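(* Let $X$ be a second countable compact Hausdorff space and $\sigma:X\to X$ a surjective local homeomorphism. Let $\psi:X\to(0,\infty)$ be a unital full potential and let $\mu_\psi$ be a probability measure on $X$, quasi-invariant for $G(X,\sigma)$, that is invariant for the dual of the transfer operator $\mathcal L_\psi$, i.e. $\int_X\mathcal L_\psi(f)\,d\mu_\psi=\int_X f\,d\mu_\psi$ for all $f\in C(X)$. Assume that (i) the equivalence relation $R_\infty=\bigcup_{n\ge0}\{(x,y):\sigma^n(x)=\sigma^n(y)\}$ is minimal; (ii) there is an integer $L\ge1$ such that $\sigma^L$ admits a generator; (iii) there is an integer $M\ge1$ such that $\psi_M$ satisfies Bowen's condition with respect to $\sigma^M$. Let $\hat L=(\mu_\psi,X*\mathcal H,\hat L)$ be a unitary representation of $G(X,\sigma)$ with integrated form $\mathfrak L$. Let $m\in C(X)$ be a $\psi$-filter such that $\mu_\psi(\{x\in X:|m(x)|\ne1\})>0$, and put $\mathfrak u=\sqrt\psi\,m$. Then the isometry $\tilde S_{\mathfrak u}=\mathfrak L(S_{\mathfrak u})$ on $L^2(X*\mathcal H,\mu_\psi)$ is a pure isometry.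
   Context: **Transfer operators and filters.** A potential is a continuous $\psi:X\to[0,\infty)$; its transfer operator is $\mathcal L_\psi(f)(x)=\sum_{\sigma(y)=x}\psi(y)f(y)$ on $C(X)$. It is full if nowhere zero, and unital (normalized) if $\mathcal L_\psi(1)=1$. A $\psi$-filter is $m\in C(X)$ (complex valued) with $\mathcal L_\psi(|m|^2)=1$. For $n\ge1$, $\psi_n(x)=\prod_{i=0}^{n-1}\psi(\sigma^i(x))$. **Hypotheses (i)–(iii).** $R_\infty$ is minimal if every equivalence class is dense in $X$. A continuous map $T:X\to X$ admits a generator if there is a finite open cover $\mathcal U$ of $X$ such that for every sequence $(U_n)_{n\ge0}$ in $\mathcal U$ the set $\bigcap_{n\ge0}T^{-n}(\overline{U_n})$ has at most one point. A positive continuous function $g$ on $X$ satisfies Bowen's condition with respect to $T$ if, for a compatible metric $d$ on $X$, there are $\delta>0$ and $C>0$ such that for all $n\ge1$ and $x,y\in X$ with $d(T^kx,T^ky)\le\delta$ for $0\le k\le n-1$, one has $\big|\sum_{k=0}^{n-1}(\log g(T^kx)-\log g(T^ky))\big|\le C$. **Groupoid.** $G(X,\sigma)=\{(x,n,y)\in X\times\mathbb Z\times X:\exists k,l\ge0,\ n=k-l,\ \sigma^k(x)=\sigma^l(y)\}$, with $(x,n,y)(y,m,z)=(x,n+m,z)$, $(x,n,y)^{-1}=(y,-n,x)$, range $x$ and source $y$; basic open sets are $\{(x,k-l,y):x\in U,y\in V,\sigma^k(x)=\sigma^l(y)\}$ with $U,V$ open and $\sigma^k|_U,\sigma^l|_V$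 homeomorphisms onto the same open set. It is étale and is given the counting measure Haar system $\lambda$. The modular function of $\mu_\psi$, $\Delta_\psi=d(\mu_\psi\circ\lambda)/d(\mu_\psi\circ\lambda)^{-1}$, is $\Delta_\psi(x,k-l,y)=\psi_k(x)/\psi_l(y)$. **Representations.** $\hat L=(\mu_\psi,X*\mathcal H,\hat L)$ consists of a Borel Hilbert bundle $X*\mathcal H=\{H_x\}_{x\in X}$ and a Borel homomorphism $\gamma\mapsto L_\gamma$ with $L_\gamma:H_{s(\gamma)}\to H_{r(\gamma)}$ unitary. Its integrated form on the square integrable sections $L^2(X*\mathcal H,\mu_\psi)$ is $\mathfrak L(f)\mathfrak h(x)=\sum_{r(\gamma)=x}f(\gamma)L_\gamma\mathfrak h(s(\gamma))\Delta_\psi(\gamma)^{-1/2}$. $S_{\mathfrak u}\in C_c(G(X,\sigma))$ is the isometry $S_{\mathfrak u}(x,n,y)=\mathfrak u(x)$ if $n=1$, $y=\sigma(x)$, and $0$ otherwise; thus $\tilde S_{\mathfrak u}\mathfrak h(x)=m(x)L_{(x,1,\sigma(x))}\mathfrak h(\sigma(x))$. An isometry $S$ on a Hilbert space $H$ is pure if $\bigcap_{n\ge0}S^nH=\{0\}$. *)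

theory Defs
  imports "HOL-Probability.Probability_Measure" "HOL-Analysis.Analysis" "HOL-Algebra.Module"
begin

section \<open>Local homeomorphisms, potentials, transfer operators\<close>

definition local_homeo :: "('a::topological_space \<Rightarrow> 'b::topological_space) \<Rightarrow> bool" where
  "local_homeo f \<longleftrightarrow>
     (\<forall>x. \<exists>U V g. open U \<and> x \<in> U \<and> open V \<and> homeomorphism U V f g)"

definition potential :: "('x::topological_space \<Rightarrow> real) \<Rightarrow> bool" where
  "potential \<psi> \<longleftrightarrow> continuous_on UNIV \<psi> \<and> (\<forall>x. 0 \<le> \<psi> x)"

definition full_potential :: "('x::topological_space \<Rightarrow> real) \<Rightarrow> bool" where
  "full_potential \<psi> \<longleftrightarrow> potential \<psi> \<and> (\<forall>x. \<psi> x \<noteq> 0)"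

text \<open>When the domain of \<open>\<sigma>\<close> is compact and \<open>\<sigma>\<close> is a local homeomorphism, the fibres of \<open>\<sigma>\<close>
  are finite, so the sum below is the ordinary one. The operator acts on complex-valued functions.\<close>

definition transfer_op :: "('x \<Rightarrow> 'x) \<Rightarrow> ('x \<Rightarrow> real) \<Rightarrow> ('x \<Rightarrow> complex) \<Rightarrow> 'x \<Rightarrow> complex" where
  "transfer_op \<sigma> \<psi> f x = (\<Sum>y | \<sigma> y = x. complex_of_real (\<psi> y) * f y)"

definition unital_potential :: "('x \<Rightarrow> 'x) \<Rightarrow> ('x::topological_space \<Rightarrow> real) \<Rightarrow> bool" where
  "unital_potential \<sigma> \<psi> \<longleftrightarrow> potential \<psi> \<and> transfer_op \<sigma> \<psi> (\<lambda>_. 1) = (\<lambda>_. 1)"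

definition dual_invariant ::
    "('x \<Rightarrow> 'x) \<Rightarrow> ('x::topological_space \<Rightarrow> real) \<Rightarrow> 'x measure \<Rightarrow> bool" where
  "dual_invariant \<sigma> \<psi> \<mu> \<longleftrightarrow>
     (\<forall>f. continuous_on UNIV f \<longrightarrow> (\<integral>x. transfer_op \<sigma> \<psi> f x \<partial>\<mu>) = (\<integral>x. f x \<partial>\<mu>))"

definition potential_filter ::
    "('x \<Rightarrow> 'x) \<Rightarrow> ('x::topological_space \<Rightarrow> real) \<Rightarrow> ('x \<Rightarrow> complex) \<Rightarrow> bool" where
  "potential_filter \<sigma> \<psi> m \<longleftrightarrow> continuous_on UNIV m \<and>
     transfer_op \<sigma> \<psi> (\<lambda>x. complex_of_real ((cmod (m x))\<^sup>2)) = (\<lambda>_. 1)"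

definition iter_potential :: "('x \<Rightarrow> 'x) \<Rightarrow> ('x \<Rightarrow> real) \<Rightarrow> nat \<Rightarrow> 'x \<Rightarrow> real" where
  "iter_potential \<sigma> \<psi> n x = (\<Prod>i<n. \<psi> ((\<sigma> ^^ i) x))"


section \<open>Minimality, generators, Bowen's condition\<close>

definition R_infinity :: "('x \<Rightarrow> 'x) \<Rightarrow> ('x \<times> 'x) set" where
  "R_infinity \<sigma> = (\<Union>n. {(x, y). (\<sigma> ^^ n) x = (\<sigma> ^^ n) y})"

definition minimal_rel :: "('x::topological_space \<times> 'x) set \<Rightarrow> bool" where
  "minimal_rel R \<longleftrightarrow> (\<forall>x. closure (R `` {x}) = UNIV)"

definition admits_generator :: "('x::topological_space \<Rightarrow> 'x) \<Rightarrow> bool" where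
  "admits_generator T \<longleftrightarrow>
     (\<exists>\<U>. finite \<U> \<and> (\<forall>U\<in>\<U>. open U) \<and> \<Union>\<U> = UNIV \<and>
       (\<forall>U :: nat \<Rightarrow> 'x set. (\<forall>n. U n \<in> \<U>) \<longrightarrow>
          (\<forall>x y. x \<in> (\<Inter>n. (T ^^ n) -` closure (U n)) \<and> y \<in> (\<Inter>n. (T ^^ n) -` closure (U n))
             \<longrightarrow> x = y)))"

definition bowen_condition ::
    "('x::topological_space \<Rightarrow> 'x) \<Rightarrow> ('x \<Rightarrow> real) \<Rightarrow> bool" where
  "bowen_condition T g \<longleftrightarrow>
     (\<exists>d. Metric_space UNIV d \<and> Metric_space.mtopology UNIV d = euclidean \<and>
       (\<exists>\<delta>>0. \<exists>C>0. \<forall>n\<ge>1. \<forall>x y.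
          (\<forall>k<n. d ((T ^^ k) x) ((T ^^ k) y) \<le> \<delta>) \<longrightarrow>
          \<bar>\<Sum>k<n. ln (g ((T ^^ k) x)) - ln (g ((T ^^ k) y))\<bar> \<le> C))"


section \<open>The groupoid of a local homeomorphism\<close>

type_synonym 'x arrow = "'x \<times> int \<times> 'x"

definition gpd :: "('x \<Rightarrow> 'x) \<Rightarrow> 'x arrow set" where
  "gpd \<sigma> = {(x, n, y). \<exists>k l :: nat. n = int k - int l \<and> (\<sigma> ^^ k) x = (\<sigma> ^^ l) y}"

definition gpd_range :: "'x arrow \<Rightarrow> 'x" where
  "gpd_range \<gamma> = fst \<gamma>"

definition gpd_source :: "'x arrow \<Rightarrow> 'x" where
  "gpd_source \<gamma> = snd (snd \<gamma>)"

text \<open>The product is only meaningful when the source of the first arrow is the range of the second.\<close>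

definition gpd_mult :: "'x arrow \<Rightarrow> 'x arrow \<Rightarrow> 'x arrow" where
  "gpd_mult \<gamma> \<eta> = (fst \<gamma>, fst (snd \<gamma>) + fst (snd \<eta>), snd (snd \<eta>))"

definition gpd_inverse :: "'x arrow \<Rightarrow> 'x arrow" where
  "gpd_inverse \<gamma> = (snd (snd \<gamma>), - fst (snd \<gamma>), fst \<gamma>)"

definition gpd_basic ::
    "('x \<Rightarrow> 'x) \<Rightarrow> 'x set \<Rightarrow> nat \<Rightarrow> nat \<Rightarrow> 'x set \<Rightarrow> 'x arrow set" where
  "gpd_basic \<sigma> U k l V =
     {(x, int k - int l, y) | x y. x \<in> U \<and> y \<in> V \<and> (\<sigma> ^^ k) x = (\<sigma> ^^ l) y}"

definition gpd_topology :: "('x::topological_space \<Rightarrow> 'x) \<Rightarrow> 'x arrow topology" where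
  "gpd_topology \<sigma> = topology_generated_by
     {gpd_basic \<sigma> U k l V | U k l V. open U \<and> open V \<and>
        (\<exists>W g h. open W \<and> homeomorphism U W (\<sigma> ^^ k) g \<and> homeomorphism V W (\<sigma> ^^ l) h)}"

definition gpd_borel :: "('x::topological_space \<Rightarrow> 'x) \<Rightarrow> 'x arrow measure" where
  "gpd_borel \<sigma> = sigma (gpd \<sigma>) {U. openin (gpd_topology \<sigma>) U}"

text \<open>The measure \<open>\<mu> \<circ> \<lambda> = \<integral> \<lambda>\<^sup>x d\<mu>(x)\<close>, where \<open>\<lambda>\<^sup>x\<close> is counting measure on the
  arrows with range \<open>x\<close>, and its image under inversion.\<close>

definition gpd_measure :: "('x::topological_space \<Rightarrow> 'x) \<Rightarrow> 'x measure \<Rightarrow> 'x arrow measure" where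
  "gpd_measure \<sigma> \<mu> = measure_of (gpd \<sigma>) (sets (gpd_borel \<sigma>))
     (\<lambda>E. \<integral>\<^sup>+x. emeasure (count_space UNIV) {\<gamma> \<in> E. gpd_range \<gamma> = x} \<partial>\<mu>)"

definition gpd_measure_inv :: "('x::topological_space \<Rightarrow> 'x) \<Rightarrow> 'x measure \<Rightarrow> 'x arrow measure" where
  "gpd_measure_inv \<sigma> \<mu> = distr (gpd_measure \<sigma> \<mu>) (gpd_borel \<sigma>) gpd_inverse"

definition quasi_invariant :: "('x::topological_space \<Rightarrow> 'x) \<Rightarrow> 'x measure \<Rightarrow> bool" where
  "quasi_invariant \<sigma> \<mu> \<longleftrightarrow>
     absolutely_continuous (gpd_measure \<sigma> \<mu>) (gpd_measure_inv \<sigma> \<mu>) \<and>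
     absolutely_continuous (gpd_measure_inv \<sigma> \<mu>) (gpd_measure \<sigma> \<mu>)"

text \<open>The continuous version \<open>\<Delta>\<^sub>\<psi>(x, k - l, y) = \<psi>\<^sub>k(x) / \<psi>\<^sub>l(y)\<close>, for \<open>\<sigma>\<^sup>k(x) = \<sigma>\<^sup>l(y)\<close>, of the
  Radon-Nikodym derivative of \<open>\<mu> \<circ> \<lambda>\<close> with respect to its image under inversion, for a
  measure \<open>\<mu>\<close> that is invariant for the dual of the transfer operator of \<open>\<psi>\<close>. For nowhere
  vanishing \<open>\<psi>\<close> the quotient depends only on the arrow (lemma \<open>modular_fun_eq\<close> below).\<close>

definition modular_fun :: "('x \<Rightarrow> 'x) \<Rightarrow> ('x \<Rightarrow> real) \<Rightarrow> 'x arrow \<Rightarrow> real" where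
  "modular_fun \<sigma> \<psi> \<gamma> = (THE r. \<exists>k l :: nat. fst (snd \<gamma>) = int k - int l \<and>
     (\<sigma> ^^ k) (gpd_range \<gamma>) = (\<sigma> ^^ l) (gpd_source \<gamma>) \<and>
     r = iter_potential \<sigma> \<psi> k (gpd_range \<gamma>) / iter_potential \<sigma> \<psi> l (gpd_source \<gamma>))"

lemma iter_potential_quotient_add:
  assumes "\<And>x. \<psi> x \<noteq> 0" "(\<sigma> ^^ k) x = (\<sigma> ^^ l) y"
  shows "iter_potential \<sigma> \<psi> (j + k) x / iter_potential \<sigma> \<psi> (j + l) y
       = iter_potential \<sigma> \<psi> k x / iter_potential \<sigma> \<psi> l y"
proof (induction j)
  case (Suc j)
  have "(\<sigma> ^^ (j + k)) x = (\<sigma> ^^ (j + l)) y"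
    using assms(2) by (simp add: funpow_add)
  then show ?case
    using Suc assms(1) by (simp add: iter_potential_def)
qed simp

lemma modular_fun_eq:
  assumes nz: "\<And>x. \<psi> x \<noteq> 0" and eq: "(\<sigma> ^^ k) x = (\<sigma> ^^ l) y"
  shows "modular_fun \<sigma> \<psi> (x, int k - int l, y)
       = iter_potential \<sigma> \<psi> k x / iter_potential \<sigma> \<psi> l y"
  unfolding modular_fun_def
proof (rule the_equality, goal_cases)
  case 1
  show ?case
    using eq by (auto simp: gpd_range_def gpd_source_def)
next
  case (2 r)
  then obtain k' l' where *: "int k - int l = int k' - int l'" "(\<sigma> ^^ k') x = (\<sigma> ^^ l') y"
      "r = iter_potential \<sigma> \<psi> k' x / iter_potential \<sigma> \<psi> l' y"
    by (auto simp: gpd_range_def gpd_source_def)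
  show ?case
  proof (cases "k \<le> k'")
    case True
    then have "k' = (k' - k) + k" "l' = (k' - k) + l"
      using *(1) by auto
    then show ?thesis
      using iter_potential_quotient_add[where \<psi> = \<psi> and \<sigma> = \<sigma> and k = k and x = x
          and l = l and y = y and j = "k' - k"] nz eq *(3) by simp
  next
    case False
    then have "k = (k - k') + k'" "l = (k - k') + l'"
      using *(1) by auto
    then show ?thesis
      using iter_potential_quotient_add[where \<psi> = \<psi> and \<sigma> = \<sigma> and k = k' and x = x
          and l = l' and y = y and j = "k - k'"] nz *(2,3) by simp
  qed
qed


section \<open>Hilbert spaces on carrier sets\<close>

definition complex_ring :: "complex ring" where
  "complex_ring = \<lparr>carrier = UNIV, monoid.mult = (*), one = 1, zero = 0, add = (+)\<rparr>"

text \<open>The fields \<^const>\<open>monoid.mult\<close> and \<^const>\<open>monoid.one\<close> inherited by the library's module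
  record play no role. Inner products are linear in the first variable.\<close>

record 'h inner_space = "(complex, 'h) module" +
  cinner :: "'h \<Rightarrow> 'h \<Rightarrow> complex"

definition hnorm :: "'h inner_space \<Rightarrow> 'h \<Rightarrow> real" where
  "hnorm K v = sqrt (Re (cinner K v v))"

definition hilbert_space :: "'h inner_space \<Rightarrow> bool" where
  "hilbert_space K \<longleftrightarrow> module complex_ring K \<and>
     (\<forall>u\<in>carrier K. \<forall>v\<in>carrier K. \<forall>w\<in>carrier K.
        cinner K (u \<oplus>\<^bsub>K\<^esub> v) w = cinner K u w + cinner K v w) \<and>
     (\<forall>c. \<forall>v\<in>carrier K. \<forall>w\<in>carrier K. cinner K (c \<odot>\<^bsub>K\<^esub> v) w = c * cinner K v w) \<and>
     (\<forall>v\<in>carrier K. \<forall>w\<in>carrier K. cinner K w v = cnj (cinner K v w)) \<and>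
     (\<forall>v\<in>carrier K. 0 \<le> Re (cinner K v v)) \<and>
     (\<forall>v\<in>carrier K. cinner K v v = 0 \<longrightarrow> v = \<zero>\<^bsub>K\<^esub>) \<and>
     Metric_space.mcomplete (carrier K) (\<lambda>v w. hnorm K (v \<ominus>\<^bsub>K\<^esub> w))"

definition linear_operator ::
    "'h inner_space \<Rightarrow> 'k inner_space \<Rightarrow> ('h \<Rightarrow> 'k) \<Rightarrow> bool" where
  "linear_operator H K T \<longleftrightarrow> T \<in> carrier H \<rightarrow> carrier K \<and>
     (\<forall>v\<in>carrier H. \<forall>w\<in>carrier H. T (v \<oplus>\<^bsub>H\<^esub> w) = T v \<oplus>\<^bsub>K\<^esub> T w) \<and>
     (\<forall>c. \<forall>v\<in>carrier H. T (c \<odot>\<^bsub>H\<^esub> v) = c \<odot>\<^bsub>K\<^esub> T v)"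

definition unitary_operator ::
    "'h inner_space \<Rightarrow> 'k inner_space \<Rightarrow> ('h \<Rightarrow> 'k) \<Rightarrow> bool" where
  "unitary_operator H K U \<longleftrightarrow> linear_operator H K U \<and> U ` carrier H = carrier K \<and>
     (\<forall>v\<in>carrier H. \<forall>w\<in>carrier H. cinner K (U v) (U w) = cinner H v w)"

definition isometry_on :: "'h inner_space \<Rightarrow> ('h \<Rightarrow> 'h) \<Rightarrow> bool" where
  "isometry_on H S \<longleftrightarrow> linear_operator H H S \<and> (\<forall>v\<in>carrier H. hnorm H (S v) = hnorm H v)"

definition pure_isometry :: "'h inner_space \<Rightarrow> ('h \<Rightarrow> 'h) \<Rightarrow> bool" where
  "pure_isometry H S \<longleftrightarrow> isometry_on H S \<and> (\<Inter>n. (S ^^ n) ` carrier H) = {\<zero>\<^bsub>H\<^esub>}"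


section \<open>Borel Hilbert bundles and their square integrable sections\<close>

text \<open>A bundle is a family \<open>H\<close> of Hilbert spaces, whose carriers lie in one type but need not be
  related in any way, with a Borel structure \<open>B\<close> on the total space \<open>{(x, v). v \<in> H\<^sub>x}\<close>. There is
  a fundamental sequence \<open>f\<^sub>n\<close> of sections: the functions \<open>(x, v) \<mapsto> (v | f\<^sub>n(x))\<close> and the
  projection separate points, \<open>x \<mapsto> (f\<^sub>n(x) | f\<^sub>m(x))\<close> is Borel, and \<open>B\<close> is generated by the
  projection and the functions \<open>(x, v) \<mapsto> (v | f\<^sub>n(x))\<close>. (If \<open>B\<close> is analytic, the last clause
  amounts to these maps being Borel for \<open>B\<close>.) Separability of the fibres follows.\<close>

definition borel_hilbert_bundle ::
    "('x::topological_space \<Rightarrow> 'h inner_space) \<Rightarrow> ('x \<times> 'h) measure \<Rightarrow> bool" where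
  "borel_hilbert_bundle H B \<longleftrightarrow> (\<forall>x. hilbert_space (H x)) \<and>
     (\<exists>f :: nat \<Rightarrow> 'x \<Rightarrow> 'h.
        (\<forall>n x. f n x \<in> carrier (H x)) \<and>
        (\<forall>n m. (\<lambda>x. cinner (H x) (f n x) (f m x)) \<in> borel_measurable borel) \<and>
        (\<forall>x. \<forall>v\<in>carrier (H x). \<forall>w\<in>carrier (H x).
           (\<forall>n. cinner (H x) v (f n x) = cinner (H x) w (f n x)) \<longrightarrow> v = w) \<and>
        sets B = sets (vimage_algebra (SIGMA x:UNIV. carrier (H x))
                         (\<lambda>(x, v). (x, \<lambda>n. cinner (H x) v (f n x)))
                         (borel \<Otimes>\<^sub>M (\<Pi>\<^sub>M n\<in>UNIV. borel))))"

definition borel_section ::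
    "('x::topological_space \<Rightarrow> 'h inner_space) \<Rightarrow> ('x \<times> 'h) measure \<Rightarrow> ('x \<Rightarrow> 'h) \<Rightarrow> bool" where
  "borel_section H B h \<longleftrightarrow>
     (\<forall>x. h x \<in> carrier (H x)) \<and> (\<lambda>x. (x, h x)) \<in> measurable borel B"

definition L2_sections ::
    "('x::topological_space \<Rightarrow> 'h inner_space) \<Rightarrow> ('x \<times> 'h) measure \<Rightarrow> 'x measure \<Rightarrow> ('x \<Rightarrow> 'h) set" where
  "L2_sections H B \<mu> = {h. borel_section H B h \<and> integrable \<mu> (\<lambda>x. (hnorm (H x) (h x))\<^sup>2)}"

definition ae_eq ::
    "('x::topological_space \<Rightarrow> 'h inner_space) \<Rightarrow> ('x \<times> 'h) measure \<Rightarrow> 'x measure \<Rightarrow>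
     (('x \<Rightarrow> 'h) \<times> ('x \<Rightarrow> 'h)) set" where
  "ae_eq H B \<mu> = {(h, k). h \<in> L2_sections H B \<mu> \<and> k \<in> L2_sections H B \<mu> \<and> (AE x in \<mu>. h x = k x)}"

text \<open>The Hilbert space of classes of square integrable Borel sections modulo almost everywhere
  equality, with pointwise operations on representatives.\<close>

definition L2_space ::
    "('x::topological_space \<Rightarrow> 'h inner_space) \<Rightarrow> ('x \<times> 'h) measure \<Rightarrow> 'x measure \<Rightarrow>
     ('x \<Rightarrow> 'h) set inner_space" where
  "L2_space H B \<mu> = \<lparr>
     carrier = L2_sections H B \<mu> // ae_eq H B \<mu>,
     monoid.mult = undefined,
     one = undefined,
     zero = {k \<in> L2_sections H B \<mu>. AE x in \<mu>. k x = \<zero>\<^bsub>H x\<^esub>},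
     add = (\<lambda>a b. {k \<in> L2_sections H B \<mu>.
              \<exists>g\<in>a. \<exists>h\<in>b. AE x in \<mu>. k x = g x \<oplus>\<^bsub>H x\<^esub> h x}),
     smult = (\<lambda>c a. {k \<in> L2_sections H B \<mu>. \<exists>h\<in>a. AE x in \<mu>. k x = c \<odot>\<^bsub>H x\<^esub> h x}),
     cinner = (\<lambda>a b. THE c. \<exists>g\<in>a. \<exists>h\<in>b. c = (\<integral>x. cinner (H x) (g x) (h x) \<partial>\<mu>))\<rparr>"


section \<open>Unitary representations and integrated forms\<close>

text \<open>Borel measurability of \<open>\<gamma> \<mapsto> L\<^sub>\<gamma>\<close> refers to the usual Borel structure on the isomorphism
  groupoid of the bundle, the weakest one making \<open>(x, V, y) \<mapsto> (V f(y) | g(x))\<close> Borel for all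
  Borel sections \<open>f\<close> and \<open>g\<close>.\<close>

definition unitary_representation ::
    "('x::topological_space \<Rightarrow> 'x) \<Rightarrow> ('x \<Rightarrow> 'h inner_space) \<Rightarrow> ('x \<times> 'h) measure \<Rightarrow>
     ('x arrow \<Rightarrow> 'h \<Rightarrow> 'h) \<Rightarrow> bool" where
  "unitary_representation \<sigma> H B L \<longleftrightarrow> borel_hilbert_bundle H B \<and>
     (\<forall>\<gamma>\<in>gpd \<sigma>. unitary_operator (H (gpd_source \<gamma>)) (H (gpd_range \<gamma>)) (L \<gamma>)) \<and>
     (\<forall>\<gamma>\<in>gpd \<sigma>. \<forall>\<eta>\<in>gpd \<sigma>. gpd_source \<gamma> = gpd_range \<eta> \<longrightarrow>
        (\<forall>v\<in>carrier (H (gpd_source \<eta>)). L (gpd_mult \<gamma> \<eta>) v = L \<gamma> (L \<eta> v))) \<and>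
     (\<forall>f g. borel_section H B f \<and> borel_section H B g \<longrightarrow>
        (\<lambda>\<gamma>. cinner (H (gpd_range \<gamma>)) (L \<gamma> (f (gpd_source \<gamma>))) (g (gpd_range \<gamma>)))
          \<in> borel_measurable (gpd_borel \<sigma>))"

text \<open>The sum over the arrows with range \<open>x\<close> is restricted to the support of \<open>f\<close>, which meets each
  range fibre in a finite set if \<open>f\<close> is continuous with compact support.\<close>

definition integrated_section ::
    "('x \<Rightarrow> 'x) \<Rightarrow> ('x \<Rightarrow> real) \<Rightarrow> ('x \<Rightarrow> 'h inner_space) \<Rightarrow> ('x arrow \<Rightarrow> 'h \<Rightarrow> 'h) \<Rightarrow>
     ('x arrow \<Rightarrow> complex) \<Rightarrow> ('x \<Rightarrow> 'h) \<Rightarrow> 'x \<Rightarrow> 'h" where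
  "integrated_section \<sigma> \<psi> H L f h x =
     (\<Oplus>\<^bsub>H x\<^esub>\<gamma>\<in>{\<gamma> \<in> gpd \<sigma>. gpd_range \<gamma> = x \<and> f \<gamma> \<noteq> 0}.
        (f \<gamma> * complex_of_real (modular_fun \<sigma> \<psi> \<gamma> powr (- 1 / 2))) \<odot>\<^bsub>H x\<^esub> L \<gamma> (h (gpd_source \<gamma>)))"

definition integrated_form ::
    "('x::topological_space \<Rightarrow> 'x) \<Rightarrow> ('x \<Rightarrow> real) \<Rightarrow> 'x measure \<Rightarrow> ('x \<Rightarrow> 'h inner_space) \<Rightarrow>
     ('x \<times> 'h) measure \<Rightarrow> ('x arrow \<Rightarrow> 'h \<Rightarrow> 'h) \<Rightarrow> ('x arrow \<Rightarrow> complex) \<Rightarrow>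
     ('x \<Rightarrow> 'h) set \<Rightarrow> ('x \<Rightarrow> 'h) set" where
  "integrated_form \<sigma> \<psi> \<mu> H B L f a =
     {k \<in> L2_sections H B \<mu>. \<exists>h\<in>a. AE x in \<mu>. k x = integrated_section \<sigma> \<psi> H L f h x}"

definition S_fun :: "('x \<Rightarrow> 'x) \<Rightarrow> ('x \<Rightarrow> complex) \<Rightarrow> 'x arrow \<Rightarrow> complex" where
  "S_fun \<sigma> u \<gamma> = (case \<gamma> of (x, n, y) \<Rightarrow> if n = 1 \<and> y = \<sigma> x then u x else 0)"

end

theory Submission
  imports Defs
begin

text \<open>
  Write \<open>p = |m|\<^sup>2\<close> and let \<open>S\<close> be the isometry, so that \<open>S h(x) = m(x) L\<^sub>x h(\<sigma> x)\<close> with \<open>L\<^sub>x\<close> unitary.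
  Passing to pointwise norms forgets the representation: \<open>|S h|\<^sup>2 = p \<cdot> |h|\<^sup>2 \<circ> \<sigma>\<close>. If \<open>h = S\<^sup>n k\<close>, the
  functions \<open>b\<^sub>i = |S\<^bsup>n-i\<^esup> k|\<^sup>2\<close> therefore form a chain \<open>b\<^sub>0 = |h|\<^sup>2\<close>, \<open>b\<^sub>i = p \<cdot> b\<^sub>i\<^sub>+\<^sub>1 \<circ> \<sigma>\<close> of length \<open>n\<close>. The
  transfer operator \<open>\<L>\<close> satisfies \<open>\<integral> F \<cdot> (\<phi> \<circ> \<sigma>) d\<mu> = \<integral> \<L>(F) \<cdot> \<phi> d\<mu>\<close> and \<open>\<L>(p) = 1\<close> by the filter
  equation, hence \<open>b\<^sub>i \<mu>\<close> is the image of \<open>|h|\<^sup>2 \<mu>\<close> under \<open>\<sigma>\<^sup>i\<close>.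

  The dynamical input is that \<open>\<mu>\<close> is exact: for integrable \<open>g\<close> the image of \<open>g \<mu>\<close> under \<open>\<sigma>\<^sup>n\<close> tends in
  total variation to the multiple \<open>(\<integral> g d\<mu>) \<mu>\<close> (lemma \<open>exactness\<close>). So \<open>b\<^sub>n\<close> and \<open>b\<^sub>n\<^sub>+\<^sub>1\<close> are both close
  in \<open>L\<^sup>1(\<mu>)\<close> to the constant \<open>c = \<integral> |h|\<^sup>2 d\<mu>\<close>. Inserting this into \<open>b\<^sub>n = p \<cdot> b\<^sub>n\<^sub>+\<^sub>1 \<circ> \<sigma>\<close> and using that
  \<open>G \<mapsto> p \<cdot> G \<circ> \<sigma>\<close> preserves the \<open>L\<^sup>1\<close> norm gives \<open>c = c p\<close> almost everywhere. Since \<open>|m| \<noteq> 1\<close> on a set of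
  positive measure, \<open>c = 0\<close>, that is \<open>h = 0\<close> (theorem \<open>weight_rigidity\<close>).

  Exactness follows from the uniform convergence of \<open>\<L>\<^sup>n f\<close> to a constant for continuous \<open>f\<close>, by
  density of continuous functions in \<open>L\<^sup>1\<close>. For the convergence, a generator makes \<open>\<sigma>\<close> expansive, so
  that for nearby points \<open>x\<close>, \<open>x'\<close> the fibres of every \<open>\<sigma>\<^sup>n\<close> can be matched by points whose first \<open>n\<close>
  iterates stay close (lemma \<open>fibre_matching\<close>). Bowen's condition then compares the weights along
  matched branches with a constant that does not depend on \<open>n\<close>, which is a Harnack inequality for
  \<open>\<L>\<^sup>n F\<close> on small balls (lemma \<open>harnack\<close>). By minimality some fixed \<open>\<sigma>\<^sup>N\<close> has fibres that meet every small
  ball, and one more application of \<open>\<L>\<^sup>N\<close> turns this into a global inequality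
  \<open>\<kappa> \<cdot> max \<L>\<^sup>n F - \<epsilon> \<le> min \<L>\<^sup>n\<^sup>+\<^sup>N F\<close>. Applied to \<open>F = \<L>\<^sup>k f - min \<L>\<^sup>k f\<close> it forces the oscillation of
  \<open>\<L>\<^sup>n f\<close> to \<open>0\<close>.

  What remains is to see that \<open>S\<close> really is an isometry of the space of classes of Borel sections.
  Measurability is obtained from that of the representation, by restricting its coefficients to the
  arrows \<open>(x, 1, \<sigma> x)\<close>, and to the units for inner products of sections.
\<close>


section \<open>Compact spaces with a compatible metric\<close>

lemma compact_UNIV_finite_subcover:
  fixes U :: "'i \<Rightarrow> 'x::topological_space set"
  assumes "compact (UNIV :: 'x set)" "\<And>i. open (U i)" "\<And>x. \<exists>i. x \<in> U i"
  obtains J where "finite J" "\<And>x. \<exists>i\<in>J. x \<in> U i"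
proof -
  have "UNIV \<subseteq> (\<Union>i\<in>UNIV. U i)" using assms(3) by blast
  then obtain J where "finite J" "UNIV \<subseteq> (\<Union>i\<in>J. U i)"
    by (rule compactE_image[OF assms(1), where C = UNIV and f = U, rotated]) (use assms(2) in auto)
  then show ?thesis by (intro that[of J]) auto
qed

text \<open>A compatible metric is a parameter here, because the type of points only carries a topology and
  the metric is supplied by Bowen's condition.\<close>

locale metrized_compact =
  fixes d :: "'x::{second_countable_topology,t2_space} \<Rightarrow> 'x \<Rightarrow> real"
  assumes compact_UNIV: "compact (UNIV :: 'x set)"
    and metric: "Metric_space UNIV d"
    and mtopology_eq: "Metric_space.mtopology UNIV d = euclidean"
begin

interpretation Metric_space UNIV d by (rule metric)

lemma d_refl [simp]: "d x x = 0" by simp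
lemma d_nonneg [simp]: "0 \<le> d x y" by simp
lemma d_eq_0: "d x y = 0 \<longleftrightarrow> x = y" by simp
lemma d_commute: "d x y = d y x" by (rule commute)
lemma d_triangle: "d x z \<le> d x y + d y z" using triangle by simp

lemma continuous_d: "continuous_on UNIV (\<lambda>p. d (fst p) (snd p))"
proof -
  have "continuous_map (prod_topology euclidean euclidean) euclideanreal (\<lambda>p. d (fst p) (snd p))"
    using continuous_map_mdist[of "prod_topology euclidean euclidean" Self fst snd]
    by (simp add: mtopology_eq mtopology_of_def continuous_on_fst continuous_on_snd)
  then show ?thesis by (simp add: euclidean_product_topology)
qed

lemma continuous_on_d [continuous_intros]:
  assumes "continuous_on A f" "continuous_on A g"
  shows "continuous_on A (\<lambda>z. d (f z) (g z))"
  using continuous_on_compose2[OF continuous_d continuous_on_Pair[OF assms]] by simp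

lemma open_ball_d: "open {y. d x y < r}"
  by (intro open_Collect_less continuous_intros)

lemma open_contains_ball_d:
  assumes "open U" "x \<in> U"
  obtains r where "r > 0" "\<And>y. d x y < r \<Longrightarrow> y \<in> U"
proof -
  have "openin mtopology U" using assms by (simp add: mtopology_eq)
  then obtain r where "r > 0" "mball x r \<subseteq> U" using assms unfolding openin_mtopology by blast
  then show ?thesis using that[of r] by (auto simp: subset_iff)
qed

text \<open>Compactness of the square, in the form used throughout: uniform continuity and Lebesgue numbers
  of finite covers are both instances.\<close>

lemma closed_off_diagonal:
  assumes "closed K" "\<And>x. (x, x) \<notin> K"
  obtains r where "r > 0" "\<And>x y. d x y < r \<Longrightarrow> (x, y) \<notin> K"
proof (cases "K = {}")
  case True then show ?thesis using that[of 1] by simp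
next
  case False
  have "compact (UNIV :: ('x \<times> 'x) set)"
    using compact_Times[OF compact_UNIV compact_UNIV] by simp
  then have K: "compact K" using assms(1) compact_Int_closed[of UNIV K] by simp
  obtain p where p: "p \<in> K" "\<And>q. q \<in> K \<Longrightarrow> d (fst p) (snd p) \<le> d (fst q) (snd q)"
    using continuous_attains_inf[OF K False continuous_on_subset[OF continuous_d]] by auto
  have "fst p \<noteq> snd p" using assms(2) p(1) by (metis prod.collapse)
  then have "d (fst p) (snd p) > 0" by (simp add: order_less_le d_eq_0)
  moreover have "(x, y) \<notin> K" if "d x y < d (fst p) (snd p)" for x y
    using p(2)[of "(x, y)"] that by auto
  ultimately show ?thesis using that by blast
qed

lemma uniformly_continuous_d:
  fixes f :: "'x \<Rightarrow> real"
  assumes "continuous_on UNIV f" "e > 0"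
  obtains r where "r > 0" "\<And>x y. d x y < r \<Longrightarrow> \<bar>f x - f y\<bar> < e"
proof -
  have "continuous_on UNIV (\<lambda>p::'x\<times>'x. f (fst p))" "continuous_on UNIV (\<lambda>p::'x\<times>'x. f (snd p))"
    by (auto intro!: continuous_on_compose2[OF assms(1)] continuous_intros)
  then have "closed {p. e \<le> \<bar>f (fst p) - f (snd p)\<bar>}"
    by (intro closed_Collect_le continuous_intros)
  then obtain r where "r > 0" "\<And>x y. d x y < r \<Longrightarrow> (x, y) \<notin> {p. e \<le> \<bar>f (fst p) - f (snd p)\<bar>}"
    by (rule closed_off_diagonal) (use assms in auto)
  then show ?thesis using that[of r] by force
qed

lemma finite_cover_common_member:
  assumes "finite \<U>" "\<And>U. U \<in> \<U> \<Longrightarrow> open U" "\<Union>\<U> = (UNIV :: 'x set)"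
  obtains r where "r > 0" "\<And>x y. d x y < r \<Longrightarrow> \<exists>U\<in>\<U>. x \<in> U \<and> y \<in> U"
proof -
  have "closed (- (\<Union>U\<in>\<U>. U \<times> U))"
    using assms by (intro closed_Compl open_UN ballI open_Times) auto
  then obtain r where "r > 0" "\<And>x y. d x y < r \<Longrightarrow> (x, y) \<notin> - (\<Union>U\<in>\<U>. U \<times> U)"
    by (rule closed_off_diagonal) (use assms in auto)
  then show ?thesis using that[of r] by force
qed

end


section \<open>Expansive local homeomorphisms\<close>

lemma local_homeo_open_map:
  assumes "local_homeo f" "open S" shows "open (f ` S)"
proof (subst open_subopen)
  show "\<forall>x\<in>f ` S. \<exists>T. open T \<and> x \<in> T \<and> T \<subseteq> f ` S"
  proof
    fix z assume "z \<in> f ` S"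
    then obtain x where x: "x \<in> S" "z = f x" by auto
    obtain U V g where U: "open U" "x \<in> U" "open V" "homeomorphism U V f g"
      using assms(1) unfolding local_homeo_def by blast
    have "openin (top_of_set V) (f ` (S \<inter> U))"
      using U(4) by (rule homeomorphism_imp_open_map) (use assms(2) in \<open>auto simp: openin_open\<close>)
    then have "open (f ` (S \<inter> U))" using U(3) openin_open_trans by blast
    then show "\<exists>T. open T \<and> z \<in> T \<and> T \<subseteq> f ` S" using x U(2) by blast
  qed
qed

lemma local_homeo_continuous:
  fixes f :: "'x::t2_space \<Rightarrow> 'y::topological_space"
  assumes "local_homeo f" shows "continuous_on UNIV f"
proof -
  have "isCont f x" for x
  proof -
    obtain U V g where U: "open U" "x \<in> U" "open V" "homeomorphism U V f g"
      using assms unfolding local_homeo_def by blast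
    then show ?thesis
      using continuous_on_eq_continuous_at[of U f] homeomorphism_cont1[of U V f g] by blast
  qed
  then show ?thesis by (simp add: continuous_at_imp_continuous_on)
qed

lemma local_homeo_locally_inj:
  assumes "local_homeo f"
  obtains U where "open U" "x \<in> U" "inj_on f U"
proof -
  obtain U V g where U: "open U" "x \<in> U" "open V" "homeomorphism U V f g"
    using assms unfolding local_homeo_def by blast
  then have "inj_on f U" by (metis homeomorphism_apply1 inj_on_inverseI)
  then show ?thesis using that U by blast
qed

text \<open>Finitely many sets on which \<open>f\<close> is injective cover the space, and each contains at most one point
  of the fibre.\<close>

lemma local_homeo_finite_fibre:
  fixes f :: "'x::topological_space \<Rightarrow> 'y::topological_space"
  assumes "local_homeo f" "compact (UNIV :: 'x set)"
  shows "finite (f -` {z})"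
proof -
  have "\<forall>x. \<exists>U. open U \<and> x \<in> U \<and> inj_on f U" using local_homeo_locally_inj[OF assms(1)] by metis
  then obtain U where U: "\<And>x. open (U x)" "\<And>x. x \<in> U x" "\<And>x. inj_on f (U x)" by metis
  obtain C where C: "finite C" "\<And>y. \<exists>x\<in>C. y \<in> U x"
    using compact_UNIV_finite_subcover[OF assms(2), of U] U by metis
  have "finite (f -` {z} \<inter> U x)" for x
  proof (rule finite_subset)
    show "f -` {z} \<inter> U x \<subseteq> {inv_into (U x) f z}" using U(3)[of x] by (auto simp: inv_into_f_f)
  qed simp
  then have "finite (\<Union>x\<in>C. f -` {z} \<inter> U x)" using C(1) by blast
  moreover have "f -` {z} \<subseteq> (\<Union>x\<in>C. f -` {z} \<inter> U x)" using C(2) by blast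
  ultimately show ?thesis by (rule rev_finite_subset)
qed

text \<open>If all iterates of \<open>x\<close> and \<open>y\<close> are closer than a Lebesgue number of the generating cover, then the
  two points have a common itinerary through the cover.\<close>

lemma admits_generator_expansive:
  assumes "metrized_compact d" "admits_generator T"
  obtains e where "e > 0" "\<And>x y. (\<And>n. d ((T ^^ n) x) ((T ^^ n) y) \<le> e) \<Longrightarrow> x = y"
proof -
  interpret metrized_compact d by fact
  obtain \<U> where \<U>: "finite \<U> \<and> (\<forall>U\<in>\<U>. open U) \<and> \<Union>\<U> = UNIV \<and>
       (\<forall>U. (\<forall>n::nat. U n \<in> \<U>) \<longrightarrow>
          (\<forall>x y. x \<in> (\<Inter>n. (T ^^ n) -` closure (U n)) \<and> y \<in> (\<Inter>n. (T ^^ n) -` closure (U n))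
             \<longrightarrow> x = y))"
    using assms(2) unfolding admits_generator_def by (elim exE)
  have U: "finite \<U>" "\<Union>\<U> = UNIV" using \<U> by simp_all
  have op: "open U" if "U \<in> \<U>" for U using \<U> that by simp
  have gen: "x = y" if "\<And>n::nat. U n \<in> \<U>" "\<And>n. (T ^^ n) x \<in> closure (U n)"
    "\<And>n. (T ^^ n) y \<in> closure (U n)" for U x y
    using conjunct2[OF conjunct2[OF conjunct2[OF \<U>]], THEN spec[of _ U]] that by simp
  obtain r where r: "r > 0" "\<And>x y. d x y < r \<Longrightarrow> \<exists>U\<in>\<U>. x \<in> U \<and> y \<in> U"
    by (rule finite_cover_common_member[OF U(1) _ U(2)], erule op, rule that)
  show ?thesis
  proof (rule that[of "r/2"])
    fix x y assume *: "\<And>n. d ((T ^^ n) x) ((T ^^ n) y) \<le> r/2"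
    have "\<exists>U\<in>\<U>. (T ^^ n) x \<in> U \<and> (T ^^ n) y \<in> U" for n
      using r *[of n] by (intro r(2)) linarith
    then have "\<forall>n. \<exists>U. U \<in> \<U> \<and> (T ^^ n) x \<in> U \<and> (T ^^ n) y \<in> U" by blast
    from choice[OF this] obtain U where U: "\<And>n. U n \<in> \<U> \<and> (T ^^ n) x \<in> U n \<and> (T ^^ n) y \<in> U n"
      by blast
    show "x = y" using U by (intro gen[of U]) (auto intro: closure_subset[THEN subsetD])
  qed (use r in auto)
qed

text \<open>Expansiveness of a power \<open>\<sigma>\<^sup>l\<close> implies that of \<open>\<sigma>\<close> with the same constant, since more iterates are
  compared. This is why a generator for some power is enough.\<close>

locale expansive_local_homeo = metrized_compact d
  for d :: "'x::{second_countable_topology,t2_space} \<Rightarrow> 'x \<Rightarrow> real" +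
  fixes \<sigma> :: "'x \<Rightarrow> 'x" and e0 :: real
  assumes local_homeo: "local_homeo \<sigma>" and surj_\<sigma>: "surj \<sigma>"
    and e0_pos: "e0 > 0"
    and expansive: "\<And>x y. (\<And>n. d ((\<sigma> ^^ n) x) ((\<sigma> ^^ n) y) \<le> e0) \<Longrightarrow> x = y"
begin

lemma continuous_\<sigma>: "continuous_on UNIV \<sigma>"
  by (rule local_homeo_continuous[OF local_homeo])

lemma continuous_iterate: "continuous_on UNIV (\<sigma> ^^ n)"
proof (induction n)
  case (Suc n)
  then show ?case using continuous_on_compose2[OF continuous_\<sigma> Suc] by (simp add: o_def)
qed (simp add: id_def)

lemma finite_fibre: "finite {y. (\<sigma> ^^ n) y = x}"
proof (induction n arbitrary: x)
  case (Suc n)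
  have "{y. (\<sigma> ^^ Suc n) y = x} = (\<Union>z\<in>\<sigma> -` {x}. {y. (\<sigma> ^^ n) y = z})" by auto
  then show ?case using Suc local_homeo_finite_fibre[OF local_homeo compact_UNIV] by simp
qed simp

text \<open>The pairs that stay \<open>e0\<close>-close for \<open>k\<close> steps form closed sets with intersection the diagonal, so
  by compactness finitely many of them already push a pair to distance less than \<open>e\<close>.\<close>

lemma uniform_expansiveness:
  assumes "e > 0"
  obtains N where "\<And>n x y. N \<le> n \<Longrightarrow> (\<And>k. k \<le> n \<Longrightarrow> d ((\<sigma> ^^ k) x) ((\<sigma> ^^ k) y) \<le> e0) \<Longrightarrow> d x y < e"
proof -
  have c: "continuous_on UNIV (\<lambda>p::'x\<times>'x. (\<sigma> ^^ k) (fst p))"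
    "continuous_on UNIV (\<lambda>p::'x\<times>'x. (\<sigma> ^^ k) (snd p))" for k
    by (auto intro!: continuous_on_compose2[OF continuous_iterate] continuous_intros)
  define K where "K k = {p. d ((\<sigma> ^^ k) (fst p)) ((\<sigma> ^^ k) (snd p)) \<le> e0}" for k
  have clo: "closed (K k)" for k
    unfolding K_def by (intro closed_Collect_le continuous_intros c)
  define Z where "Z = {p. e \<le> d (fst p) (snd p)}"
  have "compact (UNIV :: ('x \<times> 'x) set)"
    using compact_Times[OF compact_UNIV compact_UNIV] by simp
  moreover have "closed Z" unfolding Z_def by (intro closed_Collect_le continuous_intros)
  ultimately have Z: "compact Z" using compact_Int_closed[of UNIV Z] by simp
  have "(\<Inter>k. K k) \<inter> Z = {}"
  proof -
    have False if "p \<in> Z" "\<And>k. p \<in> K k" for p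
    proof -
      have "fst p = snd p" using that(2) by (intro expansive) (auto simp: K_def)
      then show False using that(1) assms by (simp add: Z_def)
    qed
    then show ?thesis by blast
  qed
  then obtain J where J: "finite J" "(\<Inter>k\<in>J. K k) \<inter> Z = {}"
    using compact_imp_fip_image[OF Z, of UNIV K] clo by (metis Int_commute subset_UNIV)
  show ?thesis
  proof (rule that[of "if J = {} then 0 else Max J"])
    fix n x y assume n: "(if J = {} then 0 else Max J) \<le> n"
      and *: "\<And>k. k \<le> n \<Longrightarrow> d ((\<sigma> ^^ k) x) ((\<sigma> ^^ k) y) \<le> e0"
    have "(x, y) \<in> (\<Inter>k\<in>J. K k)"
      using n * J(1) by (auto simp: K_def split: if_splits)
    then have "(x, y) \<notin> Z" using J(2) by blast
    then show "d x y < e" by (simp add: Z_def)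
  qed
qed

text \<open>A local homeomorphism of a compact space is uniformly open: the set of pairs \<open>(y, q)\<close> such that
  \<open>q\<close> has a preimage close to \<open>y\<close> is an open neighbourhood of the graph of \<open>\<sigma>\<close>.\<close>

lemma uniform_lift:
  assumes "e > 0"
  obtains r where "r > 0" "\<And>y q. d (\<sigma> y) q < r \<Longrightarrow> \<exists>y'. \<sigma> y' = q \<and> d y y' < e"
proof -
  define W where "W = (\<lambda>p. (\<sigma> (fst p), \<sigma> (snd p))) ` {p. d (fst p) (snd p) < e}"
  define V where "V = {(y, q). \<exists>y'. \<sigma> y' = q \<and> d y y' < e}"
  have "open V"
  proof (subst open_subopen, safe)
    fix y q assume "(y, q) \<in> V"
    then obtain y' where y': "\<sigma> y' = q" "d y y' < e" by (auto simp: V_def)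
    define s where "s = (e - d y y') / 2"
    have s: "s > 0" using y' by (simp add: s_def)
    let ?T = "{z. d y z < s} \<times> \<sigma> ` {z. d y' z < s}"
    have "open ?T" by (intro open_Times local_homeo_open_map[OF local_homeo] open_ball_d)
    moreover have "(y, q) \<in> ?T" using y' s by (auto intro!: image_eqI[of _ _ y'])
    moreover have "?T \<subseteq> V"
    proof safe
      fix z z' assume "d y z < s" "d y' z' < s"
      moreover have "d z z' \<le> d z y + d y z'" "d y z' \<le> d y y' + d y' z'" by (rule d_triangle)+
      ultimately have "d z z' < e" unfolding s_def by (simp add: d_commute field_simps)
      then show "(z, \<sigma> z') \<in> V" by (auto simp: V_def)
    qed
    ultimately show "\<exists>T. open T \<and> (y, q) \<in> T \<and> T \<subseteq> V" by blast
  qed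
  moreover have cV: "compact (- V)"
  proof -
    have "compact (UNIV :: ('x \<times> 'x) set)"
      using compact_Times[OF compact_UNIV compact_UNIV] by simp
    then show ?thesis using \<open>open V\<close> compact_Int_closed[of UNIV "- V"] by (simp add: closed_Compl)
  qed
  show ?thesis
  proof (cases "- V = {}")
    case True
    then have "V = UNIV" by blast
    then have "\<exists>y'. \<sigma> y' = q \<and> d y y' < e" for y q
      using UNIV_I[of "(y, q)"] unfolding V_def by (auto simp: set_eq_iff)
    then show ?thesis using that[of 1] by simp
  next
    case False
    have "continuous_on UNIV (\<lambda>p::'x\<times>'x. d (\<sigma> (fst p)) (snd p))"
      by (intro continuous_intros continuous_on_compose2[OF continuous_\<sigma>]) auto
    then obtain p where p: "p \<in> - V" "\<And>q. q \<in> - V \<Longrightarrow> d (\<sigma> (fst p)) (snd p) \<le> d (\<sigma> (fst q)) (snd q)"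
      using continuous_attains_inf[OF cV False continuous_on_subset] by blast
    have "(fst p, snd p) \<notin> V" using p(1) by simp
    then have "\<sigma> (fst p) \<noteq> snd p" using assms by (force simp: V_def)
    then have "d (\<sigma> (fst p)) (snd p) > 0" by (simp add: order_less_le d_eq_0)
    moreover have "\<exists>y'. \<sigma> y' = q \<and> d y y' < e" if "d (\<sigma> y) q < d (\<sigma> (fst p)) (snd p)" for y q
    proof -
      have "(y, q) \<in> V" using p(2)[of "(y, q)"] that by force
      then show ?thesis by (simp add: V_def)
    qed
    ultimately show ?thesis using that by blast
  qed
qed

lemma uniform_lift_iterate:
  assumes "e > 0"
  obtains r where "r > 0" "\<And>y q n. n \<le> N \<Longrightarrow> d ((\<sigma> ^^ n) y) q < r \<Longrightarrow>
     \<exists>y'. (\<sigma> ^^ n) y' = q \<and> (\<forall>k\<le>n. d ((\<sigma> ^^ k) y) ((\<sigma> ^^ k) y') < e)"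
proof -
  have "\<exists>r>0. \<forall>y q n. n \<le> N \<longrightarrow> d ((\<sigma> ^^ n) y) q < r \<longrightarrow>
     (\<exists>y'. (\<sigma> ^^ n) y' = q \<and> (\<forall>k\<le>n. d ((\<sigma> ^^ k) y) ((\<sigma> ^^ k) y') < e))"
  proof (induction N)
    case 0
    then show ?case using assms by (intro exI[of _ e]) auto
  next
    case (Suc N)
    then obtain r where r: "r > 0" "\<And>y q n. n \<le> N \<Longrightarrow> d ((\<sigma> ^^ n) y) q < r \<Longrightarrow>
     (\<exists>y'. (\<sigma> ^^ n) y' = q \<and> (\<forall>k\<le>n. d ((\<sigma> ^^ k) y) ((\<sigma> ^^ k) y') < e))" by metis
    obtain s where s: "s > 0" "\<And>y q. d (\<sigma> y) q < s \<Longrightarrow> \<exists>y'. \<sigma> y' = q \<and> d y y' < min r e"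
      using uniform_lift[of "min r e"] r(1) assms by auto
    show ?case
    proof (intro exI[of _ "min (min r s) e"] conjI allI impI)
      fix y q n assume n: "n \<le> Suc N" and dq: "d ((\<sigma> ^^ n) y) q < min (min r s) e"
      show "\<exists>y'. (\<sigma> ^^ n) y' = q \<and> (\<forall>k\<le>n. d ((\<sigma> ^^ k) y) ((\<sigma> ^^ k) y') < e)"
      proof (cases "n \<le> N")
        case True then show ?thesis using r(2)[of n y q] dq by auto
      next
        case False
        then have n: "n = Suc N" using n by simp
        have "d (\<sigma> ((\<sigma> ^^ N) y)) q < s" using dq n by simp
        then obtain z where z: "\<sigma> z = q" "d ((\<sigma> ^^ N) y) z < min r e" using s(2) by blast
        obtain y' where y': "(\<sigma> ^^ N) y' = z" "\<forall>k\<le>N. d ((\<sigma> ^^ k) y) ((\<sigma> ^^ k) y') < e"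
          using r(2)[of N y z] z by auto
        have "(\<sigma> ^^ n) y' = q" using n y' z by simp
        moreover have "d ((\<sigma> ^^ k) y) ((\<sigma> ^^ k) y') < e" if "k \<le> n" for k
          using that n y'(2) dq \<open>(\<sigma> ^^ n) y' = q\<close> by (cases "k = n") auto
        ultimately show ?thesis by blast
      qed
    qed (use r s assms in auto)
  qed
  then show ?thesis using that by metis
qed

text \<open>Lifting \<open>n\<close> times by uniform openness alone would need a radius that shrinks with \<open>n\<close>. Expansiveness
  recovers the loss: a lift whose \<open>n \<ge> N\<close> iterates are \<open>e0\<close>-close to those of \<open>y\<close> is automatically
  \<open>s\<close>-close to \<open>y\<close>, which is what the next lifting step requires. Only the first \<open>N\<close> steps need a
  small radius.\<close>

lemma shadowing_lift:
  assumes "e > 0"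
  obtains r where "r > 0" "\<And>y q n. d ((\<sigma> ^^ n) y) q < r \<Longrightarrow>
     \<exists>y'. (\<sigma> ^^ n) y' = q \<and> (\<forall>k\<le>n. d ((\<sigma> ^^ k) y) ((\<sigma> ^^ k) y') < e)"
proof -
  define e' where "e' = min e e0"
  have e': "e' > 0" using assms e0_pos by (simp add: e'_def)
  obtain s where s: "s > 0" "\<And>y q. d (\<sigma> y) q < s \<Longrightarrow> \<exists>y'. \<sigma> y' = q \<and> d y y' < e'"
    using uniform_lift[OF e'] by blast
  obtain N where N: "\<And>n x y. N \<le> n \<Longrightarrow> (\<And>k. k \<le> n \<Longrightarrow> d ((\<sigma> ^^ k) x) ((\<sigma> ^^ k) y) \<le> e0) \<Longrightarrow> d x y < s"
    using uniform_expansiveness[OF s(1)] by blast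
  obtain r where r: "r > 0" "\<And>y q n. n \<le> N \<Longrightarrow> d ((\<sigma> ^^ n) y) q < r \<Longrightarrow>
     \<exists>y'. (\<sigma> ^^ n) y' = q \<and> (\<forall>k\<le>n. d ((\<sigma> ^^ k) y) ((\<sigma> ^^ k) y') < min s e')"
    using uniform_lift_iterate[of "min s e'" N] e' s(1) by (metis min_less_iff_conj)
  have "\<exists>y'. (\<sigma> ^^ n) y' = q \<and> (\<forall>k\<le>n. d ((\<sigma> ^^ k) y) ((\<sigma> ^^ k) y') < e') \<and> d y y' < s"
    if "d ((\<sigma> ^^ n) y) q < r" for y q n
    using that
  proof (induction n arbitrary: y)
    case 0
    then show ?case using r(2)[of 0 y q] by auto
  next
    case (Suc n)
    show ?case
    proof (cases "Suc n \<le> N")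
      case True
      then show ?thesis using r(2)[of "Suc n" y q] Suc.prems by (metis le0 funpow_0 min_less_iff_conj)
    next
      case False
      have "d ((\<sigma> ^^ n) (\<sigma> y)) q < r" using Suc.prems by (simp add: funpow_swap1)
      then obtain z where z: "(\<sigma> ^^ n) z = q" "\<And>k. k \<le> n \<Longrightarrow> d ((\<sigma> ^^ k) (\<sigma> y)) ((\<sigma> ^^ k) z) < e'"
        "d (\<sigma> y) z < s" using Suc.IH by blast
      obtain y' where y': "\<sigma> y' = z" "d y y' < e'" using s(2) z(3) by blast
      have *: "d ((\<sigma> ^^ k) y) ((\<sigma> ^^ k) y') < e'" if "k \<le> Suc n" for k
        using that z(2)[of "k - 1"] y' by (cases k) (auto simp: funpow_swap1)
      \<comment> \<open>Here at least \<open>N\<close> iterates of the new lift are controlled.\<close>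
      have "d y y' < s" using * False by (intro N[of "Suc n"]) (auto simp: e'_def order_less_imp_le)
      moreover have "(\<sigma> ^^ Suc n) y' = q" using y' z by (simp add: funpow_swap1)
      ultimately show ?thesis using * by blast
    qed
  qed
  then show ?thesis using that[OF r(1)] by (metis e'_def min_less_iff_conj)
qed

text \<open>Lifts of distinct points are distinct by expansiveness, so shadowing gives injections between the
  two fibres in both directions, and finite fibres make them bijections.\<close>

lemma fibre_matching:
  assumes "e > 0"
  obtains r where "r > 0" "\<And>x x' n. d x x' < r \<Longrightarrow>
     \<exists>\<phi>. bij_betw \<phi> {y. (\<sigma> ^^ n) y = x} {y. (\<sigma> ^^ n) y = x'} \<and>
        (\<forall>y k. (\<sigma> ^^ n) y = x \<longrightarrow> k \<le> n \<longrightarrow> d ((\<sigma> ^^ k) y) ((\<sigma> ^^ k) (\<phi> y)) < e)"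
proof -
  define e' where "e' = min e (e0 / 2)"
  have e': "e' > 0" using assms e0_pos by (simp add: e'_def)
  obtain r where r: "r > 0" "\<And>y q n. d ((\<sigma> ^^ n) y) q < r \<Longrightarrow>
     \<exists>y'. (\<sigma> ^^ n) y' = q \<and> (\<forall>k\<le>n. d ((\<sigma> ^^ k) y) ((\<sigma> ^^ k) y') < e')"
    using shadowing_lift[OF e'] by blast
  have inj: "\<exists>\<phi>. inj_on \<phi> {y. (\<sigma> ^^ n) y = x} \<and> \<phi> ` {y. (\<sigma> ^^ n) y = x} \<subseteq> {y. (\<sigma> ^^ n) y = x'} \<and>
        (\<forall>y k. (\<sigma> ^^ n) y = x \<longrightarrow> k \<le> n \<longrightarrow> d ((\<sigma> ^^ k) y) ((\<sigma> ^^ k) (\<phi> y)) < e')"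
    if "d x x' < r" for x x' n
  proof -
    have "\<forall>y. \<exists>y'. (\<sigma> ^^ n) y = x \<longrightarrow> (\<sigma> ^^ n) y' = x' \<and> (\<forall>k\<le>n. d ((\<sigma> ^^ k) y) ((\<sigma> ^^ k) y') < e')"
      using r(2)[of n _ x'] that by blast
    then obtain \<phi> where \<phi>: "\<And>y. (\<sigma> ^^ n) y = x \<Longrightarrow>
       (\<sigma> ^^ n) (\<phi> y) = x' \<and> (\<forall>k\<le>n. d ((\<sigma> ^^ k) y) ((\<sigma> ^^ k) (\<phi> y)) < e')" by metis
    have "inj_on \<phi> {y. (\<sigma> ^^ n) y = x}"
    proof (rule inj_onI, clarsimp)
      fix y z assume *: "x = (\<sigma> ^^ n) y" "(\<sigma> ^^ n) z = (\<sigma> ^^ n) y" "\<phi> y = \<phi> z"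
      \<comment> \<open>Both points stay close to the common lift up to time \<open>n\<close> and coincide from then on.\<close>
      show "y = z"
      proof (rule expansive)
        fix k
        show "d ((\<sigma> ^^ k) y) ((\<sigma> ^^ k) z) \<le> e0"
        proof (cases "k \<le> n")
          case True
          have "d ((\<sigma> ^^ k) y) ((\<sigma> ^^ k) (\<phi> y)) < e'" "d ((\<sigma> ^^ k) z) ((\<sigma> ^^ k) (\<phi> y)) < e'"
            using \<phi>[of y] \<phi>[of z] * True by auto
          then show ?thesis
            using d_triangle[of "(\<sigma> ^^ k) y" "(\<sigma> ^^ k) z" "(\<sigma> ^^ k) (\<phi> y)"]
            by (auto simp: e'_def d_commute min_def split: if_splits)
        next
          case False
          then have "k = (k - n) + n" by simp
          then have "(\<sigma> ^^ k) y = (\<sigma> ^^ k) z" using *(2) by (metis funpow_add o_apply)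
          then show ?thesis using e0_pos by simp
        qed
      qed
    qed
    then show ?thesis using \<phi> by (intro exI[of _ \<phi>]) auto
  qed
  show ?thesis
  proof (rule that[OF r(1)])
    fix x x' n assume dx: "d x x' < r"
    obtain \<phi> where \<phi>: "inj_on \<phi> {y. (\<sigma> ^^ n) y = x}" "\<phi> ` {y. (\<sigma> ^^ n) y = x} \<subseteq> {y. (\<sigma> ^^ n) y = x'}"
        "\<forall>y k. (\<sigma> ^^ n) y = x \<longrightarrow> k \<le> n \<longrightarrow> d ((\<sigma> ^^ k) y) ((\<sigma> ^^ k) (\<phi> y)) < e'"
      using inj[OF dx] by blast
    obtain \<phi>' where \<phi>': "inj_on \<phi>' {y. (\<sigma> ^^ n) y = x'}" "\<phi>' ` {y. (\<sigma> ^^ n) y = x'} \<subseteq> {y. (\<sigma> ^^ n) y = x}"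
      using inj[of x' x n] dx by (auto simp: d_commute)
    have "card {y. (\<sigma> ^^ n) y = x} = card {y. (\<sigma> ^^ n) y = x'}"
      by (intro antisym card_inj_on_le[OF \<phi>(1,2)] card_inj_on_le[OF \<phi>'] finite_fibre)
    then have "bij_betw \<phi> {y. (\<sigma> ^^ n) y = x} {y. (\<sigma> ^^ n) y = x'}"
      using \<phi>(1,2) finite_fibre[where n=n and x=x'] unfolding bij_betw_def
      by (metis card_image card_subset_eq)
    moreover have "\<forall>y k. (\<sigma> ^^ n) y = x \<longrightarrow> k \<le> n \<longrightarrow> d ((\<sigma> ^^ k) y) ((\<sigma> ^^ k) (\<phi> y)) < e"
      using \<phi>(3) by (auto simp: e'_def)
    ultimately show "\<exists>\<phi>. bij_betw \<phi> {y. (\<sigma> ^^ n) y = x} {y. (\<sigma> ^^ n) y = x'} \<and>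
        (\<forall>y k. (\<sigma> ^^ n) y = x \<longrightarrow> k \<le> n \<longrightarrow> d ((\<sigma> ^^ k) y) ((\<sigma> ^^ k) (\<phi> y)) < e)" by blast
  qed
qed

lemma open_iterate_image:
  assumes "open V" shows "open ((\<sigma> ^^ n) ` V)"
proof (induction n)
  case (Suc n)
  then show ?case using local_homeo_open_map[OF local_homeo Suc] by (simp add: image_comp)
qed (use assms in simp)

lemma surj_iterate: "surj (\<sigma> ^^ n)"
proof (induction n)
  case (Suc n)
  then show ?case using comp_surj[OF Suc surj_\<sigma>] by (simp only: funpow.simps)
qed simp

text \<open>Every \<open>R\<^sub>\<infinity>\<close> class meets \<open>V\<close>, so the increasing open sets \<open>\<sigma>\<^bsup>-n\<^esup>(\<sigma>\<^sup>n V)\<close> exhaust the space.\<close>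

lemma minimal_iterate_covers:
  assumes "minimal_rel (R_infinity \<sigma>)" "open V" "V \<noteq> {}"
  obtains n where "\<And>k. n \<le> k \<Longrightarrow> (\<sigma> ^^ k) ` V = UNIV"
proof -
  have mono: "(\<sigma> ^^ k) -` (\<sigma> ^^ k) ` V \<subseteq> (\<sigma> ^^ l) -` (\<sigma> ^^ l) ` V" if "k \<le> l" for k l
  proof
    fix x assume "x \<in> (\<sigma> ^^ k) -` (\<sigma> ^^ k) ` V"
    then obtain v where v: "v \<in> V" "(\<sigma> ^^ k) x = (\<sigma> ^^ k) v" by auto
    have "l = (l - k) + k" using that by simp
    then have "(\<sigma> ^^ l) x = (\<sigma> ^^ l) v" using v(2) by (metis funpow_add o_apply)
    then show "x \<in> (\<sigma> ^^ l) -` (\<sigma> ^^ l) ` V" using v(1) by auto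
  qed
  have covers: "\<exists>n. x \<in> (\<sigma> ^^ n) -` (\<sigma> ^^ n) ` V" for x
  proof -
    have "closure (R_infinity \<sigma> `` {x}) = UNIV" using assms(1) by (simp add: minimal_rel_def)
    then have "V \<inter> R_infinity \<sigma> `` {x} \<noteq> {}"
      using assms(2,3) open_Int_closure_eq_empty[OF assms(2)] by auto
    then obtain v n where "v \<in> V" "(\<sigma> ^^ n) x = (\<sigma> ^^ n) v" by (auto simp: R_infinity_def)
    then show ?thesis by auto
  qed
  have "open ((\<sigma> ^^ n) -` (\<sigma> ^^ n) ` V)" for n
    by (intro open_vimage open_iterate_image assms continuous_iterate)
  then obtain J where J: "finite J" "\<And>x. \<exists>n\<in>J. x \<in> (\<sigma> ^^ n) -` (\<sigma> ^^ n) ` V"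
    using compact_UNIV_finite_subcover[OF compact_UNIV _ covers] by metis
  show ?thesis
  proof (rule that[of "Max J"])
    fix k assume k: "Max J \<le> k"
    have "UNIV \<subseteq> (\<sigma> ^^ k) -` (\<sigma> ^^ k) ` V"
    proof
      fix x obtain n where "n \<in> J" "x \<in> (\<sigma> ^^ n) -` (\<sigma> ^^ n) ` V" using J(2) by blast
      moreover have "n \<le> k" using k J(1) \<open>n \<in> J\<close> by (meson Max_ge le_trans)
      ultimately show "x \<in> (\<sigma> ^^ k) -` (\<sigma> ^^ k) ` V" using mono by blast
    qed
    then have "(\<sigma> ^^ k) ` UNIV \<subseteq> (\<sigma> ^^ k) ` V" by blast
    then show "(\<sigma> ^^ k) ` V = UNIV" unfolding surj_iterate[of k] by (rule top.extremum_uniqueI)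
  qed
qed

lemma minimal_fibres_dense:
  assumes "minimal_rel (R_infinity \<sigma>)" "r > 0"
  obtains N where "\<And>x z. \<exists>y. (\<sigma> ^^ N) y = x \<and> d z y < r"
proof -
  have "\<exists>c. x \<in> {y. d c y < r / 2}" for x using assms(2) by (intro exI[of _ x]) simp
  then obtain C where C: "finite C" "\<And>x. \<exists>c\<in>C. x \<in> {y. d c y < r / 2}"
    by (rule compact_UNIV_finite_subcover[OF compact_UNIV open_ball_d, of "\<lambda>c. c" "\<lambda>_. r / 2"]) blast
  have "\<forall>c. \<exists>n. \<forall>k\<ge>n. (\<sigma> ^^ k) ` {y. d c y < r / 2} = UNIV"
  proof
    fix c
    have "{y. d c y < r / 2} \<noteq> {}" using assms(2) by (auto intro!: exI[of _ c])
    then show "\<exists>n. \<forall>k\<ge>n. (\<sigma> ^^ k) ` {y. d c y < r / 2} = UNIV"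
      by (rule minimal_iterate_covers[OF assms(1) open_ball_d]) blast
  qed
  from choice[OF this] obtain n where n: "\<And>c k. k \<ge> n c \<Longrightarrow> (\<sigma> ^^ k) ` {y. d c y < r / 2} = UNIV"
    by blast
  show ?thesis
  proof (rule that[of "Max (n ` C)"])
    fix x z
    obtain c where c: "c \<in> C" "d c z < r / 2" using C(2) by blast
    have "Max (n ` C) \<ge> n c" using c C(1) by simp
    then have "x \<in> (\<sigma> ^^ Max (n ` C)) ` {y. d c y < r / 2}" using n by simp
    then obtain y where y: "(\<sigma> ^^ Max (n ` C)) y = x" "d c y < r / 2" by blast
    have "d z y < r" using d_triangle[of z y c] c y by (simp add: d_commute)
    then show "\<exists>y. (\<sigma> ^^ Max (n ` C)) y = x \<and> d z y < r" using y by blast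
  qed
qed

end


section \<open>The transfer operator of a normalized potential\<close>

lemma iter_potential_Suc:
  "iter_potential \<sigma> \<psi> (Suc n) x = iter_potential \<sigma> \<psi> n x * \<psi> ((\<sigma> ^^ n) x)"
  by (simp add: iter_potential_def)

lemma iter_potential_add:
  "iter_potential \<sigma> \<psi> (n + k) x = iter_potential \<sigma> \<psi> n x * iter_potential \<sigma> \<psi> k ((\<sigma> ^^ n) x)"
proof (induction k)
  case (Suc k)
  have "(\<sigma> ^^ (n + k)) x = (\<sigma> ^^ k) ((\<sigma> ^^ n) x)"
    by (simp add: funpow_add add.commute[of n])
  then show ?case using Suc by (simp add: iter_potential_Suc)
qed (simp add: iter_potential_def)

lemma iter_potential_mult:
  "iter_potential \<sigma> \<psi> (M * n) x = (\<Prod>k<n. iter_potential \<sigma> \<psi> M (((\<sigma> ^^ M) ^^ k) x))"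
proof (induction n)
  case (Suc n)
  have "iter_potential \<sigma> \<psi> (M * n + M) x
      = iter_potential \<sigma> \<psi> (M * n) x * iter_potential \<sigma> \<psi> M ((\<sigma> ^^ (M * n)) x)"
    by (rule iter_potential_add)
  then show ?case using Suc by (simp add: funpow_mult add.commute)
qed (simp add: iter_potential_def)

text \<open>The transfer operator acts here on real functions, where order arguments are available.\<close>

locale normalized_potential = expansive_local_homeo d \<sigma> e0
  for d :: "'x::{second_countable_topology,t2_space} \<Rightarrow> 'x \<Rightarrow> real" and \<sigma> e0 +
  fixes \<psi> :: "'x \<Rightarrow> real"
  assumes continuous_\<psi>: "continuous_on UNIV \<psi>" and \<psi>_pos: "0 < \<psi> x"
    and normalized: "(\<Sum>y | \<sigma> y = x. \<psi> y) = 1"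
begin

definition ruelle :: "('x \<Rightarrow> real) \<Rightarrow> 'x \<Rightarrow> real" where
  "ruelle f x = (\<Sum>y | \<sigma> y = x. \<psi> y * f y)"

abbreviation \<Psi> :: "nat \<Rightarrow> 'x \<Rightarrow> real" where "\<Psi> \<equiv> iter_potential \<sigma> \<psi>"

lemma \<Psi>_pos: "0 < \<Psi> n x"
  by (simp add: iter_potential_def prod_pos \<psi>_pos)

lemma ruelle_iterate: "(ruelle ^^ n) f x = (\<Sum>y | (\<sigma> ^^ n) y = x. \<Psi> n y * f y)"
proof (induction n arbitrary: x)
  case 0
  then show ?case by (simp add: iter_potential_def)
next
  case (Suc n)
  let ?Z = "{z. \<sigma> z = x}"
  have fin: "finite ?Z" using finite_fibre[of 1 x] by simp
  have "(ruelle ^^ Suc n) f x = (\<Sum>z\<in>?Z. \<Sum>y | (\<sigma> ^^ n) y = z. \<Psi> (Suc n) y * f y)"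
    unfolding funpow.simps o_apply ruelle_def[of "(ruelle ^^ n) f"] Suc sum_distrib_left
    by (intro sum.cong refl) (auto simp: iter_potential_Suc)
  also have "\<dots> = (\<Sum>y\<in>(\<Union>z\<in>?Z. {y. (\<sigma> ^^ n) y = z}). \<Psi> (Suc n) y * f y)"
    by (rule sum.UNION_disjoint[symmetric]) (auto simp: fin finite_fibre)
  also have "(\<Union>z\<in>?Z. {y. (\<sigma> ^^ n) y = z}) = {y. (\<sigma> ^^ Suc n) y = x}" by auto
  finally show ?case .
qed

lemma \<Psi>_sum: "(\<Sum>y | (\<sigma> ^^ n) y = x. \<Psi> n y) = 1"
proof -
  have "ruelle (\<lambda>_. 1) = (\<lambda>_. 1)" by (simp add: ruelle_def normalized fun_eq_iff)
  then have "(ruelle ^^ n) (\<lambda>_. 1) = (\<lambda>_. 1)" by (induction n) simp_all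
  then show ?thesis using ruelle_iterate[of n "\<lambda>_. 1" x] by simp
qed

lemma ruelle_iterate_diff_const: "(ruelle ^^ n) (\<lambda>x. f x - c) x = (ruelle ^^ n) f x - c"
proof -
  have "(\<Sum>y | (\<sigma> ^^ n) y = x. \<Psi> n y * c) = c"
    by (simp add: sum_distrib_right[symmetric] \<Psi>_sum)
  then show ?thesis by (simp add: ruelle_iterate right_diff_distrib sum_subtractf)
qed

lemma ruelle_iterate_ge:
  assumes "\<And>x. c \<le> f x" shows "c \<le> (ruelle ^^ n) f x"
proof -
  have "0 \<le> (ruelle ^^ n) (\<lambda>x. f x - c) x"
    unfolding ruelle_iterate using assms \<Psi>_pos by (intro sum_nonneg mult_nonneg_nonneg) (auto simp: less_imp_le)
  then show ?thesis by (simp add: ruelle_iterate_diff_const)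
qed

lemma ruelle_iterate_le:
  assumes "\<And>x. f x \<le> c" shows "(ruelle ^^ n) f x \<le> c"
proof -
  have "(ruelle ^^ n) (\<lambda>x. f x - c) x \<le> 0"
    unfolding ruelle_iterate using assms \<Psi>_pos by (intro sum_nonpos mult_nonneg_nonpos) (auto simp: less_imp_le)
  then show ?thesis by (simp add: ruelle_iterate_diff_const)
qed

lemma bounded_continuous:
  assumes "continuous_on UNIV (f :: 'x \<Rightarrow> real)"
  obtains b where "b > 0" "\<And>x. \<bar>f x\<bar> \<le> b"
proof -
  have "bounded (range f)"
    by (intro compact_imp_bounded compact_continuous_image assms compact_UNIV)
  then obtain b where "b > 0" "\<forall>x\<in>range f. norm x \<le> b" using bounded_pos by blast
  then show ?thesis using that[of b] by auto
qed

text \<open>The matching of fibres for \<open>n = 1\<close> pairs off the terms of the sums at nearby points.\<close>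

lemma continuous_ruelle:
  assumes f: "continuous_on UNIV f" shows "continuous_on UNIV (ruelle f)"
proof -
  have c: "continuous_on UNIV (\<lambda>x. \<psi> x * f x)" by (intro continuous_intros f continuous_\<psi>)
  have "isCont (ruelle f) x" for x
  proof (subst continuous_at_open, safe)
    fix S assume S: "open S" "ruelle f x \<in> S"
    obtain \<epsilon> where e: "\<epsilon> > 0" "\<And>y. dist y (ruelle f x) < \<epsilon> \<Longrightarrow> y \<in> S"
      using S by (auto simp: open_dist)
    define K where "K = real (card {y. \<sigma> y = x}) + 1"
    have K: "K > 0" by (simp add: K_def)
    obtain s where s: "s > 0" "\<And>y z. d y z < s \<Longrightarrow> \<bar>\<psi> y * f y - \<psi> z * f z\<bar> < \<epsilon> / K"
      by (rule uniformly_continuous_d[OF c, of "\<epsilon> / K"]) (use e K in auto)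
    obtain r where r: "r > 0" "\<And>x x' n. d x x' < r \<Longrightarrow>
     \<exists>\<phi>. bij_betw \<phi> {y. (\<sigma> ^^ n) y = x} {y. (\<sigma> ^^ n) y = x'} \<and>
        (\<forall>y k. (\<sigma> ^^ n) y = x \<longrightarrow> k \<le> n \<longrightarrow> d ((\<sigma> ^^ k) y) ((\<sigma> ^^ k) (\<phi> y)) < s)"
      by (rule fibre_matching[OF s(1)], rule that)
    have "ruelle f x' \<in> S" if dx: "d x x' < r" for x'
    proof -
      obtain \<phi> where \<phi>: "bij_betw \<phi> {y. \<sigma> y = x} {y. \<sigma> y = x'}"
        and cl: "\<And>y. \<sigma> y = x \<Longrightarrow> d y (\<phi> y) < s"
        using r(2)[OF dx, of 1] by (force dest: spec[of _ "0::nat"])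
      have "ruelle f x' = (\<Sum>y | \<sigma> y = x. \<psi> (\<phi> y) * f (\<phi> y))"
        unfolding ruelle_def using sum.reindex_bij_betw[OF \<phi>, of "\<lambda>y. \<psi> y * f y"] by simp
      then have "\<bar>ruelle f x - ruelle f x'\<bar> = \<bar>\<Sum>y | \<sigma> y = x. \<psi> y * f y - \<psi> (\<phi> y) * f (\<phi> y)\<bar>"
        by (simp add: ruelle_def sum_subtractf)
      also have "\<dots> \<le> (\<Sum>y | \<sigma> y = x. \<epsilon> / K)"
        by (rule order_trans[OF sum_abs sum_mono]) (auto intro!: less_imp_le s(2) cl)
      also have "\<dots> < \<epsilon>" using K e(1) by (simp add: K_def field_simps)
      finally show ?thesis by (intro e(2)) (simp add: dist_real_def)
    qed
    moreover have "x \<in> {x'. d x x' < r}" using r(1) by simp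
    ultimately show "\<exists>T. open T \<and> x \<in> T \<and> (\<forall>x'\<in>T. ruelle f x' \<in> S)"
      using open_ball_d by blast
  qed
  then show ?thesis by (simp add: continuous_at_imp_continuous_on)
qed

lemma continuous_ruelle_iterate:
  "continuous_on UNIV f \<Longrightarrow> continuous_on UNIV ((ruelle ^^ n) f)"
  by (induction n) (simp_all add: continuous_ruelle)

end


section \<open>Convergence of the iterates under Bowen's condition\<close>

locale bowen_potential = normalized_potential d \<sigma> e0 \<psi>
  for d :: "'x::{second_countable_topology,t2_space} \<Rightarrow> 'x \<Rightarrow> real" and \<sigma> e0 \<psi> +
  fixes M :: nat and \<delta> C :: real
  assumes M: "1 \<le> M" and \<delta>_pos: "\<delta> > 0"
    and bowen: "\<And>n x y. 1 \<le> n \<Longrightarrow> (\<And>k. k < n \<Longrightarrow> d (((\<sigma> ^^ M) ^^ k) x) (((\<sigma> ^^ M) ^^ k) y) \<le> \<delta>) \<Longrightarrow>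
       \<bar>\<Sum>k<n. ln (\<Psi> M (((\<sigma> ^^ M) ^^ k) x)) - ln (\<Psi> M (((\<sigma> ^^ M) ^^ k) y))\<bar> \<le> C"
    and minimal: "minimal_rel (R_infinity \<sigma>)"
begin

text \<open>Bowen's condition in multiplicative form; the constant does not depend on \<open>n\<close>.\<close>

lemma distortion:
  assumes "1 \<le> n" "\<And>k. k \<le> M * n \<Longrightarrow> d ((\<sigma> ^^ k) x) ((\<sigma> ^^ k) y) \<le> \<delta>"
  shows "\<Psi> (M * n) x \<le> exp C * \<Psi> (M * n) y"
proof -
  have ln: "ln (\<Psi> (M * n) z) = (\<Sum>k<n. ln (\<Psi> M (((\<sigma> ^^ M) ^^ k) z)))" for z
    unfolding iter_potential_mult using \<Psi>_pos by (intro ln_prod) (auto simp: less_imp_neq[THEN not_sym])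
  have "\<bar>\<Sum>k<n. ln (\<Psi> M (((\<sigma> ^^ M) ^^ k) x)) - ln (\<Psi> M (((\<sigma> ^^ M) ^^ k) y))\<bar> \<le> C"
    using assms by (intro bowen) (auto simp: funpow_mult)
  then have "ln (\<Psi> (M * n) x) \<le> C + ln (\<Psi> (M * n) y)"
    unfolding sum_subtractf ln[symmetric] by linarith
  then have "exp (ln (\<Psi> (M * n) x)) \<le> exp (C + ln (\<Psi> (M * n) y))" by simp
  then show ?thesis using \<Psi>_pos by (simp add: exp_add)
qed

text \<open>Matched preimages \<open>y\<close>, \<open>\<phi> y\<close> have weights that differ by at most the factor \<open>exp C\<close>, and they are so
  close for large \<open>n\<close> that the values of \<open>F\<close> differ by at most \<open>\<epsilon>\<close>.\<close>

lemma harnack: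
  obtains r where "r > 0"
    "\<forall>F \<epsilon>. continuous_on UNIV F \<longrightarrow> (\<forall>x. 0 \<le> F x) \<longrightarrow> \<epsilon> > 0 \<longrightarrow>
      (\<exists>n0. \<forall>n\<ge>n0. \<forall>x x'. d x x' < r \<longrightarrow> (ruelle ^^ (M * n)) F x \<le> exp C * ((ruelle ^^ (M * n)) F x' + \<epsilon>))"
proof -
  define e where "e = min \<delta> e0"
  have e: "e > 0" using \<delta>_pos e0_pos by (simp add: e_def)
  obtain r where r: "r > 0" "\<And>x x' n. d x x' < r \<Longrightarrow>
     \<exists>\<phi>. bij_betw \<phi> {y. (\<sigma> ^^ n) y = x} {y. (\<sigma> ^^ n) y = x'} \<and>
        (\<forall>y k. (\<sigma> ^^ n) y = x \<longrightarrow> k \<le> n \<longrightarrow> d ((\<sigma> ^^ k) y) ((\<sigma> ^^ k) (\<phi> y)) < e)"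
    by (rule fibre_matching[OF e], rule that)
  show ?thesis
  proof (rule that[OF r(1)], intro allI impI)
    fix F :: "'x \<Rightarrow> real" and \<epsilon> assume F: "continuous_on UNIV F" "\<forall>x. 0 \<le> F x" and eps: "(\<epsilon>::real) > 0"
    obtain s where s: "s > 0" "\<And>x y. d x y < s \<Longrightarrow> \<bar>F x - F y\<bar> < \<epsilon>"
      by (rule uniformly_continuous_d[OF F(1) eps], rule that)
    obtain N where N: "\<And>n x y. N \<le> n \<Longrightarrow> (\<And>k. k \<le> n \<Longrightarrow> d ((\<sigma> ^^ k) x) ((\<sigma> ^^ k) y) \<le> e0) \<Longrightarrow> d x y < s"
      using uniform_expansiveness[OF s(1)] by blast
    show "\<exists>n0. \<forall>n\<ge>n0. \<forall>x x'. d x x' < r \<longrightarrow> (ruelle ^^ (M * n)) F x \<le> exp C * ((ruelle ^^ (M * n)) F x' + \<epsilon>)"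
    proof (intro exI[of _ "Suc N"] allI impI)
      fix n x x' assume n: "Suc N \<le> n" and dx: "d x x' < r"
      have MN: "N \<le> M * n" using n M by (metis Suc_leD le_trans mult_le_mono1 nat_mult_1)
      obtain \<phi> where \<phi>: "bij_betw \<phi> {y. (\<sigma> ^^ (M*n)) y = x} {y. (\<sigma> ^^ (M*n)) y = x'}"
        and cl: "\<And>y k. (\<sigma> ^^ (M*n)) y = x \<Longrightarrow> k \<le> M*n \<Longrightarrow> d ((\<sigma> ^^ k) y) ((\<sigma> ^^ k) (\<phi> y)) < e"
        using r(2)[OF dx, of "M*n"] by auto
      let ?Y = "{y. (\<sigma> ^^ (M*n)) y = x}" and ?Y' = "{y. (\<sigma> ^^ (M*n)) y = x'}"
      have 1: "\<Psi> (M*n) y \<le> exp C * \<Psi> (M*n) (\<phi> y)" if "y \<in> ?Y" for y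
        using cl[of y] that n by (intro distortion) (auto simp: e_def less_imp_le)
      have 2: "F y \<le> F (\<phi> y) + \<epsilon>" if "y \<in> ?Y" for y
      proof -
        have "d y (\<phi> y) < s" using cl[of y] that by (intro N[OF MN]) (auto simp: e_def less_imp_le)
        then show ?thesis using s(2)[of y "\<phi> y"] by linarith
      qed
      have "(ruelle ^^ (M * n)) F x \<le> (\<Sum>y\<in>?Y. exp C * \<Psi> (M*n) (\<phi> y) * (F (\<phi> y) + \<epsilon>))"
        unfolding ruelle_iterate
        by (intro sum_mono mult_mono 1 2) (auto intro!: mult_nonneg_nonneg F(2)[rule_format] less_imp_le[OF \<Psi>_pos])
      also have "\<dots> = (\<Sum>y\<in>?Y'. exp C * \<Psi> (M*n) y * (F y + \<epsilon>))"
        by (rule sum.reindex_bij_betw[OF \<phi>])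
      also have "\<dots> = exp C * ((\<Sum>y\<in>?Y'. \<Psi> (M*n) y * F y) + (\<Sum>y\<in>?Y'. \<Psi> (M*n) y) * \<epsilon>)"
        by (simp add: sum_distrib_left sum_distrib_right sum.distrib algebra_simps)
      also have "\<dots> = exp C * ((ruelle ^^ (M * n)) F x' + \<epsilon>)"
        by (simp add: ruelle_iterate \<Psi>_sum)
      finally show "(ruelle ^^ (M * n)) F x \<le> exp C * ((ruelle ^^ (M * n)) F x' + \<epsilon>)" .
    qed
  qed
qed

text \<open>Among the \<open>\<sigma>\<^sup>N\<close>-preimages of \<open>x\<close> there is one close to \<open>z\<close>. Its term alone bounds the sum defining
  \<open>\<L>\<^sup>N(\<L>\<^sup>M\<^sup>n F)(x)\<close> from below, by the minimum of \<open>\<psi>\<^sub>N\<close> and the Harnack inequality.\<close>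

lemma uniform_positivity:
  obtains \<kappa> N where "\<kappa> > 0"
    "\<forall>F \<epsilon>. continuous_on UNIV F \<longrightarrow> (\<forall>x. 0 \<le> F x) \<longrightarrow> \<epsilon> > 0 \<longrightarrow>
      (\<exists>n0. \<forall>n\<ge>n0. \<forall>x z. \<kappa> * (ruelle ^^ (M * n)) F z - \<epsilon> \<le> (ruelle ^^ (N + M * n)) F x)"
proof -
  obtain r where r: "r > 0"
    "\<forall>F \<epsilon>. continuous_on UNIV F \<longrightarrow> (\<forall>x. 0 \<le> F x) \<longrightarrow> \<epsilon> > 0 \<longrightarrow>
      (\<exists>n0. \<forall>n\<ge>n0. \<forall>x x'. d x x' < r \<longrightarrow> (ruelle ^^ (M * n)) F x \<le> exp C * ((ruelle ^^ (M * n)) F x' + \<epsilon>))"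
    by (rule harnack, rule that)
  obtain N where N: "\<And>x z. \<exists>y. (\<sigma> ^^ N) y = x \<and> d z y < r"
    by (rule minimal_fibres_dense[OF minimal r(1)], rule that)
  have cont: "continuous_on UNIV (\<Psi> N)"
    unfolding iter_potential_def[abs_def]
    by (intro continuous_intros continuous_on_compose2[OF continuous_\<psi> continuous_iterate]) auto
  obtain z0 where z0: "\<And>y. \<Psi> N z0 \<le> \<Psi> N y"
    using continuous_attains_inf[OF compact_UNIV _ cont] by auto
  define c where "c = \<Psi> N z0"
  have c: "c > 0" "\<And>y. c \<le> \<Psi> N y" using z0 \<Psi>_pos by (auto simp: c_def)
  show ?thesis
  proof (rule that[of "c * exp (- C)" N], use c in simp, intro allI impI)
    fix F :: "'x \<Rightarrow> real" and \<epsilon> assume F: "continuous_on UNIV F" "\<forall>x. 0 \<le> F x" and eps: "(\<epsilon>::real) > 0"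
    have "\<epsilon> / c > 0" using eps c by simp
    from r(2)[rule_format, OF F(1) _ this] F(2) obtain n0 where n0: "\<And>n x x'. n \<ge> n0 \<Longrightarrow> d x x' < r \<Longrightarrow>
      (ruelle ^^ (M * n)) F x \<le> exp C * ((ruelle ^^ (M * n)) F x' + \<epsilon> / c)" by blast
    show "\<exists>n0. \<forall>n\<ge>n0. \<forall>x z. c * exp (- C) * (ruelle ^^ (M * n)) F z - \<epsilon> \<le> (ruelle ^^ (N + M * n)) F x"
    proof (intro exI[of _ n0] allI impI)
      fix n x z assume n: "n \<ge> n0"
      obtain y where y: "(\<sigma> ^^ N) y = x" "d z y < r" using N by blast
      let ?G = "(ruelle ^^ (M * n)) F"
      have G: "0 \<le> ?G w" for w using F(2) by (intro ruelle_iterate_ge) simp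
      have "exp (-C) * ?G z \<le> ?G y + \<epsilon> / c"
        using n0[OF n y(2)] by (simp add: exp_minus field_simps)
      then have "c * (exp (-C) * ?G z) \<le> c * (?G y + \<epsilon> / c)" using c(1) by simp
      then have "c * exp (- C) * ?G z - \<epsilon> \<le> c * ?G y" using c(1) by (simp add: distrib_left mult.assoc)
      also have "\<dots> \<le> \<Psi> N y * ?G y" using c(2) G by (intro mult_right_mono)
      also have "\<dots> \<le> (\<Sum>y | (\<sigma> ^^ N) y = x. \<Psi> N y * ?G y)"
        using y(1) by (intro member_le_sum[where f = "\<lambda>y. \<Psi> N y * ?G y"])
          (auto simp: finite_fibre intro!: mult_nonneg_nonneg G less_imp_le[OF \<Psi>_pos])
      also have "\<dots> = (ruelle ^^ (N + M * n)) F x" by (simp add: ruelle_iterate[symmetric] funpow_add)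
      finally show "c * exp (- C) * ?G z - \<epsilon> \<le> (ruelle ^^ (N + M * n)) F x" .
    qed
  qed
qed

text \<open>The minima \<open>a\<^sub>n\<close> of \<open>\<L>\<^sup>n f\<close> increase to some \<open>A\<close> and the maxima \<open>b\<^sub>n\<close> decrease to some \<open>B\<close>. Uniform
  positivity for \<open>\<L>\<^sup>k f - a\<^sub>k\<close> gives \<open>\<kappa> (B - a\<^sub>k) \<le> A - a\<^sub>k\<close>, and \<open>k \<rightarrow> \<infinity>\<close> yields \<open>B \<le> A\<close>.\<close>

theorem ruelle_iterates_converge:
  assumes f: "continuous_on UNIV f" and e: "\<epsilon> > 0"
  obtains n0 where "\<And>n x y. n0 \<le> n \<Longrightarrow> \<bar>(ruelle ^^ n) f x - (ruelle ^^ n) f y\<bar> \<le> \<epsilon>"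
proof -
  define a where "a n = (INF x. (ruelle ^^ n) f x)" for n
  define b where "b n = (SUP x. (ruelle ^^ n) f x)" for n
  obtain K where K: "K > 0" "\<And>x. \<bar>f x\<bar> \<le> K" by (rule bounded_continuous[OF f], rule that)
  have Kn: "- K \<le> (ruelle ^^ n) f x" "(ruelle ^^ n) f x \<le> K" for n x
    using K(2) by (auto intro!: ruelle_iterate_ge ruelle_iterate_le simp: abs_le_iff minus_le_iff)
  have bdd: "bdd_below (range ((ruelle ^^ n) f))" "bdd_above (range ((ruelle ^^ n) f))" for n
    using Kn by (auto intro!: bdd_belowI[of _ "-K"] bdd_aboveI[of _ K])
  have ab: "a n \<le> (ruelle ^^ n) f x" "(ruelle ^^ n) f x \<le> b n" for n x
    unfolding a_def b_def by (auto intro!: cINF_lower cSUP_upper bdd)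
  have ext: "c \<le> a n" if "\<And>x. c \<le> (ruelle ^^ n) f x" for c n
    unfolding a_def by (rule cINF_greatest) (auto intro: that)
  have ext': "b n \<le> c" if "\<And>x. (ruelle ^^ n) f x \<le> c" for c n
    unfolding b_def by (rule cSUP_least) (auto intro: that)
  have "incseq a"
  proof (rule incseq_SucI, rule ext)
    fix n x show "a n \<le> (ruelle ^^ Suc n) f x"
      using ruelle_iterate_ge[of "a n" "(ruelle ^^ n) f" 1 x] ab(1) by simp
  qed
  moreover have "decseq b"
  proof (rule decseq_SucI, rule ext')
    fix n x show "(ruelle ^^ Suc n) f x \<le> b n"
      using ruelle_iterate_le[of "(ruelle ^^ n) f" "b n" 1 x] ab(2) by simp
  qed
  moreover have "a n \<le> K" "-K \<le> b n" for n using ab[of n undefined] Kn[of n undefined] by linarith+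
  ultimately obtain A B where A: "a \<longlonglongrightarrow> A" "\<And>n. a n \<le> A" and B: "b \<longlonglongrightarrow> B" "\<And>n. B \<le> b n"
    using incseq_convergent[of a K thesis] decseq_convergent[of b "-K" thesis] by auto
  obtain \<kappa> N where \<kappa>: "\<kappa> > 0"
    "\<forall>F \<epsilon>. continuous_on UNIV F \<longrightarrow> (\<forall>x. 0 \<le> F x) \<longrightarrow> \<epsilon> > 0 \<longrightarrow>
      (\<exists>n0. \<forall>n\<ge>n0. \<forall>x z. \<kappa> * (ruelle ^^ (M * n)) F z - \<epsilon> \<le> (ruelle ^^ (N + M * n)) F x)"
    by (rule uniform_positivity, rule that)
  \<comment> \<open>The error \<open>\<eta>\<close> costs nothing: \<open>n\<close> may be taken large for each fixed \<open>k\<close>.\<close>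
  have main: "\<kappa> * (B - a k) - \<eta> \<le> A - a k" if \<eta>: "\<eta> > 0" for k \<eta>
  proof -
    define F where "F = (\<lambda>x. (ruelle ^^ k) f x - a k)"
    have F: "continuous_on UNIV F" "\<And>x. 0 \<le> F x"
      unfolding F_def using ab(1) by (auto intro!: continuous_intros continuous_ruelle_iterate f)
    obtain n where n: "\<And>x z. \<kappa> * (ruelle ^^ (M * n)) F z - \<eta> \<le> (ruelle ^^ (N + M * n)) F x"
      using \<kappa>(2)[rule_format, OF F(1) _ \<eta>] F(2) by blast
    have LF: "(ruelle ^^ j) F x = (ruelle ^^ (j + k)) f x - a k" for j x
      unfolding F_def ruelle_iterate_diff_const by (simp add: funpow_add)
    have "\<kappa> * ((ruelle ^^ (M * n + k)) f z - a k) - \<eta> \<le> A - a k" for z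
    proof -
      have "\<kappa> * ((ruelle ^^ (M * n + k)) f z - a k) - \<eta> + a k \<le> a (N + M * n + k)"
        using n[of z] by (intro ext) (simp add: LF algebra_simps)
      then show ?thesis using A(2)[of "N + M * n + k"] by linarith
    qed
    then have "(ruelle ^^ (M * n + k)) f z \<le> (A - a k + \<eta>) / \<kappa> + a k" for z
      using \<kappa>(1) by (simp add: field_simps)
    then have "b (M * n + k) \<le> (A - a k + \<eta>) / \<kappa> + a k" by (rule ext')
    then have "B \<le> (A - a k + \<eta>) / \<kappa> + a k" using B(2) order_trans by blast
    then show ?thesis using \<kappa>(1) by (simp add: field_simps)
  qed
  have "\<kappa> * (B - a k) \<le> A - a k" for k
  proof (rule field_le_epsilon)
    fix \<eta> :: real assume "\<eta> > 0"
    from main[OF this, of k] show "\<kappa> * (B - a k) \<le> A - a k + \<eta>" by linarith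
  qed
  moreover have "(\<lambda>k. \<kappa> * (B - a k)) \<longlonglongrightarrow> \<kappa> * (B - A)" "(\<lambda>k. A - a k) \<longlonglongrightarrow> A - A"
    by (intro tendsto_intros A(1))+
  ultimately have "\<kappa> * (B - A) \<le> A - A" using LIMSEQ_le by blast
  then have "B \<le> A" using \<kappa>(1) by (simp add: mult_le_0_iff)
  moreover have "(\<lambda>n. b n - a n) \<longlonglongrightarrow> B - A" by (intro tendsto_intros A B)
  ultimately have "eventually (\<lambda>n. b n - a n < \<epsilon>) sequentially"
    using e by (intro order_tendstoD(2)[where y = "B - A"]) auto
  then obtain n0 where n0: "\<And>n. n0 \<le> n \<Longrightarrow> b n - a n < \<epsilon>" by (auto simp: eventually_sequentially)
  have "\<bar>(ruelle ^^ n) f x - (ruelle ^^ n) f y\<bar> \<le> \<epsilon>" if "n0 \<le> n" for n x y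
    using n0[OF that] ab[of n x] ab[of n y] by linarith
  then show ?thesis by (rule that)
qed

end


section \<open>Continuous functions and Borel measures\<close>

context metrized_compact
begin

text \<open>The distance to \<open>A\<close> has zero set exactly \<open>A\<close>. The empty set is treated apart, as the infimum over it
  is unspecified.\<close>

lemma closed_eq_zero_set:
  assumes "closed A"
  obtains g :: "'x \<Rightarrow> real" where "continuous_on UNIV g" "\<forall>x. 0 \<le> g x \<and> (g x = 0 \<longleftrightarrow> x \<in> A)"
proof (cases "A = {}")
  case True
  then show ?thesis using that[of "\<lambda>_. 1"] by simp
next
  case False
  define g where "g x = (INF a\<in>A. d x a)" for x
  have bdd: "bdd_below (d x ` A)" for x by (auto intro!: bdd_belowI[of _ 0])
  have le: "g x \<le> d x y + g y" for x y
  proof -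
    have "g x - d x y \<le> g y"
      unfolding g_def[of y]
    proof (rule cINF_greatest[OF False])
      fix a assume "a \<in> A"
      then have "g x \<le> d x a" unfolding g_def by (intro cINF_lower bdd)
      then show "g x - d x y \<le> d y a" using d_triangle[of x a y] by linarith
    qed
    then show ?thesis by linarith
  qed
  have nonneg: "0 \<le> g x" for x unfolding g_def by (rule cINF_greatest[OF False]) simp
  have "continuous_on UNIV g"
  proof (rule continuous_at_imp_continuous_on, rule ballI)
    fix x
    have "continuous_on UNIV (d x)" by (intro continuous_intros)
    then have "isCont (d x) x" by (simp add: continuous_on_eq_continuous_at)
    then have lim: "((\<lambda>y. d x y) \<longlongrightarrow> d x x) (at x)" unfolding isCont_def .
    have "((\<lambda>y. g y - g x) \<longlongrightarrow> 0) (at x)"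
    proof (rule Lim_null_comparison[OF always_eventually])
      show "\<forall>y. norm (g y - g x) \<le> d x y"
        using le[of x] le[of _ x] by (auto simp: abs_le_iff d_commute algebra_simps)
      show "((\<lambda>y. d x y) \<longlongrightarrow> 0) (at x)" using lim by simp
    qed
    then show "isCont g x" by (simp add: isCont_def LIM_zero_iff)
  qed
  moreover have "g x = 0 \<longleftrightarrow> x \<in> A" for x
  proof
    assume "x \<in> A"
    then have "g x \<le> d x x" unfolding g_def by (intro cINF_lower bdd)
    then show "g x = 0" using nonneg[of x] by simp
  next
    assume g0: "g x = 0"
    show "x \<in> A"
    proof (rule ccontr)
      assume "x \<notin> A"
      then obtain r where r: "r > 0" "\<And>y. d x y < r \<Longrightarrow> y \<in> - A"
        using open_contains_ball_d[of "- A" x] assms by (auto simp: open_Compl)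
      have "r \<le> g x" unfolding g_def
        by (rule cINF_greatest[OF False]) (use r(2) in \<open>force simp: not_less[symmetric]\<close>)
      then show False using r(1) g0 by simp
    qed
  qed
  ultimately show ?thesis by (intro that[of g]) (simp_all add: nonneg)
qed

lemma closed_indicator_approx:
  assumes "closed A"
  obtains h :: "nat \<Rightarrow> 'x \<Rightarrow> real" where "\<And>n. continuous_on UNIV (h n)" "\<And>n x. 0 \<le> h n x" "\<And>n x. h n x \<le> 1"
    "\<And>x. (\<lambda>n. h n x) \<longlonglongrightarrow> indicator A x"
proof -
  obtain g :: "'x \<Rightarrow> real" where g0: "continuous_on UNIV g" "\<forall>x. 0 \<le> g x \<and> (g x = 0 \<longleftrightarrow> x \<in> A)"
    by (rule closed_eq_zero_set[OF assms])
  then have g: "continuous_on UNIV g" "\<And>x. 0 \<le> g x" "\<And>x. g x = 0 \<longleftrightarrow> x \<in> A" by simp_all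
  show ?thesis
  proof (rule that[of "\<lambda>n x. max 0 (1 - real n * g x)"])
    fix x
    show "(\<lambda>n. max 0 (1 - real n * g x)) \<longlonglongrightarrow> indicator A x"
    proof (cases "x \<in> A")
      case False
      then have "g x > 0" using g(2,3)[of x] by (simp add: order_less_le)
      then obtain N where N: "1 < real N * g x" using reals_Archimedean3 by blast
      have "eventually (\<lambda>n. max 0 (1 - real n * g x) = 0) sequentially"
        using eventually_ge_at_top[of N]
      proof eventually_elim
        case (elim n)
        then have "real N * g x \<le> real n * g x" using g(2) by (intro mult_right_mono) auto
        then show ?case using N by simp
      qed
      then show ?thesis using False by (simp add: tendsto_eventually)
    qed (use g(3)[of x] in simp)
  qed (use g in \<open>auto intro!: continuous_intros\<close>)
qed

lemma borel_measurable_cont: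
  assumes "sets \<mu> = sets borel" "continuous_on UNIV (f :: 'x \<Rightarrow> real)"
  shows "f \<in> borel_measurable \<mu>"
  using borel_measurable_continuous_onI[OF assms(2)] measurable_cong_sets[OF assms(1) refl] by blast

lemma integrable_cont:
  assumes "finite_measure \<mu>" "sets \<mu> = sets borel" "continuous_on UNIV (f :: 'x \<Rightarrow> real)"
  shows "integrable \<mu> f"
proof -
  have "bounded (range f)"
    by (intro compact_imp_bounded compact_continuous_image assms compact_UNIV)
  then obtain b where "\<forall>x\<in>range f. norm x \<le> b" using bounded_pos by blast
  then show ?thesis
    by (intro finite_measure.integrable_const_bound[OF assms(1), of _ b] AE_I2
          borel_measurable_cont[OF assms(2,3)]) auto
qed

lemma Int_stable_closed: "Int_stable (Collect closed :: 'x set set)"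
  by (auto simp: Int_stable_def)

text \<open>Closed sets form an intersection-stable generator of the Borel sets, and their indicators are
  bounded pointwise limits of continuous functions.\<close>

lemma finite_measure_eqI_continuous:
  assumes N1: "finite_measure N1" "sets N1 = sets borel" and N2: "finite_measure N2" "sets N2 = sets borel"
    and eq: "\<And>f :: 'x \<Rightarrow> real. continuous_on UNIV f \<Longrightarrow> (\<integral>x. f x \<partial>N1) = (\<integral>x. f x \<partial>N2)"
  shows "N1 = N2"
proof (rule measure_eqI_generator_eq[where E = "Collect closed" and \<Omega> = UNIV and A = "\<lambda>_. UNIV"])
  show "Int_stable (Collect closed :: 'x set set)" by (rule Int_stable_closed)
  have "sets borel = sigma_sets UNIV (Collect closed :: 'x set set)"
    by (simp add: borel_eq_closed)
  then show "sets N1 = sigma_sets UNIV (Collect closed)" "sets N2 = sigma_sets UNIV (Collect closed)"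
    using N1 N2 by auto
  fix A :: "'x set" assume "A \<in> Collect closed"
  then obtain h :: "nat \<Rightarrow> 'x \<Rightarrow> real" where h: "\<And>n. continuous_on UNIV (h n)" "\<And>n x. 0 \<le> h n x" "\<And>n x. h n x \<le> 1"
    "\<And>x. (\<lambda>n. h n x) \<longlonglongrightarrow> indicator A x" using closed_indicator_approx by blast
  have lim: "(\<lambda>n. \<integral>x. h n x \<partial>N) \<longlonglongrightarrow> measure N A" if N: "finite_measure N" "sets N = sets borel" for N
  proof -
    interpret finite_measure N by fact
    have A: "A \<in> sets N" using \<open>A \<in> Collect closed\<close> N(2) by auto
    have "(\<lambda>n. \<integral>x. h n x \<partial>N) \<longlonglongrightarrow> (\<integral>x. indicator A x \<partial>N)"
      by (rule integral_dominated_convergence[where w = "\<lambda>_. 1"])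
        (use h A N(2) in \<open>auto intro!: borel_measurable_cont\<close>)
    then show ?thesis using A by simp
  qed
  have "measure N1 A = measure N2 A"
    using lim[OF N1] lim[OF N2] eq[OF h(1)] by (simp add: LIMSEQ_unique)
  then show "emeasure N1 A = emeasure N2 A"
    using N1(1) N2(1) by (simp add: finite_measure.emeasure_eq_measure)
qed (use N1(1) in \<open>auto simp: finite_measure.emeasure_eq_measure\<close>)

text \<open>The functions that can be approximated contain the indicators of closed sets. They are closed
  under the operations of a Dynkin system and under dominated limits, which leads to all Borel sets
  and then to all integrable functions.\<close>

lemma continuous_dense_L1:
  fixes g :: "'x \<Rightarrow> real"
  assumes \<mu>: "finite_measure \<mu>" "sets \<mu> = sets borel" and g: "integrable \<mu> g" and e: "\<epsilon> > 0"
  shows "\<exists>f. continuous_on UNIV f \<and> (\<integral>x. \<bar>g x - f x\<bar> \<partial>\<mu>) < \<epsilon>"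
proof -
  interpret finite_measure \<mu> by fact
  note ic = integrable_cont[OF \<mu>]
  define P where "P g \<longleftrightarrow> (\<forall>\<epsilon>>0. \<exists>f. continuous_on UNIV f \<and> (\<integral>x. \<bar>g x - f x\<bar> \<partial>\<mu>) < \<epsilon>)" for g :: "'x \<Rightarrow> real"
  have cls: "P g" if g: "integrable \<mu> g" and ap: "\<And>\<epsilon>. \<epsilon> > 0 \<Longrightarrow> \<exists>h. integrable \<mu> h \<and> P h \<and> (\<integral>x. \<bar>g x - h x\<bar> \<partial>\<mu>) < \<epsilon>" for g
    unfolding P_def
  proof (intro allI impI)
    fix \<epsilon> :: real assume "\<epsilon> > 0"
    then have e2: "\<epsilon> / 2 > 0" by simp
    obtain h where h: "integrable \<mu> h" "P h" "(\<integral>x. \<bar>g x - h x\<bar> \<partial>\<mu>) < \<epsilon> / 2" using ap[OF e2] by blast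
    obtain f where f: "continuous_on UNIV f" "(\<integral>x. \<bar>h x - f x\<bar> \<partial>\<mu>) < \<epsilon> / 2"
      using h(2) e2 unfolding P_def by blast
    have "(\<integral>x. \<bar>g x - f x\<bar> \<partial>\<mu>) \<le> (\<integral>x. \<bar>g x - h x\<bar> + \<bar>h x - f x\<bar> \<partial>\<mu>)"
      by (intro integral_mono Bochner_Integration.integrable_add integrable_abs Bochner_Integration.integrable_diff g h ic f) auto
    also have "\<dots> = (\<integral>x. \<bar>g x - h x\<bar> \<partial>\<mu>) + (\<integral>x. \<bar>h x - f x\<bar> \<partial>\<mu>)"
      by (intro Bochner_Integration.integral_add integrable_abs Bochner_Integration.integrable_diff g h ic f)
    also have "\<dots> < \<epsilon>" using h f by simp
    finally show "\<exists>f. continuous_on UNIV f \<and> (\<integral>x. \<bar>g x - f x\<bar> \<partial>\<mu>) < \<epsilon>" using f by blast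
  qed
  have P_add: "P (\<lambda>x. g x + h x)" if g: "integrable \<mu> g" "P g" and h: "integrable \<mu> h" "P h" for g h
    unfolding P_def
  proof (intro allI impI)
    fix \<epsilon> :: real assume "\<epsilon> > 0"
    then have e2: "\<epsilon> / 2 > 0" by simp
    obtain f where f: "continuous_on UNIV f" "(\<integral>x. \<bar>g x - f x\<bar> \<partial>\<mu>) < \<epsilon> / 2"
      using g(2) e2 unfolding P_def by blast
    obtain k where k: "continuous_on UNIV k" "(\<integral>x. \<bar>h x - k x\<bar> \<partial>\<mu>) < \<epsilon> / 2"
      using h(2) e2 unfolding P_def by blast
    have "(\<integral>x. \<bar>g x + h x - (f x + k x)\<bar> \<partial>\<mu>) \<le> (\<integral>x. \<bar>g x - f x\<bar> + \<bar>h x - k x\<bar> \<partial>\<mu>)"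
      by (intro integral_mono Bochner_Integration.integrable_add integrable_abs Bochner_Integration.integrable_diff g h ic f k) auto
    also have "\<dots> = (\<integral>x. \<bar>g x - f x\<bar> \<partial>\<mu>) + (\<integral>x. \<bar>h x - k x\<bar> \<partial>\<mu>)"
      by (intro Bochner_Integration.integral_add integrable_abs Bochner_Integration.integrable_diff g h ic f k)
    also have "\<dots> < \<epsilon>" using k f by simp
    finally show "\<exists>f. continuous_on UNIV f \<and> (\<integral>x. \<bar>g x + h x - f x\<bar> \<partial>\<mu>) < \<epsilon>"
      using f(1) k(1) by (intro exI[of _ "\<lambda>x. f x + k x"]) (auto intro: continuous_intros)
  qed
  have scale: "P (\<lambda>x. c * g x)" if "P g" for g and c :: real
    unfolding P_def
  proof (intro allI impI)
    fix \<epsilon> :: real assume "\<epsilon> > 0"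
    then have "\<epsilon> / (\<bar>c\<bar> + 1) > 0" by simp
    then obtain f where f: "continuous_on UNIV f" "(\<integral>x. \<bar>g x - f x\<bar> \<partial>\<mu>) < \<epsilon> / (\<bar>c\<bar> + 1)"
      using \<open>P g\<close> unfolding P_def by blast
    have "(\<integral>x. \<bar>c * g x - c * f x\<bar> \<partial>\<mu>) = \<bar>c\<bar> * (\<integral>x. \<bar>g x - f x\<bar> \<partial>\<mu>)"
      by (simp add: abs_mult flip: right_diff_distrib)
    also have "\<dots> \<le> (\<bar>c\<bar> + 1) * (\<integral>x. \<bar>g x - f x\<bar> \<partial>\<mu>)"
      by (intro mult_right_mono Bochner_Integration.integral_nonneg) auto
    also have "\<dots> < \<epsilon>" using f(2) by (simp add: pos_less_divide_eq mult.commute add_pos_nonneg)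
    finally show "\<exists>f. continuous_on UNIV f \<and> (\<integral>x. \<bar>c * g x - f x\<bar> \<partial>\<mu>) < \<epsilon>"
      using f(1) by (intro exI[of _ "\<lambda>x. c * f x"]) (auto intro: continuous_intros)
  qed
  have cont: "P f" if "continuous_on UNIV f" for f
    using that unfolding P_def by (intro allI impI exI[of _ f]) simp
  have P_lim: "P g" if s: "\<And>i. integrable \<mu> (s i)" "\<And>i. P (s i)" and ptw: "\<And>x. (\<lambda>i. s i x) \<longlonglongrightarrow> g x"
    and bd: "\<And>i x. \<bar>s i x\<bar> \<le> w x" and w: "integrable \<mu> w" and g: "integrable \<mu> g" for s g w
  proof (rule cls[OF g])
    fix \<epsilon> :: real assume "\<epsilon> > 0"
    have "(\<lambda>i. \<integral>x. \<bar>g x - s i x\<bar> \<partial>\<mu>) \<longlonglongrightarrow> (\<integral>x. \<bar>g x - g x\<bar> \<partial>\<mu>)"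
    proof (rule integral_dominated_convergence[where w = "\<lambda>x. \<bar>g x\<bar> + w x"])
      show "AE x in \<mu>. (\<lambda>i. \<bar>g x - s i x\<bar>) \<longlonglongrightarrow> \<bar>g x - g x\<bar>"
        by (intro AE_I2 tendsto_intros ptw)
      show "AE x in \<mu>. norm \<bar>g x - s i x\<bar> \<le> \<bar>g x\<bar> + w x" for i
        using bd[of i] by (intro AE_I2) (simp add: abs_triangle_ineq4[THEN order_trans])
    qed (use g s w in auto)
    then have "eventually (\<lambda>i. (\<integral>x. \<bar>g x - s i x\<bar> \<partial>\<mu>) < \<epsilon>) sequentially"
      using \<open>\<epsilon> > 0\<close> by (intro order_tendstoD(2)) auto
    then obtain i where "(\<integral>x. \<bar>g x - s i x\<bar> \<partial>\<mu>) < \<epsilon>" by (auto simp: eventually_sequentially)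
    then show "\<exists>h. integrable \<mu> h \<and> P h \<and> (\<integral>x. \<bar>g x - h x\<bar> \<partial>\<mu>) < \<epsilon>" using s by blast
  qed
  have Pow_UNIV_top: "Collect closed \<subseteq> Pow (UNIV :: 'x set)" by simp
  have ind: "P (indicator A)" if A: "A \<in> sigma_sets UNIV (Collect closed)" for A
    using Int_stable_closed Pow_UNIV_top A
  proof (induction rule: sigma_sets_induct_disjoint)
    case (basic A)
    then obtain h :: "nat \<Rightarrow> 'x \<Rightarrow> real" where h: "\<And>n. continuous_on UNIV (h n)" "\<And>n x. 0 \<le> h n x" "\<And>n x. h n x \<le> 1"
      "\<And>x. (\<lambda>n. h n x) \<longlonglongrightarrow> indicator A x" using closed_indicator_approx by blast
    show ?case
      by (rule P_lim[of h _ "\<lambda>_. 1"]) (use h ic basic \<mu>(2) in \<open>auto simp: cont emeasure_finite less_top[symmetric] intro!: integrable_real_indicator\<close>)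
  next
    case empty
    have "indicator {} = (\<lambda>_::'x. 0::real)" by (simp add: fun_eq_iff)
    then show ?case using cont[of "\<lambda>_. 0"] by (simp add: continuous_on_const)
  next
    case (compl A)
    have "A \<in> sets \<mu>" using compl \<mu>(2) by (simp add: borel_eq_closed)
    then have "integrable \<mu> (indicator A :: 'x \<Rightarrow> real)" by (intro integrable_real_indicator) (auto simp: emeasure_finite less_top[symmetric])
    then have "P (\<lambda>x. 1 + (-1) * indicator A x)"
      using P_add[OF _ cont[OF continuous_on_const] _ scale[OF compl.IH, of "-1"], of 1] by simp
    moreover have "(\<lambda>x. 1 + (-1) * indicator A x) = (indicator (UNIV - A) :: 'x \<Rightarrow> real)"
      by (auto simp: fun_eq_iff indicator_def)
    ultimately show ?case by simp
  next
    case (union A)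
    have A: "A i \<in> sets \<mu>" for i using union \<mu>(2) by (auto simp: borel_eq_closed)
    then have iA: "integrable \<mu> (indicator (A i) :: 'x \<Rightarrow> real)" for i
      by (intro integrable_real_indicator) (auto simp: emeasure_finite less_top[symmetric])
    have Ps: "P (\<lambda>x. \<Sum>i<n. indicator (A i) x)" for n
    proof (induction n)
      case 0 then show ?case using cont[of "\<lambda>_. 0"] by (simp add: continuous_on_const)
    next
      case (Suc n)
      have "P (\<lambda>x. (\<Sum>i<n. indicator (A i) x) + indicator (A n) x)"
        by (intro P_add Suc iA union Bochner_Integration.integrable_sum)
      then show ?case by simp
    qed
    have sums: "(\<lambda>i. indicator (A i) x :: real) sums indicator (\<Union>i. A i) x" for x
      using union by (intro indicator_sums) (auto simp: disjoint_family_on_def)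
    show ?case
    proof (rule P_lim[of "\<lambda>n x. \<Sum>i<n. indicator (A i) x" _ "\<lambda>_. 1"])
      show "(\<lambda>n. \<Sum>i<n. indicator (A i) x :: real) \<longlonglongrightarrow> indicator (\<Union>i. A i) x" for x
        using sums[of x] by (simp add: sums_def)
      show "\<bar>\<Sum>i<n. indicator (A i) x :: real\<bar> \<le> 1" for n x
      proof -
        have "(\<Sum>i<n. indicator (A i) x :: real) = indicator (\<Union>i<n. A i) x"
          using union by (intro indicator_UN_disjoint[symmetric]) (auto simp: disjoint_family_on_def)
        then show ?thesis by (simp add: indicator_def)
      qed
    qed (use Ps iA A in \<open>auto intro!: integrable_real_indicator simp: emeasure_finite less_top[symmetric]\<close>)
  qed
  have "P g" using g
  proof (induction rule: integrable_induct)
    case (base A c)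
    then have "A \<in> sigma_sets UNIV (Collect closed)" using \<mu>(2) by (simp add: borel_eq_closed)
    then have "P (\<lambda>x. c * indicator A x)" by (intro scale ind)
    then show ?case by (simp add: mult.commute)
  next
    case (add f g)
    then show ?case by (intro P_add)
  next
    case (lim f s)
    then show ?case
      using sets_eq_imp_space_eq[OF \<mu>(2)] by (intro P_lim[of s f "\<lambda>x. 2 * \<bar>f x\<bar>"]) auto
  qed
  then show ?thesis using e by (simp add: P_def)
qed

end


section \<open>Exactness of the conformal measure\<close>

text \<open>The measure is a fixed point of the dual operator; eigenmeasures of transfer operators are also
  called conformal.\<close>

locale conformal_measure = bowen_potential d \<sigma> e0 \<psi> M \<delta> C
  for d :: "'x::{second_countable_topology,t2_space} \<Rightarrow> 'x \<Rightarrow> real" and \<sigma> e0 \<psi> M \<delta> C +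
  fixes \<mu> :: "'x measure"
  assumes sets_\<mu>: "sets \<mu> = sets borel" and prob: "prob_space \<mu>"
    and dual_inv: "continuous_on UNIV f \<Longrightarrow> (\<integral>x. ruelle f x \<partial>\<mu>) = (\<integral>x. f x \<partial>\<mu>)"
begin

sublocale prob_space \<mu> by (rule prob)

lemmas measurable_cont = borel_measurable_cont[OF sets_\<mu>]
lemmas integrable_continuous = integrable_cont[OF finite_measure_axioms sets_\<mu>]

lemma measurable_\<mu>_iff: "f \<in> borel_measurable \<mu> \<longleftrightarrow> f \<in> borel_measurable borel"
  using measurable_cong_sets[OF sets_\<mu> refl] by blast

lemma \<sigma>_measurable: "\<sigma> \<in> measurable \<mu> borel" "\<sigma> \<in> measurable borel borel"
  using borel_measurable_continuous_onI[OF continuous_\<sigma>] measurable_cong_sets[OF sets_\<mu> refl]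
  by blast+

lemma iterate_measurable: "(\<sigma> ^^ n) \<in> measurable borel borel"
  using borel_measurable_continuous_onI[OF continuous_iterate] by blast

lemma ruelle_nonneg: "(\<And>x. 0 \<le> F x) \<Longrightarrow> 0 \<le> ruelle F x"
  using ruelle_iterate_ge[of 0 F 1 x] by simp

text \<open>Against continuous \<open>f\<close>, the invariance of \<open>\<mu>\<close> for \<open>F \<cdot> f \<circ> \<sigma>\<close> reads
  \<open>\<integral> F \<cdot> f \<circ> \<sigma> d\<mu> = \<integral> \<L>(F) \<cdot> f d\<mu>\<close>. As an equality of measures this extends to all Borel functions.\<close>

lemma distr_density_ruelle:
  assumes F: "continuous_on UNIV F" "\<And>x. 0 \<le> F x"
  shows "distr (density \<mu> (\<lambda>x. ennreal (F x))) borel \<sigma> = density \<mu> (\<lambda>x. ennreal (ruelle F x))"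
proof (rule finite_measure_eqI_continuous)
  have fin: "finite_measure (density \<mu> (\<lambda>x. ennreal (G x)))" if G: "continuous_on UNIV G" "\<And>x. 0 \<le> G x" for G :: "'x \<Rightarrow> real"
  proof (rule finite_measureI)
    have "emeasure (density \<mu> (\<lambda>x. ennreal (G x))) (space \<mu>) = (\<integral>\<^sup>+x. ennreal (G x) \<partial>\<mu>)"
      using measurable_cont[OF G(1)] by (simp add: emeasure_density cong: nn_integral_cong)
    also have "\<dots> = ennreal (\<integral>x. G x \<partial>\<mu>)" using integrable_continuous[OF G(1)] G(2) by (intro nn_integral_eq_integral) auto
    finally show "emeasure (density \<mu> (\<lambda>x. ennreal (G x))) (space (density \<mu> (\<lambda>x. ennreal (G x)))) \<noteq> \<infinity>" by simp
  qed
  show "finite_measure (distr (density \<mu> (\<lambda>x. ennreal (F x))) borel \<sigma>)"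
    by (rule finite_measure.finite_measure_distr[OF fin[OF F]]) (simp add: \<sigma>_measurable)
  show "finite_measure (density \<mu> (\<lambda>x. ennreal (ruelle F x)))"
    by (rule fin) (auto intro: continuous_ruelle F ruelle_nonneg)
  fix f :: "'x \<Rightarrow> real" assume f: "continuous_on UNIV f"
  have f\<sigma>: "continuous_on UNIV (\<lambda>x. f (\<sigma> x))" by (rule continuous_on_compose2[OF f continuous_\<sigma>]) simp
  have "(\<integral>x. f x \<partial>distr (density \<mu> (\<lambda>x. ennreal (F x))) borel \<sigma>) = (\<integral>x. F x * f (\<sigma> x) \<partial>\<mu>)"
    using f f\<sigma> F by (simp add: integral_distr integral_density \<sigma>_measurable measurable_cont borel_measurable_continuous_onI)
  also have "\<dots> = (\<integral>x. ruelle (\<lambda>x. F x * f (\<sigma> x)) x \<partial>\<mu>)"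
    by (rule dual_inv[symmetric]) (intro continuous_intros F f\<sigma>)
  also have "\<dots> = (\<integral>x. ruelle F x * f x \<partial>\<mu>)"
    unfolding ruelle_def sum_distrib_right by (intro Bochner_Integration.integral_cong sum.cong) auto
  also have "\<dots> = (\<integral>x. f x \<partial>density \<mu> (\<lambda>x. ennreal (ruelle F x)))"
    using f F by (simp add: integral_density measurable_cont continuous_ruelle ruelle_nonneg)
  finally show "(\<integral>x. f x \<partial>distr (density \<mu> (\<lambda>x. ennreal (F x))) borel \<sigma>)
    = (\<integral>x. f x \<partial>density \<mu> (\<lambda>x. ennreal (ruelle F x)))" .
qed (simp_all add: sets_\<mu>)

lemma transfer_duality:
  fixes \<phi> :: "'x \<Rightarrow> real"
  assumes F: "continuous_on UNIV F" "\<And>x. 0 \<le> F x" and \<phi>: "\<phi> \<in> borel_measurable borel"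
  shows "integrable \<mu> (\<lambda>x. F x * \<phi> (\<sigma> x)) \<longleftrightarrow> integrable \<mu> (\<lambda>x. ruelle F x * \<phi> x)"
    and "(\<integral>x. F x * \<phi> (\<sigma> x) \<partial>\<mu>) = (\<integral>x. ruelle F x * \<phi> x \<partial>\<mu>)"
proof -
  have m: "(\<lambda>x. \<phi> (\<sigma> x)) \<in> borel_measurable \<mu>"
    by (rule measurable_compose[OF \<sigma>_measurable(1) \<phi>])
  have m2: "\<phi> \<in> borel_measurable \<mu>" using \<phi> by (simp add: measurable_\<mu>_iff)
  let ?D = "distr (density \<mu> (\<lambda>x. ennreal (F x))) borel \<sigma>"
  have "integrable \<mu> (\<lambda>x. F x * \<phi> (\<sigma> x)) \<longleftrightarrow> integrable ?D \<phi>"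
    using F \<phi> m by (simp add: integrable_distr_eq integrable_density \<sigma>_measurable measurable_cont)
  also have "\<dots> \<longleftrightarrow> integrable \<mu> (\<lambda>x. ruelle F x * \<phi> x)"
    unfolding distr_density_ruelle[OF F] using F m2
    by (simp add: integrable_density measurable_cont continuous_ruelle ruelle_nonneg)
  finally show "integrable \<mu> (\<lambda>x. F x * \<phi> (\<sigma> x)) \<longleftrightarrow> integrable \<mu> (\<lambda>x. ruelle F x * \<phi> x)" .
  have "(\<integral>x. F x * \<phi> (\<sigma> x) \<partial>\<mu>) = (\<integral>x. \<phi> x \<partial>?D)"
    using F \<phi> m by (simp add: integral_distr integral_density \<sigma>_measurable measurable_cont)
  also have "\<dots> = (\<integral>x. ruelle F x * \<phi> x \<partial>\<mu>)"
    unfolding distr_density_ruelle[OF F] using F m2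
    by (simp add: integral_density measurable_cont continuous_ruelle ruelle_nonneg)
  finally show "(\<integral>x. F x * \<phi> (\<sigma> x) \<partial>\<mu>) = (\<integral>x. ruelle F x * \<phi> x \<partial>\<mu>)" .
qed

text \<open>The case \<open>F = 1\<close>: the normalization \<open>\<L>(1) = 1\<close> makes \<open>\<mu>\<close> invariant under \<open>\<sigma>\<close>.\<close>

lemma distr_\<sigma>: "distr \<mu> borel \<sigma> = \<mu>"
proof -
  have "ruelle (\<lambda>_. 1) = (\<lambda>_. 1)" by (simp add: ruelle_def normalized fun_eq_iff)
  then have "distr (density \<mu> (\<lambda>_. 1)) borel \<sigma> = density \<mu> (\<lambda>_. 1)"
    using distr_density_ruelle[of "\<lambda>_. 1"] by simp
  then show ?thesis by (simp add: density_1)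
qed

lemma AE_\<sigma>:
  assumes "AE x in \<mu>. P x" shows "AE x in \<mu>. P (\<sigma> x)"
proof -
  have "AE x in distr \<mu> borel \<sigma>. P x" unfolding distr_\<sigma> by (rule assms)
  then show ?thesis by (rule AE_distrD[OF \<sigma>_measurable(1)])
qed

lemma iterate_duality:
  fixes \<phi> :: "'x \<Rightarrow> real"
  assumes F: "continuous_on UNIV F" "\<And>x. 0 \<le> F x" and \<phi>: "\<phi> \<in> borel_measurable borel"
  shows "(\<integral>x. F x * \<phi> ((\<sigma> ^^ n) x) \<partial>\<mu>) = (\<integral>x. (ruelle ^^ n) F x * \<phi> x \<partial>\<mu>)"
  using F
proof (induction n arbitrary: F)
  case (Suc n)
  have "(\<integral>x. F x * \<phi> ((\<sigma> ^^ Suc n) x) \<partial>\<mu>) = (\<integral>x. F x * (\<lambda>x. \<phi> ((\<sigma> ^^ n) x)) (\<sigma> x) \<partial>\<mu>)"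
    by (simp add: funpow_swap1)
  also have "\<dots> = (\<integral>x. ruelle F x * \<phi> ((\<sigma> ^^ n) x) \<partial>\<mu>)"
    by (rule transfer_duality(2)) (use Suc.prems measurable_compose[OF iterate_measurable \<phi>] in auto)
  also have "\<dots> = (\<integral>x. (ruelle ^^ n) (ruelle F) x * \<phi> x \<partial>\<mu>)"
    by (rule Suc.IH) (use Suc.prems in \<open>auto intro: continuous_ruelle ruelle_nonneg\<close>)
  finally show ?case by (simp only: funpow_Suc_right o_apply)
qed simp

lemma integrable_bounded_mult:
  fixes \<phi> g :: "'x \<Rightarrow> real"
  assumes "\<phi> \<in> borel_measurable borel" "\<And>x. \<bar>\<phi> x\<bar> \<le> 1" "integrable \<mu> g"
  shows "integrable \<mu> (\<lambda>x. g x * \<phi> x)"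
proof (rule Bochner_Integration.integrable_bound[OF assms(3)])
  show "AE x in \<mu>. norm (g x * \<phi> x) \<le> norm (g x)"
    using assms(2) by (intro AE_I2) (simp add: abs_mult mult_left_le)
  show "(\<lambda>x. g x * \<phi> x) \<in> borel_measurable \<mu>" using assms by (auto simp: measurable_\<mu>_iff)
qed

lemma abs_integral_bounded_mult:
  fixes \<phi> g :: "'x \<Rightarrow> real"
  assumes "\<phi> \<in> borel_measurable borel" "\<And>x. \<bar>\<phi> x\<bar> \<le> 1" "integrable \<mu> g"
  shows "\<bar>\<integral>x. g x * \<phi> x \<partial>\<mu>\<bar> \<le> (\<integral>x. \<bar>g x\<bar> \<partial>\<mu>)"
proof -
  have "norm (\<integral>x. g x * \<phi> x \<partial>\<mu>) \<le> (\<integral>x. norm (g x * \<phi> x) \<partial>\<mu>)" by (rule integral_norm_bound)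
  also have "\<dots> \<le> (\<integral>x. \<bar>g x\<bar> \<partial>\<mu>)"
    using assms by (intro integral_mono integrable_norm integrable_bounded_mult integrable_abs)
      (auto simp: abs_mult mult_left_le)
  finally show ?thesis by simp
qed

text \<open>The estimate is uniform over all \<open>\<phi>\<close> with \<open>|\<phi>| \<le> 1\<close>, which amounts to convergence in total
  variation. It holds for continuous \<open>f\<close> in place of \<open>g\<close>, because
  \<open>\<integral> f \<cdot> \<phi> \<circ> \<sigma>\<^sup>n d\<mu> = \<integral> \<L>\<^sup>n(f) \<cdot> \<phi> d\<mu>\<close> and \<open>\<L>\<^sup>n f\<close> is uniformly close to \<open>\<integral> f d\<mu>\<close>; replacing \<open>g\<close> by \<open>f\<close>
  costs at most \<open>\<integral> |g - f| d\<mu>\<close>.\<close>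

lemma exactness:
  fixes g :: "'x \<Rightarrow> real"
  assumes g: "integrable \<mu> g" "\<And>x. 0 \<le> g x" and e: "\<epsilon> > 0"
  shows "\<exists>n0. \<forall>n\<ge>n0. \<forall>\<phi>. \<phi> \<in> borel_measurable borel \<longrightarrow> (\<forall>x. \<bar>\<phi> x\<bar> \<le> 1) \<longrightarrow>
     \<bar>(\<integral>x. g x * \<phi> ((\<sigma> ^^ n) x) \<partial>\<mu>) - (\<integral>x. g x \<partial>\<mu>) * (\<integral>x. \<phi> x \<partial>\<mu>)\<bar> \<le> \<epsilon>"
proof -
  have e3: "\<epsilon> / 3 > 0" using e by simp
  obtain f0 where f0: "continuous_on UNIV f0" "(\<integral>x. \<bar>g x - f0 x\<bar> \<partial>\<mu>) < \<epsilon> / 3"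
    using continuous_dense_L1[OF finite_measure_axioms sets_\<mu> g(1) e3] by blast
  \<comment> \<open>Truncation does not increase the distance to \<open>g \<ge> 0\<close>.\<close>
  define f where "f x = max 0 (f0 x)" for x
  have f: "continuous_on UNIV f" "\<And>x. 0 \<le> f x" unfolding f_def by (auto intro!: continuous_intros f0)
  note fi = integrable_continuous[OF f(1)]
  have "\<bar>g x - f x\<bar> \<le> \<bar>g x - f0 x\<bar>" for x using g(2)[of x] by (simp add: f_def)
  then have "(\<integral>x. \<bar>g x - f x\<bar> \<partial>\<mu>) \<le> (\<integral>x. \<bar>g x - f0 x\<bar> \<partial>\<mu>)"
    by (intro integral_mono integrable_abs Bochner_Integration.integrable_diff g fi integrable_continuous f0)
  then have gf: "(\<integral>x. \<bar>g x - f x\<bar> \<partial>\<mu>) \<le> \<epsilon> / 3" using f0 by linarith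
  obtain n0 where n0: "\<And>n x y. n0 \<le> n \<Longrightarrow> \<bar>(ruelle ^^ n) f x - (ruelle ^^ n) f y\<bar> \<le> \<epsilon> / 3"
    by (rule ruelle_iterates_converge[OF f(1) e3]) (rule that)
  have int_n: "(\<integral>x. (ruelle ^^ n) f x \<partial>\<mu>) = (\<integral>x. f x \<partial>\<mu>)" for n
    using iterate_duality[OF f, of "\<lambda>_. 1" n] by simp
  show ?thesis
  proof (intro exI[of _ n0] allI impI)
    fix n and \<phi> :: "'x \<Rightarrow> real" assume n: "n0 \<le> n" and \<phi>: "\<phi> \<in> borel_measurable borel" "\<forall>x. \<bar>\<phi> x\<bar> \<le> (1::real)"
    let ?\<phi>n = "\<lambda>x. \<phi> ((\<sigma> ^^ n) x)" and ?I = "\<lambda>g. \<integral>x. g x \<partial>\<mu>"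
    have \<phi>n: "?\<phi>n \<in> borel_measurable borel" "\<And>x. \<bar>?\<phi>n x\<bar> \<le> 1"
      using \<phi> measurable_compose[OF iterate_measurable \<phi>(1)] by auto
    have i\<phi>: "integrable \<mu> \<phi>" using integrable_bounded_mult[of \<phi> "\<lambda>_. 1"] \<phi> by simp
    have Lf: "integrable \<mu> ((ruelle ^^ n) f)" by (intro integrable_continuous continuous_ruelle_iterate f)
    have 1: "\<bar>?I (\<lambda>x. g x * ?\<phi>n x) - ?I (\<lambda>x. f x * ?\<phi>n x)\<bar> \<le> \<epsilon> / 3"
    proof -
      have "?I (\<lambda>x. g x * ?\<phi>n x) - ?I (\<lambda>x. f x * ?\<phi>n x) = ?I (\<lambda>x. (g x - f x) * ?\<phi>n x)"
        unfolding left_diff_distrib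
        by (intro Bochner_Integration.integral_diff[symmetric] integrable_bounded_mult \<phi>n g fi)
      also have "\<bar>\<dots>\<bar> \<le> ?I (\<lambda>x. \<bar>g x - f x\<bar>)"
        by (intro abs_integral_bounded_mult \<phi>n Bochner_Integration.integrable_diff g fi)
      finally show ?thesis using gf by linarith
    qed
    have 2: "\<bar>?I (\<lambda>x. f x * ?\<phi>n x) - ?I f * ?I \<phi>\<bar> \<le> \<epsilon> / 3"
    proof -
      have near: "\<bar>(ruelle ^^ n) f x - ?I f\<bar> \<le> \<epsilon> / 3" for x
      proof -
        have "?I (\<lambda>y. (ruelle ^^ n) f x - (ruelle ^^ n) f y) = (ruelle ^^ n) f x - ?I f"
          using Lf by (simp add: int_n prob_space)
        then have "\<bar>(ruelle ^^ n) f x - ?I f\<bar> = \<bar>?I (\<lambda>y. (ruelle ^^ n) f x - (ruelle ^^ n) f y)\<bar>" by simp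
        also have "\<dots> \<le> ?I (\<lambda>y. \<bar>(ruelle ^^ n) f x - (ruelle ^^ n) f y\<bar>)" by (rule integral_abs_bound)
        also have "\<dots> \<le> ?I (\<lambda>y. \<epsilon> / 3)" using Lf n0[OF n] by (intro integral_mono) auto
        finally show ?thesis by (simp add: prob_space)
      qed
      have "?I (\<lambda>x. f x * ?\<phi>n x) = ?I (\<lambda>x. (ruelle ^^ n) f x * \<phi> x)"
        by (rule iterate_duality[OF f \<phi>(1)])
      then have "?I (\<lambda>x. f x * ?\<phi>n x) - ?I f * ?I \<phi> = ?I (\<lambda>x. ((ruelle ^^ n) f x - ?I f) * \<phi> x)"
        unfolding left_diff_distrib using \<phi> i\<phi>
        by (subst Bochner_Integration.integral_diff) (auto intro!: integrable_bounded_mult Lf)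
      also have "\<bar>\<dots>\<bar> \<le> ?I (\<lambda>x. \<bar>(ruelle ^^ n) f x - ?I f\<bar>)"
        using \<phi> by (intro abs_integral_bounded_mult Bochner_Integration.integrable_diff Lf) auto
      also have "\<dots> \<le> ?I (\<lambda>x. \<epsilon> / 3)" using Lf near by (intro integral_mono) auto
      finally show ?thesis by (simp add: prob_space)
    qed
    have 3: "\<bar>?I f * ?I \<phi> - ?I g * ?I \<phi>\<bar> \<le> \<epsilon> / 3"
    proof -
      have "\<bar>?I \<phi>\<bar> \<le> ?I (\<lambda>_. \<bar>1\<bar>)"
        using abs_integral_bounded_mult[of \<phi> "\<lambda>_. 1"] \<phi> by simp
      then have p1: "\<bar>?I \<phi>\<bar> \<le> 1" by (simp add: prob_space)
      have "\<bar>?I f - ?I g\<bar> = \<bar>?I (\<lambda>x. g x - f x)\<bar>" using g fi by (simp add: abs_minus_commute)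
      also have "\<dots> \<le> ?I (\<lambda>x. \<bar>g x - f x\<bar>)" by (rule integral_abs_bound)
      finally have "\<bar>?I f - ?I g\<bar> \<le> \<epsilon> / 3" using gf by linarith
      then have "\<bar>?I f - ?I g\<bar> * \<bar>?I \<phi>\<bar> \<le> \<epsilon> / 3 * 1" using p1 e by (intro mult_mono) auto
      then show ?thesis by (simp add: left_diff_distrib[symmetric] abs_mult)
    qed
    show "\<bar>?I (\<lambda>x. g x * ?\<phi>n x) - ?I g * ?I \<phi>\<bar> \<le> \<epsilon>" using 1 2 3 by linarith
  qed
qed

text \<open>For \<open>p = |m|\<^sup>2\<close> this is the reason that \<open>S\<close> preserves norms.\<close>

lemma weighted_preimage:
  fixes G p :: "'x \<Rightarrow> real"
  assumes p: "continuous_on UNIV p" "\<And>x. 0 \<le> p x" "\<And>x. ruelle p x = 1" and G: "G \<in> borel_measurable borel"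
  shows "integrable \<mu> (\<lambda>x. p x * G (\<sigma> x)) \<longleftrightarrow> integrable \<mu> G"
    and "(\<integral>x. p x * G (\<sigma> x) \<partial>\<mu>) = (\<integral>x. G x \<partial>\<mu>)"
  using transfer_duality[OF p(1,2) G] p(3) by simp_all

text \<open>A chain of each finite length is what membership in the range of every \<open>S\<^sup>n\<close> gives directly, and
  the estimate uses one chain for each accuracy \<open>\<epsilon>\<close>, long enough for exactness to take effect.\<close>

theorem weight_rigidity:
  fixes g p :: "'x \<Rightarrow> real"
  assumes p: "continuous_on UNIV p" "\<And>x. 0 \<le> p x" "\<And>x. ruelle p x = 1"
    and g: "integrable \<mu> g" "\<And>x. 0 \<le> g x"
    and chain: "\<And>n. \<exists>b. b 0 = g \<and> (\<forall>i\<le>n. integrable \<mu> (b i)) \<and>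
        (\<forall>i<n. AE x in \<mu>. b i x = p x * b (Suc i) (\<sigma> x))"
    and nonconst: "\<not> (AE x in \<mu>. p x = 1)"
  shows "AE x in \<mu>. g x = 0"
proof -
  let ?I = "\<lambda>g. \<integral>x. g x \<partial>\<mu>"
  define c where "c = ?I g"
  have c0: "c \<ge> 0" using g by (simp add: c_def)
  have pm: "p \<in> borel_measurable \<mu>" "integrable \<mu> p" by (rule measurable_cont[OF p(1)], rule integrable_continuous[OF p(1)])
  have "c * ?I (\<lambda>x. \<bar>p x - 1\<bar>) \<le> 0 + \<epsilon>" if e: "\<epsilon> > 0" for \<epsilon>
  proof -
    have e2: "\<epsilon> / 2 > 0" using e by simp
    obtain n where n: "\<And>k \<phi>. n \<le> k \<Longrightarrow> \<phi> \<in> borel_measurable borel \<Longrightarrow> (\<And>x. \<bar>\<phi> x\<bar> \<le> 1) \<Longrightarrow>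
     \<bar>?I (\<lambda>x. g x * \<phi> ((\<sigma> ^^ k) x)) - c * ?I \<phi>\<bar> \<le> \<epsilon> / 2"
      using exactness[OF g e2] unfolding c_def by blast
    obtain b where b: "b 0 = g" "\<And>i. i \<le> Suc n \<Longrightarrow> integrable \<mu> (b i)"
      "\<And>i. i < Suc n \<Longrightarrow> AE x in \<mu>. b i x = p x * b (Suc i) (\<sigma> x)" using chain[of "Suc n"] by blast
    have bm: "b i \<in> borel_measurable borel" if "i \<le> Suc n" for i
      using b(2)[OF that] measurable_\<mu>_iff by auto
    \<comment> \<open>\<open>b i\<close> is the density of the image of \<open>g \<mu>\<close> under \<open>\<sigma>\<^sup>i\<close>.\<close>
    have push: "?I (\<lambda>x. g x * \<phi> ((\<sigma> ^^ i) x)) = ?I (\<lambda>x. b i x * \<phi> x)"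
      if "i \<le> Suc n" "\<phi> \<in> borel_measurable borel" for i and \<phi> :: "'x \<Rightarrow> real"
      using that
    proof (induction i arbitrary: \<phi>)
      case (Suc i)
      have m: "(\<lambda>x. b (Suc i) x * \<phi> x) \<in> borel_measurable borel"
        using bm[of "Suc i"] Suc.prems by measurable
      have "?I (\<lambda>x. g x * \<phi> ((\<sigma> ^^ Suc i) x)) = ?I (\<lambda>x. b i x * \<phi> (\<sigma> x))"
        using Suc.IH[of "\<lambda>x. \<phi> (\<sigma> x)"] Suc.prems measurable_compose[OF \<sigma>_measurable(2) Suc.prems(2)] by simp
      also have "\<dots> = ?I (\<lambda>x. p x * (b (Suc i) (\<sigma> x) * \<phi> (\<sigma> x)))"
      proof (rule integral_cong_AE)
        show "(\<lambda>x. b i x * \<phi> (\<sigma> x)) \<in> borel_measurable \<mu>"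
          using bm[of i] Suc.prems measurable_compose[OF \<sigma>_measurable(2) Suc.prems(2)] by (simp add: measurable_\<mu>_iff)
        show "(\<lambda>x. p x * (b (Suc i) (\<sigma> x) * \<phi> (\<sigma> x))) \<in> borel_measurable \<mu>"
          by (intro borel_measurable_times pm measurable_compose[OF \<sigma>_measurable(1) m])
        show "AE x in \<mu>. b i x * \<phi> (\<sigma> x) = p x * (b (Suc i) (\<sigma> x) * \<phi> (\<sigma> x))"
          using b(3)[of i] Suc.prems by auto
      qed
      also have "\<dots> = ?I (\<lambda>x. b (Suc i) x * \<phi> x)"
        by (rule weighted_preimage(2)[OF p m])
      finally show ?case .
    qed (simp add: b)
    have near: "?I (\<lambda>x. \<bar>b i x - c\<bar>) \<le> \<epsilon> / 2" if i: "n \<le> i" "i \<le> Suc n" for i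
    proof -
      \<comment> \<open>The test function that computes the \<open>L\<^sup>1\<close> distance.\<close>
      define \<phi> where "\<phi> x = sgn (b i x - c)" for x
      have \<phi>: "\<phi> \<in> borel_measurable borel" "\<bar>\<phi> x\<bar> \<le> 1" for x
        unfolding \<phi>_def[abs_def] using bm[OF i(2)] by (auto simp: sgn_real_def)
      have i\<phi>: "integrable \<mu> \<phi>" using integrable_bounded_mult[of \<phi> "\<lambda>_. 1"] \<phi> by simp
      have "?I (\<lambda>x. \<bar>b i x - c\<bar>) = ?I (\<lambda>x. b i x * \<phi> x - c * \<phi> x)"
        by (intro Bochner_Integration.integral_cong) (auto simp: \<phi>_def abs_sgn left_diff_distrib)
      also have "\<dots> = ?I (\<lambda>x. b i x * \<phi> x) - c * ?I \<phi>"
        using i\<phi> by (subst Bochner_Integration.integral_diff) (auto intro!: integrable_bounded_mult \<phi> b i)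
      also have "\<dots> \<le> \<epsilon> / 2"
        using abs_le_D1[OF n[OF i(1) \<phi>]] unfolding push[OF i(2) \<phi>(1)] .
      finally show ?thesis .
    qed
    have iS: "integrable \<mu> (\<lambda>x. \<bar>b (Suc n) x - c\<bar>)" and iN: "integrable \<mu> (\<lambda>x. \<bar>b n x - c\<bar>)"
      using b(2)[of n] b(2)[of "Suc n"] by auto
    have mS: "(\<lambda>x. \<bar>b (Suc n) x - c\<bar>) \<in> borel_measurable borel" using iS measurable_\<mu>_iff by blast
    have iP: "integrable \<mu> (\<lambda>x. p x * \<bar>b (Suc n) (\<sigma> x) - c\<bar>)"
      using weighted_preimage(1)[OF p mS] iS by simp
    have "c * ?I (\<lambda>x. \<bar>p x - 1\<bar>) = ?I (\<lambda>x. c * \<bar>p x - 1\<bar>)" by simp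
    also have "\<dots> \<le> ?I (\<lambda>x. p x * \<bar>b (Suc n) (\<sigma> x) - c\<bar> + \<bar>b n x - c\<bar>)"
    proof (rule integral_mono_AE)
      show "AE x in \<mu>. c * \<bar>p x - 1\<bar> \<le> p x * \<bar>b (Suc n) (\<sigma> x) - c\<bar> + \<bar>b n x - c\<bar>"
        using b(3)[of n, simplified]
      proof eventually_elim
        case (elim x)
        have "c * \<bar>p x - 1\<bar> = \<bar>(b n x - c) - p x * (b (Suc n) (\<sigma> x) - c)\<bar>"
          using c0 by (simp add: elim algebra_simps abs_mult_pos' flip: abs_mult)
        also have "\<dots> \<le> \<bar>b n x - c\<bar> + \<bar>p x * (b (Suc n) (\<sigma> x) - c)\<bar>" by (rule abs_triangle_ineq4)
        finally show ?case using p(2)[of x] by (simp add: abs_mult)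
      qed
    qed (use pm iP iN in auto)
    also have "\<dots> = ?I (\<lambda>x. p x * \<bar>b (Suc n) (\<sigma> x) - c\<bar>) + ?I (\<lambda>x. \<bar>b n x - c\<bar>)"
      by (rule Bochner_Integration.integral_add[OF iP iN])
    also have "?I (\<lambda>x. p x * \<bar>b (Suc n) (\<sigma> x) - c\<bar>) = ?I (\<lambda>x. \<bar>b (Suc n) x - c\<bar>)"
      by (rule weighted_preimage(2)[OF p mS])
    finally show ?thesis using near[of n] near[of "Suc n"] by linarith
  qed
  then have *: "c * ?I (\<lambda>x. \<bar>p x - 1\<bar>) \<le> 0" by (rule field_le_epsilon)
  have "?I (\<lambda>x. \<bar>p x - 1\<bar>) \<noteq> 0"
  proof
    assume "?I (\<lambda>x. \<bar>p x - 1\<bar>) = 0"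
    then have "AE x in \<mu>. \<bar>p x - 1\<bar> = 0"
      using pm by (subst (asm) integral_nonneg_eq_0_iff_AE) auto
    then show False using nonconst by simp
  qed
  moreover have "?I (\<lambda>x. \<bar>p x - 1\<bar>) \<ge> 0" by simp
  ultimately have "c = 0" using * c0 by (smt (verit) mult_pos_pos)
  then show ?thesis using g unfolding c_def by (subst (asm) integral_nonneg_eq_0_iff_AE) auto
qed

end


section \<open>Hilbert spaces on carriers\<close>

context
  fixes K :: "'h inner_space"
  assumes K: "hilbert_space K"
begin

lemma hilbert_module: "module complex_ring K"
  using K unfolding hilbert_space_def by (rule conjunct1)

interpretation module complex_ring K by (rule hilbert_module)

lemma hilbert_add_closed: "v \<in> carrier K \<Longrightarrow> w \<in> carrier K \<Longrightarrow> v \<oplus>\<^bsub>K\<^esub> w \<in> carrier K" by simp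
lemma hilbert_zero_closed: "\<zero>\<^bsub>K\<^esub> \<in> carrier K" by simp
lemma hilbert_smult_closed: "v \<in> carrier K \<Longrightarrow> c \<odot>\<^bsub>K\<^esub> v \<in> carrier K"
  using smult_closed[of c v] by (simp add: complex_ring_def)

lemma hilbert_smult_add: "v \<in> carrier K \<Longrightarrow> w \<in> carrier K \<Longrightarrow> c \<odot>\<^bsub>K\<^esub> (v \<oplus>\<^bsub>K\<^esub> w) = c \<odot>\<^bsub>K\<^esub> v \<oplus>\<^bsub>K\<^esub> c \<odot>\<^bsub>K\<^esub> w"
  using smult_r_distr[of c v w] by (simp add: complex_ring_def)
lemma hilbert_smult_smult: "v \<in> carrier K \<Longrightarrow> a \<odot>\<^bsub>K\<^esub> (b \<odot>\<^bsub>K\<^esub> v) = (a * b) \<odot>\<^bsub>K\<^esub> v"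
  using smult_assoc1[of a b v] by (simp add: complex_ring_def)
lemma hilbert_smult_0: "v \<in> carrier K \<Longrightarrow> 0 \<odot>\<^bsub>K\<^esub> v = \<zero>\<^bsub>K\<^esub>"
  using smult_l_null[of v] by (simp add: complex_ring_def)
lemma hilbert_finsum_singleton: "f i \<in> carrier K \<Longrightarrow> (\<Oplus>\<^bsub>K\<^esub>j\<in>{i}. f j) = f i"
  by (subst finsum_insert) auto
lemma hilbert_finsum_empty: "(\<Oplus>\<^bsub>K\<^esub>j\<in>{}. f j) = \<zero>\<^bsub>K\<^esub>" by simp

lemma cinner_add: "u \<in> carrier K \<Longrightarrow> v \<in> carrier K \<Longrightarrow> w \<in> carrier K \<Longrightarrow> cinner K (u \<oplus>\<^bsub>K\<^esub> v) w = cinner K u w + cinner K v w"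
  using K[unfolded hilbert_space_def, THEN conjunct2, THEN conjunct1] by blast
lemma cinner_smult: "v \<in> carrier K \<Longrightarrow> w \<in> carrier K \<Longrightarrow> cinner K (c \<odot>\<^bsub>K\<^esub> v) w = c * cinner K v w"
  using K[unfolded hilbert_space_def, THEN conjunct2, THEN conjunct2, THEN conjunct1] by blast
lemma cinner_cnj: "v \<in> carrier K \<Longrightarrow> w \<in> carrier K \<Longrightarrow> cinner K w v = cnj (cinner K v w)"
  using K[unfolded hilbert_space_def, THEN conjunct2, THEN conjunct2, THEN conjunct2, THEN conjunct1] by blast
lemma cinner_pos: "v \<in> carrier K \<Longrightarrow> 0 \<le> Re (cinner K v v)"
  using K[unfolded hilbert_space_def, THEN conjunct2, THEN conjunct2, THEN conjunct2, THEN conjunct2, THEN conjunct1] by blast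
lemma cinner_eq_0: "v \<in> carrier K \<Longrightarrow> cinner K v v = 0 \<Longrightarrow> v = \<zero>\<^bsub>K\<^esub>"
  using K[unfolded hilbert_space_def, THEN conjunct2, THEN conjunct2, THEN conjunct2, THEN conjunct2, THEN conjunct2, THEN conjunct1] by blast

lemma cinner_self: "v \<in> carrier K \<Longrightarrow> cinner K v v = complex_of_real (Re (cinner K v v))"
  using cinner_cnj[of v v] by (metis Reals_cnj_iff of_real_Re)

lemma hnorm_squared: "v \<in> carrier K \<Longrightarrow> (hnorm K v)\<^sup>2 = Re (cinner K v v)"
  by (simp add: hnorm_def cinner_pos)

lemma cinner_zero: "w \<in> carrier K \<Longrightarrow> cinner K \<zero>\<^bsub>K\<^esub> w = 0"
  using cinner_smult[of w w 0] by (simp add: hilbert_smult_0)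

lemma hnorm_smult: "v \<in> carrier K \<Longrightarrow> (hnorm K (c \<odot>\<^bsub>K\<^esub> v))\<^sup>2 = (cmod c)\<^sup>2 * (hnorm K v)\<^sup>2"
proof -
  assume v: "v \<in> carrier K"
  have "cinner K (c \<odot>\<^bsub>K\<^esub> v) (c \<odot>\<^bsub>K\<^esub> v) = c * cinner K v (c \<odot>\<^bsub>K\<^esub> v)"
    using v by (simp add: cinner_smult hilbert_smult_closed)
  also have "cinner K v (c \<odot>\<^bsub>K\<^esub> v) = cnj c * cinner K v v"
    using cinner_cnj[of "c \<odot>\<^bsub>K\<^esub> v" v] v cinner_cnj[of v v] by (simp add: cinner_smult hilbert_smult_closed)
  also have "c * (cnj c * cinner K v v) = complex_of_real ((cmod c)\<^sup>2 * Re (cinner K v v))"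
    by (subst cinner_self[OF v]) (simp add: complex_norm_square[symmetric] flip: mult.assoc)
  finally show ?thesis using v by (simp add: hnorm_squared hilbert_smult_closed)
qed

text \<open>The parallelogram identity without the second term, which is what integrability of a sum needs.\<close>

lemma hnorm_add:
  assumes "v \<in> carrier K" "w \<in> carrier K"
  shows "(hnorm K (v \<oplus>\<^bsub>K\<^esub> w))\<^sup>2 \<le> 2 * (hnorm K v)\<^sup>2 + 2 * (hnorm K w)\<^sup>2"
proof -
  have *: "(hnorm K (v \<oplus>\<^bsub>K\<^esub> u))\<^sup>2 = (hnorm K v)\<^sup>2 + (hnorm K u)\<^sup>2 + 2 * Re (cinner K v u)"
    if u: "u \<in> carrier K" for u
  proof -
    note c = assms(1) u hilbert_add_closed[OF assms(1) u]
    have r: "cinner K z (v \<oplus>\<^bsub>K\<^esub> u) = cinner K z v + cinner K z u" if "z \<in> carrier K" for z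
      using cinner_cnj[of "v \<oplus>\<^bsub>K\<^esub> u" z] cinner_cnj[of v z] cinner_cnj[of u z] c that
      by (simp add: cinner_add)
    show ?thesis using c r cinner_cnj[of v u] by (simp add: hnorm_squared cinner_add)
  qed
  let ?w = "(-1) \<odot>\<^bsub>K\<^esub> w"
  have w': "?w \<in> carrier K" using assms by (simp add: hilbert_smult_closed)
  have "cinner K v ?w = - cinner K v w"
    using cinner_cnj[of ?w v] cinner_cnj[of w v] w' assms by (simp add: cinner_smult)
  then have "0 \<le> (hnorm K v)\<^sup>2 + (hnorm K w)\<^sup>2 - 2 * Re (cinner K v w)"
    using *[OF w'] hnorm_smult[OF assms(2), of "-1"] zero_le_power2[of "hnorm K (v \<oplus>\<^bsub>K\<^esub> ?w)"] by simp
  then show ?thesis using *[OF assms(2)] by simp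
qed

end


section \<open>Groupoid arrows along the graph of an iterate\<close>

lemma graph_arrow_in_gpd: "(x, int a, (\<sigma> ^^ a) x) \<in> gpd \<sigma>"
  unfolding gpd_def by (clarsimp, rule exI[of _ a], rule exI[of _ 0], simp)

text \<open>The map is continuous: the preimage of a basic set for \<open>(k, l)\<close> is empty unless \<open>k - l = a\<close>, and
  otherwise the condition \<open>\<sigma>\<^sup>k(x) = \<sigma>\<^sup>l(\<sigma>\<^sup>a x)\<close> holds for every \<open>x\<close>.\<close>

lemma graph_arrow_measurable:
  fixes \<sigma> :: "'x::topological_space \<Rightarrow> 'x"
  assumes \<sigma>: "continuous_on UNIV (\<sigma> ^^ a)"
  shows "(\<lambda>x. (x, int a, (\<sigma> ^^ a) x)) \<in> measurable borel (gpd_borel \<sigma>)"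
proof -
  let ?c = "\<lambda>x. (x, int a, (\<sigma> ^^ a) x)"
  have op: "open (?c -` W)" if "openin (gpd_topology \<sigma>) W" for W
    using that unfolding gpd_topology_def openin_topology_generated_by_iff
  proof (induction rule: generate_topology_on.induct)
    case (UN \<K>)
    then show ?case by (simp add: vimage_Union open_UN)
  next
    case (Basis W)
    then obtain U k l V where W: "W = gpd_basic \<sigma> U k l V" "open U" "open V" by auto
    show ?case
    proof (cases "k = l + a")
      case True
      have "?c -` W = U \<inter> (\<sigma> ^^ a) -` V" unfolding W gpd_basic_def True by (auto simp: funpow_add)
      then show ?thesis using W open_vimage[OF W(3) \<sigma>] by auto
    next
      case False
      then have "?c -` W = {}" unfolding W gpd_basic_def by auto
      then show ?thesis by simp
    qed
  qed auto
  have sub: "{U. openin (gpd_topology \<sigma>) U} \<subseteq> Pow (gpd \<sigma>)"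
  proof safe
    fix U x n y assume "openin (gpd_topology \<sigma>) U" "(x, n, y) \<in> U"
    then have "(x, n, y) \<in> topspace (gpd_topology \<sigma>)" using openin_subset by blast
    then show "(x, n, y) \<in> gpd \<sigma>" unfolding gpd_topology_def topology_generated_by_topspace
      by (auto simp: gpd_basic_def gpd_def)
  qed
  show ?thesis unfolding gpd_borel_def
  proof (rule measurable_measure_of[OF sub])
    show "?c \<in> space borel \<rightarrow> gpd \<sigma>" by (simp add: graph_arrow_in_gpd)
    show "?c -` W \<inter> space borel \<in> sets borel" if "W \<in> {U. openin (gpd_topology \<sigma>) U}" for W
      using op that by auto
  qed
qed


section \<open>The isometry of a filter on square integrable sections\<close>

locale filter_representation = conformal_measure d \<sigma> e0 \<psi> M \<delta> C \<mu>
  for d :: "'x::{second_countable_topology,t2_space} \<Rightarrow> 'x \<Rightarrow> real" and \<sigma> e0 \<psi> M \<delta> C \<mu> +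
  fixes H :: "'x \<Rightarrow> 'h inner_space" and B :: "('x \<times> 'h) measure" and L :: "'x arrow \<Rightarrow> 'h \<Rightarrow> 'h"
    and m :: "'x \<Rightarrow> complex"
  assumes rep: "unitary_representation \<sigma> H B L"
    and continuous_m: "continuous_on UNIV m"
    and filter: "ruelle (\<lambda>x. (cmod (m x))\<^sup>2) x = 1"
begin

abbreviation L2 :: "('x \<Rightarrow> 'h) set" where "L2 \<equiv> L2_sections H B \<mu>"

lemma fibre_hilbert: "hilbert_space (H x)"
  using rep by (simp add: unitary_representation_def borel_hilbert_bundle_def)

lemma L_unitary: "\<gamma> \<in> gpd \<sigma> \<Longrightarrow> unitary_operator (H (gpd_source \<gamma>)) (H (gpd_range \<gamma>)) (L \<gamma>)"
  using rep by (simp add: unitary_representation_def)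

lemma unit_in_gpd: "(x, 0, x) \<in> gpd \<sigma>" using graph_arrow_in_gpd[of x 0 \<sigma>] by simp
lemma step_in_gpd: "(x, 1, \<sigma> x) \<in> gpd \<sigma>" using graph_arrow_in_gpd[of x 1 \<sigma>] by simp

text \<open>A surjective idempotent is the identity.\<close>

lemma L_unit:
  assumes v: "v \<in> carrier (H x)" shows "L (x, 0, x) v = v"
proof -
  have U: "unitary_operator (H x) (H x) (L (x, 0, x))"
    using L_unitary[OF unit_in_gpd[of x]] by (simp add: gpd_source_def gpd_range_def)
  then obtain w where w: "w \<in> carrier (H x)" "v = L (x, 0, x) w"
    using v unfolding unitary_operator_def by blast
  have "\<forall>\<gamma>\<in>gpd \<sigma>. \<forall>\<eta>\<in>gpd \<sigma>. gpd_source \<gamma> = gpd_range \<eta> \<longrightarrow>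
        (\<forall>v\<in>carrier (H (gpd_source \<eta>)). L (gpd_mult \<gamma> \<eta>) v = L \<gamma> (L \<eta> v))"
    using rep by (simp add: unitary_representation_def)
  then have "L (gpd_mult (x, 0, x) (x, 0, x)) w = L (x, 0, x) (L (x, 0, x) w)"
    using unit_in_gpd[of x] w(1) by (auto simp: gpd_source_def gpd_range_def)
  then show ?thesis using w(2) by (simp add: gpd_mult_def)
qed

lemma coefficient_measurable:
  assumes "borel_section H B f" "borel_section H B g"
  shows "(\<lambda>x. cinner (H x) (L (x, int a, (\<sigma> ^^ a) x) (f ((\<sigma> ^^ a) x))) (g x)) \<in> borel_measurable borel"
proof -
  have "(\<lambda>\<gamma>. cinner (H (gpd_range \<gamma>)) (L \<gamma> (f (gpd_source \<gamma>))) (g (gpd_range \<gamma>)))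
          \<in> borel_measurable (gpd_borel \<sigma>)"
    using rep assms by (simp add: unitary_representation_def)
  from measurable_compose[OF graph_arrow_measurable[OF continuous_iterate] this, of a]
  show ?thesis by (simp add: gpd_range_def gpd_source_def)
qed

text \<open>The inner product of two Borel sections is a coefficient of the representation on the units, so
  it is Borel without any orthogonalization of the fundamental sequence.\<close>

lemma cinner_measurable:
  assumes "borel_section H B f" "borel_section H B g"
  shows "(\<lambda>x. cinner (H x) (f x) (g x)) \<in> borel_measurable borel"
proof -
  have "f x \<in> carrier (H x)" for x using assms(1) by (simp add: borel_section_def)
  then show ?thesis using coefficient_measurable[OF assms, of 0] by (simp add: L_unit)
qed

text \<open>Borel sections are recognized by their inner products with the fundamental sequence, because
  these generate the Borel structure of the bundle.\<close>

lemma fundamental_sequence: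
  obtains f :: "nat \<Rightarrow> 'x \<Rightarrow> 'h" where "\<forall>n. borel_section H B (f n)"
    "\<forall>h. (\<forall>x. h x \<in> carrier (H x)) \<longrightarrow> (\<forall>n. (\<lambda>x. cinner (H x) (h x) (f n x)) \<in> borel_measurable borel)
      \<longrightarrow> borel_section H B h"
proof -
  obtain f :: "nat \<Rightarrow> 'x \<Rightarrow> 'h" where f: "\<forall>n x. f n x \<in> carrier (H x)"
     "\<forall>n m. (\<lambda>x. cinner (H x) (f n x) (f m x)) \<in> borel_measurable borel"
     and B: "sets B = sets (vimage_algebra (SIGMA x:UNIV. carrier (H x))
                         (\<lambda>(x, v). (x, \<lambda>n. cinner (H x) v (f n x)))
                         (borel \<Otimes>\<^sub>M (\<Pi>\<^sub>M n\<in>UNIV. borel)))"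
    using rep unfolding unitary_representation_def borel_hilbert_bundle_def by (elim conjE exE) (rule that)
  have crit: "borel_section H B h"
    if h: "\<forall>x. h x \<in> carrier (H x)" "\<forall>n. (\<lambda>x. cinner (H x) (h x) (f n x)) \<in> borel_measurable borel" for h
  proof -
    have "(\<lambda>x. (\<lambda>(x, v). (x, \<lambda>n. cinner (H x) v (f n x))) (x, h x))
        \<in> measurable borel (borel \<Otimes>\<^sub>M (\<Pi>\<^sub>M n\<in>UNIV. borel))"
      using h(2) by (simp, intro measurable_Pair measurable_ident measurable_PiM_single') auto
    then have "(\<lambda>x. (x, h x)) \<in> measurable borel (vimage_algebra (SIGMA x:UNIV. carrier (H x))
                         (\<lambda>(x, v). (x, \<lambda>n. cinner (H x) v (f n x)))
                         (borel \<Otimes>\<^sub>M (\<Pi>\<^sub>M n\<in>UNIV. borel)))"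
      using h(1) by (intro measurable_vimage_algebra2) auto
    then show ?thesis using h(1) measurable_cong_sets[OF refl B] by (auto simp: borel_section_def)
  qed
  show ?thesis by (rule that[of f]) (use crit f in auto)
qed

lemma section_carrier: "borel_section H B h \<Longrightarrow> h x \<in> carrier (H x)"
  by (simp add: borel_section_def)

text \<open>The isometry \<open>S\<close> on representatives: the factor \<open>sqrt \<psi>\<close> in \<open>u\<close> cancels
  the power \<open>- 1 / 2\<close> of the modular function.\<close>

definition weighted_shift :: "('x \<Rightarrow> 'h) \<Rightarrow> 'x \<Rightarrow> 'h" where
  "weighted_shift h x = m x \<odot>\<^bsub>H x\<^esub> L (x, 1, \<sigma> x) (h (\<sigma> x))"

lemma L_step_unitary: "unitary_operator (H (\<sigma> x)) (H x) (L (x, 1, \<sigma> x))"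
  using L_unitary[OF step_in_gpd[of x]] by (simp add: gpd_source_def gpd_range_def)

lemma L_step_closed: "v \<in> carrier (H (\<sigma> x)) \<Longrightarrow> L (x, 1, \<sigma> x) v \<in> carrier (H x)"
  using L_step_unitary[of x] unfolding unitary_operator_def by blast

lemma weighted_shift_closed: "h (\<sigma> x) \<in> carrier (H (\<sigma> x)) \<Longrightarrow> weighted_shift h x \<in> carrier (H x)"
  by (simp add: weighted_shift_def hilbert_smult_closed[OF fibre_hilbert] L_step_closed)

lemma hnorm_weighted_shift:
  assumes "h (\<sigma> x) \<in> carrier (H (\<sigma> x))"
  shows "(hnorm (H x) (weighted_shift h x))\<^sup>2 = (cmod (m x))\<^sup>2 * (hnorm (H (\<sigma> x)) (h (\<sigma> x)))\<^sup>2"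
proof -
  have "cinner (H x) (L (x, 1, \<sigma> x) (h (\<sigma> x))) (L (x, 1, \<sigma> x) (h (\<sigma> x)))
      = cinner (H (\<sigma> x)) (h (\<sigma> x)) (h (\<sigma> x))"
    using L_step_unitary[of x] assms by (simp add: unitary_operator_def)
  then show ?thesis
    by (simp add: weighted_shift_def hnorm_smult[OF fibre_hilbert L_step_closed[OF assms]] hnorm_squared[OF fibre_hilbert] L_step_closed[OF assms] assms)
qed

lemma weighted_shift_add:
  assumes "\<And>x. g x \<in> carrier (H x)" "\<And>x. h x \<in> carrier (H x)"
  shows "weighted_shift (\<lambda>x. g x \<oplus>\<^bsub>H x\<^esub> h x) = (\<lambda>x. weighted_shift g x \<oplus>\<^bsub>H x\<^esub> weighted_shift h x)"
  using L_step_unitary assms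
  by (simp add: fun_eq_iff weighted_shift_def unitary_operator_def linear_operator_def hilbert_smult_add[OF fibre_hilbert] L_step_closed)

lemma weighted_shift_smult:
  assumes "\<And>x. h x \<in> carrier (H x)"
  shows "weighted_shift (\<lambda>x. c \<odot>\<^bsub>H x\<^esub> h x) = (\<lambda>x. c \<odot>\<^bsub>H x\<^esub> weighted_shift h x)"
  using L_step_unitary assms
  by (simp add: fun_eq_iff weighted_shift_def unitary_operator_def linear_operator_def hilbert_smult_smult[OF fibre_hilbert] L_step_closed mult.commute)

text \<open>The support of \<open>S_fun\<close> over \<open>x\<close> consists of the single arrow \<open>(x, 1, \<sigma> x)\<close>, or of none if \<open>m\<close>
  vanishes at \<open>x\<close>; there the modular function is \<open>\<psi>(x)\<close>.\<close>

lemma integrated_section_eq: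
  assumes h: "\<And>x. h x \<in> carrier (H x)" and u: "u = (\<lambda>x. complex_of_real (sqrt (\<psi> x)) * m x)"
  shows "integrated_section \<sigma> \<psi> H L (S_fun \<sigma> u) h x = weighted_shift h x"
proof -
  have nz: "\<psi> z \<noteq> 0" for z using \<psi>_pos[of z] by simp
  have mod: "modular_fun \<sigma> \<psi> (x, 1, \<sigma> x) = \<psi> x"
    using modular_fun_eq[of \<psi> 1 \<sigma> x 0 "\<sigma> x"] nz by (simp add: iter_potential_def)
  have "complex_of_real (sqrt (\<psi> x)) * complex_of_real (\<psi> x powr (- 1 / 2)) = 1"
    using \<psi>_pos[of x] by (simp add: powr_half_sqrt[symmetric] powr_add[symmetric] flip: of_real_mult)
  then have um: "u x * complex_of_real (\<psi> x powr (- 1 / 2)) = m x"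
    unfolding u by (simp add: mult.commute mult.left_commute)
  then have um': "u x * complex_of_real (\<psi> x powr - (1 / 2)) = m x" by simp
  have car: "m x \<odot>\<^bsub>H x\<^esub> L (x, 1, \<sigma> x) (h (\<sigma> x)) \<in> carrier (H x)"
    by (intro hilbert_smult_closed[OF fibre_hilbert] L_step_closed h)
  show ?thesis
  proof (cases "u x = 0")
    case True
    then have m0: "m x = 0" using nz[of x] u by simp
    have "{\<gamma> \<in> gpd \<sigma>. gpd_range \<gamma> = x \<and> S_fun \<sigma> u \<gamma> \<noteq> 0} = {}"
      using True by (auto simp: gpd_range_def S_fun_def split: if_splits)
    then show ?thesis unfolding integrated_section_def
      by (simp only: hilbert_finsum_empty[OF fibre_hilbert] weighted_shift_def m0 hilbert_smult_0[OF fibre_hilbert L_step_closed[OF h]])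
  next
    case False
    have "{\<gamma> \<in> gpd \<sigma>. gpd_range \<gamma> = x \<and> S_fun \<sigma> u \<gamma> \<noteq> 0} = {(x, 1, \<sigma> x)}"
      using False step_in_gpd[of x] by (auto simp: gpd_range_def S_fun_def split: if_splits)
    then show ?thesis unfolding integrated_section_def
      using car by (subst \<open>_ = {(x, 1, \<sigma> x)}\<close>, subst hilbert_finsum_singleton[OF fibre_hilbert])
        (simp_all add: S_fun_def mod um' gpd_source_def weighted_shift_def)
  qed
qed

lemma section_add:
  assumes g: "borel_section H B g" and h: "borel_section H B h"
  shows "borel_section H B (\<lambda>x. g x \<oplus>\<^bsub>H x\<^esub> h x)"
proof -
  obtain f :: "nat \<Rightarrow> 'x \<Rightarrow> 'h" where f: "\<forall>n. borel_section H B (f n)"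
    "\<forall>h. (\<forall>x. h x \<in> carrier (H x)) \<longrightarrow> (\<forall>n. (\<lambda>x. cinner (H x) (h x) (f n x)) \<in> borel_measurable borel)
      \<longrightarrow> borel_section H B h" by (rule fundamental_sequence, rule that)
  note c = section_carrier[OF g] section_carrier[OF h] section_carrier[OF f(1)[rule_format]]
  show ?thesis
  proof (rule f(2)[rule_format])
    show "g x \<oplus>\<^bsub>H x\<^esub> h x \<in> carrier (H x)" for x by (intro hilbert_add_closed[OF fibre_hilbert] c)
    show "(\<lambda>x. cinner (H x) (g x \<oplus>\<^bsub>H x\<^esub> h x) (f n x)) \<in> borel_measurable borel" for n
      using cinner_measurable[OF g f(1)[rule_format, of n]] cinner_measurable[OF h f(1)[rule_format, of n]]
      by (simp add: cinner_add[OF fibre_hilbert] c)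
  qed
qed

lemma section_smult:
  assumes h: "borel_section H B h"
  shows "borel_section H B (\<lambda>x. c \<odot>\<^bsub>H x\<^esub> h x)"
proof -
  obtain f :: "nat \<Rightarrow> 'x \<Rightarrow> 'h" where f: "\<forall>n. borel_section H B (f n)"
    "\<forall>h. (\<forall>x. h x \<in> carrier (H x)) \<longrightarrow> (\<forall>n. (\<lambda>x. cinner (H x) (h x) (f n x)) \<in> borel_measurable borel)
      \<longrightarrow> borel_section H B h" by (rule fundamental_sequence, rule that)
  note c = section_carrier[OF h] section_carrier[OF f(1)[rule_format]]
  show ?thesis
  proof (rule f(2)[rule_format])
    show "c \<odot>\<^bsub>H x\<^esub> h x \<in> carrier (H x)" for x by (intro hilbert_smult_closed[OF fibre_hilbert] c)
    show "(\<lambda>x. cinner (H x) (c \<odot>\<^bsub>H x\<^esub> h x) (f n x)) \<in> borel_measurable borel" for n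
      using cinner_measurable[OF h f(1)[rule_format, of n]]
      by (simp add: cinner_smult[OF fibre_hilbert] c)
  qed
qed

lemma section_zero: "borel_section H B (\<lambda>x. \<zero>\<^bsub>H x\<^esub>)"
proof -
  obtain f :: "nat \<Rightarrow> 'x \<Rightarrow> 'h" where f: "\<forall>n. borel_section H B (f n)"
    "\<forall>h. (\<forall>x. h x \<in> carrier (H x)) \<longrightarrow> (\<forall>n. (\<lambda>x. cinner (H x) (h x) (f n x)) \<in> borel_measurable borel)
      \<longrightarrow> borel_section H B h" by (rule fundamental_sequence, rule that)
  note c = section_carrier[OF f(1)[rule_format]]
  show ?thesis
    by (rule f(2)[rule_format]) (simp_all add: hilbert_zero_closed[OF fibre_hilbert] cinner_zero[OF fibre_hilbert] c)
qed

lemma section_weighted_shift: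
  assumes h: "borel_section H B h"
  shows "borel_section H B (weighted_shift h)"
proof -
  obtain f :: "nat \<Rightarrow> 'x \<Rightarrow> 'h" where f: "\<forall>n. borel_section H B (f n)"
    "\<forall>h. (\<forall>x. h x \<in> carrier (H x)) \<longrightarrow> (\<forall>n. (\<lambda>x. cinner (H x) (h x) (f n x)) \<in> borel_measurable borel)
      \<longrightarrow> borel_section H B h" by (rule fundamental_sequence, rule that)
  note c = section_carrier[OF h] section_carrier[OF f(1)[rule_format]]
  have mm: "m \<in> borel_measurable borel" by (rule borel_measurable_continuous_onI[OF continuous_m])
  show ?thesis
  proof (rule f(2)[rule_format])
    show "weighted_shift h x \<in> carrier (H x)" for x by (intro weighted_shift_closed c)
    have "(\<lambda>x. m x * cinner (H x) (L (x, 1, \<sigma> x) (h (\<sigma> x))) (f n x)) \<in> borel_measurable borel" for n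
      using coefficient_measurable[OF h f(1)[rule_format, of n], of 1] mm by simp
    then show "(\<lambda>x. cinner (H x) (weighted_shift h x) (f n x)) \<in> borel_measurable borel" for n
      by (simp add: weighted_shift_def cinner_smult[OF fibre_hilbert] L_step_closed c)
  qed
qed

abbreviation sq :: "('x \<Rightarrow> 'h) \<Rightarrow> 'x \<Rightarrow> real" where
  "sq h x \<equiv> (hnorm (H x) (h x))\<^sup>2"

lemma sq_measurable: "borel_section H B h \<Longrightarrow> sq h \<in> borel_measurable borel"
  using cinner_measurable[of h h] by (simp add: hnorm_squared[OF fibre_hilbert] section_carrier)

lemma L2_iff: "h \<in> L2 \<longleftrightarrow> borel_section H B h \<and> integrable \<mu> (sq h)"
  by (simp add: L2_sections_def)

lemma L2_carrier: "h \<in> L2 \<Longrightarrow> h x \<in> carrier (H x)"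
  by (simp add: L2_iff section_carrier)

lemma L2_add:
  assumes "g \<in> L2" "h \<in> L2" shows "(\<lambda>x. g x \<oplus>\<^bsub>H x\<^esub> h x) \<in> L2"
proof -
  have s: "borel_section H B (\<lambda>x. g x \<oplus>\<^bsub>H x\<^esub> h x)" using assms by (simp add: L2_iff section_add)
  have "integrable \<mu> (\<lambda>x. 2 * sq g x + 2 * sq h x)" using assms by (simp add: L2_iff)
  then have "integrable \<mu> (sq (\<lambda>x. g x \<oplus>\<^bsub>H x\<^esub> h x))"
  proof (rule Bochner_Integration.integrable_bound)
    show "sq (\<lambda>x. g x \<oplus>\<^bsub>H x\<^esub> h x) \<in> borel_measurable \<mu>" using sq_measurable[OF s] by (simp add: measurable_\<mu>_iff)
    show "AE x in \<mu>. norm (sq (\<lambda>x. g x \<oplus>\<^bsub>H x\<^esub> h x) x) \<le> norm (2 * sq g x + 2 * sq h x)"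
      using hnorm_add[OF fibre_hilbert L2_carrier[OF assms(1)] L2_carrier[OF assms(2)]] by (intro AE_I2) simp
  qed
  then show ?thesis using s by (simp add: L2_iff)
qed

lemma L2_smult:
  assumes "h \<in> L2" shows "(\<lambda>x. c \<odot>\<^bsub>H x\<^esub> h x) \<in> L2"
  using assms by (simp add: L2_iff section_smult hnorm_smult[OF fibre_hilbert] section_carrier)

lemma L2_zero: "(\<lambda>x. \<zero>\<^bsub>H x\<^esub>) \<in> L2"
  by (simp add: L2_iff section_zero hnorm_squared[OF fibre_hilbert] hilbert_zero_closed[OF fibre_hilbert] cinner_zero[OF fibre_hilbert])

abbreviation p :: "'x \<Rightarrow> real" where "p x \<equiv> (cmod (m x))\<^sup>2"

lemma p_weight: "continuous_on UNIV p" "0 \<le> p x" "ruelle p x = 1"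
  using filter by (auto intro!: continuous_intros continuous_m)

lemma sq_weighted_shift: "h \<in> L2 \<Longrightarrow> sq (weighted_shift h) x = p x * sq h (\<sigma> x)"
  by (simp add: hnorm_weighted_shift L2_carrier)

lemma
  assumes "h \<in> L2" shows L2_weighted_shift: "weighted_shift h \<in> L2" and integral_sq_weighted_shift: "(\<integral>x. sq (weighted_shift h) x \<partial>\<mu>) = (\<integral>x. sq h x \<partial>\<mu>)"
proof -
  have s: "sq h \<in> borel_measurable borel" using assms by (simp add: L2_iff sq_measurable)
  show "weighted_shift h \<in> L2"
    using weighted_preimage(1)[OF p_weight s] assms by (simp add: L2_iff section_weighted_shift hnorm_weighted_shift section_carrier)
  show "(\<integral>x. sq (weighted_shift h) x \<partial>\<mu>) = (\<integral>x. sq h x \<partial>\<mu>)"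
    using weighted_preimage(2)[OF p_weight s] assms by (simp add: sq_weighted_shift)
qed

definition L2_class :: "('x \<Rightarrow> 'h) \<Rightarrow> ('x \<Rightarrow> 'h) set" where
  "L2_class h = {k \<in> L2. AE x in \<mu>. h x = k x}"

lemma L2_class_mem: "k \<in> L2_class h \<longleftrightarrow> k \<in> L2 \<and> (AE x in \<mu>. h x = k x)" by (simp add: L2_class_def)

lemma L2_class_refl: "h \<in> L2 \<Longrightarrow> h \<in> L2_class h" by (simp add: L2_class_mem)

lemma L2_class_eqI: "(AE x in \<mu>. h x = k x) \<Longrightarrow> L2_class h = L2_class k"
  unfolding L2_class_def by (intro Collect_cong conj_cong refl) (auto elim: eventually_elim2)

abbreviation L2sp where "L2sp \<equiv> L2_space H B \<mu>"

lemma carrier_L2sp: "a \<in> carrier L2sp \<longleftrightarrow> (\<exists>h\<in>L2. a = L2_class h)"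
  by (auto simp: L2_space_def quotient_def ae_eq_def L2_class_def Image_def)

lemma zero_L2sp: "\<zero>\<^bsub>L2sp\<^esub> = L2_class (\<lambda>x. \<zero>\<^bsub>H x\<^esub>)"
  by (simp add: L2_space_def L2_class_def eq_commute)

lemma add_L2sp:
  assumes "g \<in> L2" "h \<in> L2"
  shows "L2_class g \<oplus>\<^bsub>L2sp\<^esub> L2_class h = L2_class (\<lambda>x. g x \<oplus>\<^bsub>H x\<^esub> h x)"
proof -
  have "(\<exists>g'\<in>L2_class g. \<exists>h'\<in>L2_class h. AE x in \<mu>. k x = g' x \<oplus>\<^bsub>H x\<^esub> h' x) \<longleftrightarrow> (AE x in \<mu>. g x \<oplus>\<^bsub>H x\<^esub> h x = k x)" for k
  proof (rule iffI, elim bexE)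
    fix g' h' assume "g' \<in> L2_class g" "h' \<in> L2_class h" "AE x in \<mu>. k x = g' x \<oplus>\<^bsub>H x\<^esub> h' x"
    then show "AE x in \<mu>. g x \<oplus>\<^bsub>H x\<^esub> h x = k x" unfolding L2_class_mem by auto
  next
    assume "AE x in \<mu>. g x \<oplus>\<^bsub>H x\<^esub> h x = k x"
    then have "AE x in \<mu>. k x = g x \<oplus>\<^bsub>H x\<^esub> h x" by auto
    then show "\<exists>g'\<in>L2_class g. \<exists>h'\<in>L2_class h. AE x in \<mu>. k x = g' x \<oplus>\<^bsub>H x\<^esub> h' x"
      using L2_class_refl assms by blast
  qed
  then show ?thesis by (simp add: L2_space_def L2_class_def[of "\<lambda>x. g x \<oplus>\<^bsub>H x\<^esub> h x"])
qed

lemma smult_L2sp: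
  assumes "h \<in> L2"
  shows "c \<odot>\<^bsub>L2sp\<^esub> L2_class h = L2_class (\<lambda>x. c \<odot>\<^bsub>H x\<^esub> h x)"
proof -
  have "(\<exists>h'\<in>L2_class h. AE x in \<mu>. k x = c \<odot>\<^bsub>H x\<^esub> h' x) \<longleftrightarrow> (AE x in \<mu>. c \<odot>\<^bsub>H x\<^esub> h x = k x)" for k
  proof (rule iffI, elim bexE)
    fix h' assume "h' \<in> L2_class h" "AE x in \<mu>. k x = c \<odot>\<^bsub>H x\<^esub> h' x"
    then show "AE x in \<mu>. c \<odot>\<^bsub>H x\<^esub> h x = k x" unfolding L2_class_mem by auto
  next
    assume "AE x in \<mu>. c \<odot>\<^bsub>H x\<^esub> h x = k x"
    then have "AE x in \<mu>. k x = c \<odot>\<^bsub>H x\<^esub> h x" by auto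
    then show "\<exists>h'\<in>L2_class h. AE x in \<mu>. k x = c \<odot>\<^bsub>H x\<^esub> h' x"
      using L2_class_refl assms by blast
  qed
  then show ?thesis by (simp add: L2_space_def L2_class_def[of "\<lambda>x. c \<odot>\<^bsub>H x\<^esub> h x"])
qed

lemma hnorm_L2sp:
  assumes "h \<in> L2"
  shows "hnorm L2sp (L2_class h) = sqrt (\<integral>x. sq h x \<partial>\<mu>)"
proof -
  have c: "cinner (H x) (k x) (k x) = complex_of_real (sq k x)" if "k \<in> L2" for k x
    using cinner_self[OF fibre_hilbert L2_carrier[OF that]] by (simp add: hnorm_squared[OF fibre_hilbert L2_carrier[OF that]])
  have m: "(\<lambda>x. cinner (H x) (g x) (k x)) \<in> borel_measurable \<mu>" if "g \<in> L2" "k \<in> L2" for g k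
    using that cinner_measurable[of g k] measurable_cong_sets[OF sets_\<mu> refl, of "borel :: complex measure"] by (auto simp: L2_iff)
  have eq: "(\<integral>x. cinner (H x) (g x) (k x) \<partial>\<mu>) = (\<integral>x. cinner (H x) (h x) (h x) \<partial>\<mu>)"
    if "g \<in> L2_class h" "k \<in> L2_class h" for g k
    using that assms unfolding L2_class_mem by (intro integral_cong_AE m) auto
  have "cinner L2sp (L2_class h) (L2_class h)
      = (THE c. \<exists>g\<in>L2_class h. \<exists>k\<in>L2_class h. c = (\<integral>x. cinner (H x) (g x) (k x) \<partial>\<mu>))"
    by (simp add: L2_space_def)
  also have "\<dots> = (\<integral>x. cinner (H x) (h x) (h x) \<partial>\<mu>)"
  proof (rule the_equality)
    show "\<exists>g\<in>L2_class h. \<exists>k\<in>L2_class h. (\<integral>x. cinner (H x) (h x) (h x) \<partial>\<mu>) = (\<integral>x. cinner (H x) (g x) (k x) \<partial>\<mu>)"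
      by (intro bexI[of _ h] L2_class_refl assms refl)
  next
    fix c assume "\<exists>g\<in>L2_class h. \<exists>k\<in>L2_class h. c = (\<integral>x. cinner (H x) (g x) (k x) \<partial>\<mu>)"
    then show "c = (\<integral>x. cinner (H x) (h x) (h x) \<partial>\<mu>)" by (elim bexE) (simp only: eq)
  qed
  also have "\<dots> = complex_of_real (\<integral>x. sq h x \<partial>\<mu>)"
    by (simp only: c[OF assms] integral_complex_of_real)
  finally show ?thesis unfolding hnorm_def[of L2sp] by simp
qed

context
  fixes u assumes u: "u = (\<lambda>x. complex_of_real (sqrt (\<psi> x)) * m x)"
begin

abbreviation S where "S \<equiv> integrated_form \<sigma> \<psi> \<mu> H B L (S_fun \<sigma> u)"

text \<open>Well defined on classes because \<open>\<sigma>\<close> preserves \<open>\<mu>\<close>: sections that agree almost everywhere still do so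
  after composition with \<open>\<sigma>\<close>.\<close>

lemma S_class:
  assumes "h \<in> L2" shows "S (L2_class h) = L2_class (weighted_shift h)"
proof -
  have eq: "integrated_section \<sigma> \<psi> H L (S_fun \<sigma> u) k x = weighted_shift k x" if "k \<in> L2" for k x
    using integrated_section_eq[OF L2_carrier[OF that] u] .
  have "(\<exists>h'\<in>L2_class h. AE x in \<mu>. k x = integrated_section \<sigma> \<psi> H L (S_fun \<sigma> u) h' x) \<longleftrightarrow> (AE x in \<mu>. weighted_shift h x = k x)" for k
  proof (rule iffI, elim bexE)
    fix h' assume h': "h' \<in> L2_class h" "AE x in \<mu>. k x = integrated_section \<sigma> \<psi> H L (S_fun \<sigma> u) h' x"
    then have "AE x in \<mu>. h (\<sigma> x) = h' (\<sigma> x)" using AE_\<sigma>[of "\<lambda>x. h x = h' x"] by (simp add: L2_class_mem)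
    then show "AE x in \<mu>. weighted_shift h x = k x"
      using h'(2)
    proof eventually_elim
      case (elim x)
      then show ?case using h'(1) by (simp add: eq L2_class_mem) (simp add: weighted_shift_def)
    qed
  next
    assume "AE x in \<mu>. weighted_shift h x = k x"
    then have "AE x in \<mu>. k x = integrated_section \<sigma> \<psi> H L (S_fun \<sigma> u) h x"
      using eq[OF assms] by auto
    then show "\<exists>h'\<in>L2_class h. AE x in \<mu>. k x = integrated_section \<sigma> \<psi> H L (S_fun \<sigma> u) h' x"
      using L2_class_refl[OF assms] by blast
  qed
  then show ?thesis by (simp add: integrated_form_def L2_class_def[of "weighted_shift h"])
qed

lemma isometry_S: "isometry_on L2sp S"
  unfolding isometry_on_def linear_operator_def
proof (intro conjI ballI allI funcsetI)
  fix a assume "a \<in> carrier L2sp"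
  then obtain h where h: "h \<in> L2" "a = L2_class h" by (auto simp: carrier_L2sp)
  show "S a \<in> carrier L2sp" using h L2_weighted_shift[OF h(1)] by (auto simp: S_class carrier_L2sp)
  show "hnorm L2sp (S a) = hnorm L2sp a"
    by (simp only: h(2) S_class[OF h(1)] hnorm_L2sp[OF h(1)] hnorm_L2sp[OF L2_weighted_shift[OF h(1)]] integral_sq_weighted_shift[OF h(1)])
  show "S (c \<odot>\<^bsub>L2sp\<^esub> a) = c \<odot>\<^bsub>L2sp\<^esub> S a" for c
    by (simp add: h(2) smult_L2sp[OF h(1)] S_class[OF h(1)] S_class[OF L2_smult[OF h(1)]] smult_L2sp[OF L2_weighted_shift[OF h(1)]]
        weighted_shift_smult L2_carrier[OF h(1)])
  fix b assume "b \<in> carrier L2sp"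
  then obtain k where k: "k \<in> L2" "b = L2_class k" by (auto simp: carrier_L2sp)
  show "S (a \<oplus>\<^bsub>L2sp\<^esub> b) = S a \<oplus>\<^bsub>L2sp\<^esub> S b"
    by (simp add: h(2) k(2) add_L2sp[OF h(1) k(1)] S_class[OF h(1)] S_class[OF k(1)] S_class[OF L2_add[OF h(1) k(1)]]
        add_L2sp[OF L2_weighted_shift[OF h(1)] L2_weighted_shift[OF k(1)]] weighted_shift_add L2_carrier[OF h(1)] L2_carrier[OF k(1)])
qed

lemma L2_T_iterate: "h \<in> L2 \<Longrightarrow> (weighted_shift ^^ n) h \<in> L2"
  by (induction n) (simp_all add: L2_weighted_shift)

lemma S_iterate_class: "h \<in> L2 \<Longrightarrow> (S ^^ n) (L2_class h) = L2_class ((weighted_shift ^^ n) h)"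
  by (induction n) (simp_all add: S_class L2_T_iterate)

lemma S_zero: "S \<zero>\<^bsub>L2sp\<^esub> = \<zero>\<^bsub>L2sp\<^esub>"
proof -
  have "weighted_shift (\<lambda>x. \<zero>\<^bsub>H x\<^esub>) = (\<lambda>x. \<zero>\<^bsub>H x\<^esub>)"
  proof
    fix x
    have c: "weighted_shift (\<lambda>x. \<zero>\<^bsub>H x\<^esub>) x \<in> carrier (H x)" by (intro weighted_shift_closed hilbert_zero_closed fibre_hilbert)
    have "Re (cinner (H x) (weighted_shift (\<lambda>x. \<zero>\<^bsub>H x\<^esub>) x) (weighted_shift (\<lambda>x. \<zero>\<^bsub>H x\<^esub>) x)) = 0"
      using sq_weighted_shift[OF L2_zero, of x]
      by (simp add: hnorm_squared[OF fibre_hilbert] c hilbert_zero_closed[OF fibre_hilbert] cinner_zero[OF fibre_hilbert])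
    then show "weighted_shift (\<lambda>x. \<zero>\<^bsub>H x\<^esub>) x = \<zero>\<^bsub>H x\<^esub>" using cinner_self[OF fibre_hilbert c] cinner_eq_0[OF fibre_hilbert c] by simp
  qed
  then show ?thesis by (simp add: zero_L2sp S_class[OF L2_zero])
qed

text \<open>The pointwise squared norms along an orbit of \<open>S\<close> form the chains required by \<open>weight_rigidity\<close>.\<close>

theorem pure_S:
  assumes "\<not> (AE x in \<mu>. cmod (m x) = 1)"
  shows "pure_isometry L2sp S"
  unfolding pure_isometry_def
proof (intro conjI isometry_S equalityI subsetI)
  fix a assume "a \<in> {\<zero>\<^bsub>L2sp\<^esub>}"
  then have a: "a = \<zero>\<^bsub>L2sp\<^esub>" by simp
  have "(S ^^ n) \<zero>\<^bsub>L2sp\<^esub> = \<zero>\<^bsub>L2sp\<^esub>" for n by (induction n) (simp_all add: S_zero)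
  moreover have "\<zero>\<^bsub>L2sp\<^esub> \<in> carrier L2sp" using L2_zero by (auto simp: carrier_L2sp zero_L2sp)
  ultimately show "a \<in> (\<Inter>n. (S ^^ n) ` carrier L2sp)"
    unfolding a by (intro INT_I image_eqI[of _ _ "\<zero>\<^bsub>L2sp\<^esub>"]) simp_all
next
  fix a assume a: "a \<in> (\<Inter>n. (S ^^ n) ` carrier L2sp)"
  then have "a \<in> (S ^^ 0) ` carrier L2sp" by blast
  then obtain h where h: "h \<in> L2" "a = L2_class h" by (auto simp: carrier_L2sp)
  have "AE x in \<mu>. sq h x = 0"
  proof (rule weight_rigidity[OF p_weight])
    show "integrable \<mu> (sq h)" using h by (simp add: L2_iff)
    have "p x = 1 \<longleftrightarrow> cmod (m x) = 1" for x
      using norm_ge_zero[of "m x"] unfolding power2_eq_1_iff by linarith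
    then show "\<not> (AE x in \<mu>. p x = 1)" using assms by simp
    fix n
    have "a \<in> (S ^^ n) ` carrier L2sp" using a by blast
    then obtain k where k: "k \<in> L2" "a = L2_class ((weighted_shift ^^ n) k)" by (auto simp: carrier_L2sp S_iterate_class)
    have "(weighted_shift ^^ n) k \<in> L2_class h" using k(2) h(2) L2_class_refl[OF L2_T_iterate[OF k(1), of n]] by simp
    then have hk: "AE x in \<mu>. h x = (weighted_shift ^^ n) k x" by (simp add: L2_class_mem)
    \<comment> \<open>\<open>h\<close> and \<open>(weighted_shift ^^ n) k\<close> agree only almost everywhere, but the chain has to start at \<open>h\<close> itself.\<close>
    define b where "b i = (if i = 0 then sq h else sq ((weighted_shift ^^ (n - i)) k))" for i
    have step: "sq ((weighted_shift ^^ (n - i)) k) x = p x * sq ((weighted_shift ^^ (n - Suc i)) k) (\<sigma> x)" if "i < n" for i x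
    proof -
      have "n - i = Suc (n - Suc i)" using that by simp
      then have "(weighted_shift ^^ (n - i)) k = weighted_shift ((weighted_shift ^^ (n - Suc i)) k)" by simp
      then show ?thesis by (simp only: sq_weighted_shift[OF L2_T_iterate[OF k(1)]])
    qed
    have "integrable \<mu> (b i)" for i
      using h(1) L2_T_iterate[OF k(1)] by (simp add: b_def L2_iff)
    moreover have "AE x in \<mu>. b i x = p x * b (Suc i) (\<sigma> x)" if "i < n" for i
      using hk
    proof eventually_elim
      case (elim x)
      then show ?case using step[OF that, of x] by (auto simp: b_def)
    qed
    ultimately show "\<exists>b. b 0 = sq h \<and> (\<forall>i\<le>n. integrable \<mu> (b i)) \<and>
        (\<forall>i<n. AE x in \<mu>. b i x = p x * b (Suc i) (\<sigma> x))"
      by (intro exI[of _ b]) (simp add: b_def)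
  qed simp
  then have "AE x in \<mu>. h x = \<zero>\<^bsub>H x\<^esub>"
  proof eventually_elim
    case (elim x)
    have c: "h x \<in> carrier (H x)" by (rule L2_carrier[OF h(1)])
    show ?case using elim cinner_self[OF fibre_hilbert c] cinner_eq_0[OF fibre_hilbert c] by (simp add: hnorm_squared[OF fibre_hilbert c])
  qed
  then show "a \<in> {\<zero>\<^bsub>L2sp\<^esub>}" using L2_class_eqI by (simp add: h(2) zero_L2sp)
qed

end

end


section \<open>Purity\<close>

theorem theorem12p3p1:
  fixes \<sigma> :: "'x::{second_countable_topology, t2_space} \<Rightarrow> 'x"
    and \<psi> :: "'x \<Rightarrow> real"
    and \<mu> :: "'x measure"
    and H :: "'x \<Rightarrow> 'h inner_space"
    and B :: "('x \<times> 'h) measure"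
    and L :: "'x arrow \<Rightarrow> 'h \<Rightarrow> 'h"
    and m u :: "'x \<Rightarrow> complex"
  assumes "compact (UNIV :: 'x set)"
    and "local_homeo \<sigma>" and "surj \<sigma>"
    and "full_potential \<psi>" and "unital_potential \<sigma> \<psi>"
    and "sets \<mu> = sets borel" and "prob_space \<mu>"
    and "quasi_invariant \<sigma> \<mu>" and "dual_invariant \<sigma> \<psi> \<mu>"
    and "minimal_rel (R_infinity \<sigma>)"
    and "\<exists>l\<ge>1. admits_generator (\<sigma> ^^ l)"
    and "\<exists>M\<ge>1. bowen_condition (\<sigma> ^^ M) (iter_potential \<sigma> \<psi> M)"
    and "unitary_representation \<sigma> H B L"
    and "potential_filter \<sigma> \<psi> m"
    and "measure \<mu> {x. cmod (m x) \<noteq> 1} > 0"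
    and "u = (\<lambda>x. complex_of_real (sqrt (\<psi> x)) * m x)"
  shows "pure_isometry (L2_space H B \<mu>) (integrated_form \<sigma> \<psi> \<mu> H B L (S_fun \<sigma> u))"
proof -
  obtain M where M: "1 \<le> M" "bowen_condition (\<sigma> ^^ M) (iter_potential \<sigma> \<psi> M)"
    using assms(12) by blast
  obtain d :: "'x \<Rightarrow> 'x \<Rightarrow> real" and \<delta> C where d: "Metric_space UNIV d" "Metric_space.mtopology UNIV d = euclidean"
    and \<delta>: "\<delta> > 0"
    and bowen: "\<forall>n\<ge>1. \<forall>x y. (\<forall>k<n. d (((\<sigma> ^^ M) ^^ k) x) (((\<sigma> ^^ M) ^^ k) y) \<le> \<delta>) \<longrightarrow>
          \<bar>\<Sum>k<n. ln (iter_potential \<sigma> \<psi> M (((\<sigma> ^^ M) ^^ k) x)) - ln (iter_potential \<sigma> \<psi> M (((\<sigma> ^^ M) ^^ k) y))\<bar> \<le> C"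
    using M(2) unfolding bowen_condition_def by (elim exE conjE) (rule that)
  interpret metrized_compact d by (intro metrized_compact.intro assms(1) d)
  obtain l where "admits_generator (\<sigma> ^^ l)" using assms(11) by blast
  then obtain e0 where e0: "e0 > 0" "\<And>x y. (\<And>n. d (((\<sigma> ^^ l) ^^ n) x) (((\<sigma> ^^ l) ^^ n) y) \<le> e0) \<Longrightarrow> x = y"
    using admits_generator_expansive[OF metrized_compact_axioms] by blast
  interpret expansive_local_homeo d \<sigma> e0
    by unfold_locales (use assms(2,3) e0 in \<open>auto simp: funpow_mult\<close>)
  have \<psi>: "continuous_on UNIV \<psi>" "\<And>x. 0 < \<psi> x"
    using assms(4) by (auto simp: full_potential_def potential_def order_less_le)
  have "transfer_op \<sigma> \<psi> (\<lambda>_. 1) x = 1" for x using assms(5) by (simp add: unital_potential_def)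
  then have "complex_of_real (\<Sum>y | \<sigma> y = x. \<psi> y) = 1" for x by (simp add: transfer_op_def)
  then have norm: "(\<Sum>y | \<sigma> y = x. \<psi> y) = 1" for x using of_real_eq_1_iff by blast
  interpret normalized_potential d \<sigma> e0 \<psi>
    by unfold_locales (use \<psi> norm in auto)
  interpret bowen_potential d \<sigma> e0 \<psi> M \<delta> C
    by unfold_locales (use M(1) \<delta> bowen assms(10) in auto)
  have tr: "transfer_op \<sigma> \<psi> (\<lambda>x. complex_of_real (f x)) x = complex_of_real (ruelle f x)" for f x
    by (simp add: transfer_op_def ruelle_def)
  have dual: "(\<integral>x. ruelle f x \<partial>\<mu>) = (\<integral>x. f x \<partial>\<mu>)" if "continuous_on UNIV f" for f
  proof -
    have "(\<integral>x. transfer_op \<sigma> \<psi> (\<lambda>x. complex_of_real (f x)) x \<partial>\<mu>) = (\<integral>x. complex_of_real (f x) \<partial>\<mu>)"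
      using assms(9) that by (auto simp: dual_invariant_def intro: continuous_intros)
    then have "complex_of_real (\<integral>x. ruelle f x \<partial>\<mu>) = complex_of_real (\<integral>x. f x \<partial>\<mu>)" by (simp add: tr)
    then show ?thesis by simp
  qed
  interpret conformal_measure d \<sigma> e0 \<psi> M \<delta> C \<mu>
    unfolding conformal_measure_def conformal_measure_axioms_def
    using bowen_potential_axioms assms(6,7) dual by blast
  have m: "continuous_on UNIV m" "transfer_op \<sigma> \<psi> (\<lambda>x. complex_of_real ((cmod (m x))\<^sup>2)) = (\<lambda>_. 1)"
    using assms(14) by (auto simp: potential_filter_def)
  have "ruelle (\<lambda>x. (cmod (m x))\<^sup>2) x = 1" for x
    using fun_cong[OF m(2), of x] unfolding tr by (metis of_real_eq_1_iff)
  then interpret filter_representation d \<sigma> e0 \<psi> M \<delta> C \<mu> H B L m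
    by unfold_locales (use m assms(13) in auto)
  have "\<not> (AE x in \<mu>. cmod (m x) = 1)"
  proof
    assume "AE x in \<mu>. cmod (m x) = 1"
    then have "AE x in \<mu>. \<not> (cmod (m x) \<noteq> 1)" by simp
    then have "measure \<mu> {x \<in> space \<mu>. cmod (m x) \<noteq> 1} = 0" by (rule prob_eq_0_AE)
    then show False using assms(15) sets_eq_imp_space_eq[OF assms(6)] by simp
  qed
  then show ?thesis by (rule pure_S[OF assms(16)])
qed

end
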